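(* Let $R$ be a commutative ring. A functor of $\mathcal R$-modules $\mathbb C$ is a functor of coalgebras if and only if $\mathbb C^*$ is a functor of $\mathcal R$-algebras. In particular, an $R$-module $C$ is an $R$-coalgebra if and only if $\mathcal C^*$ is a functor of $\mathcal R$-algebras.
   Context: $R$ is a commutative ring with unit. All functors are covariant functors from the category of commutative $R$-algebras to sets. $\mathcal R$ is the functor of rings $\mathcal R(S)=S$. A functor of $\mathcal R$-modules is a functor $\mathbb M$ with morphisms of functors $\mathbb M\times\mathbb M\to\mathbb M$, $\mathcal R\times\mathbb M\to\mathbb M$ making each $\mathbb M(S)$ an $S$-module; morphisms are $S$-linear for each $S$. $\mathbb M^*(S)=\mathrm{Hom}_{\mathcal S}(\mathbb M_{|S},\mathcal S)$, where $_{|S}$ is restriction to commutative $S$-algebras. Tensor products are pointwise. For an $R$-module $C$, $\mathcal C(S)=C\otimes_RS$. "Is a functor of coalgebras/algebras" means that it carries such a structure with its given $\mathcal R$-module structure. A functor of $\mathcal R$-algebras is a functor of (associative, unital) rings $\mathbb A$ with a morphism of functors of rings $\mathcal R\to\mathbb A$ such that the image of $S$ is central in $\mathbb A(S)$ for all $S$. $\mathbb M_1\tilde\otimes\cdots\tilde\otimes\mathbb M_n:=(\mathbb M_1^*\otimes_{\mathcal R}\cdots\otimes_{\mathcal R}\mathbb M_n^* )^*$. A functor of coalgebras is a functor of $\mathcal R$-modules $\mathbb C$ with a morphism of $\mathcal R$-modules $m':\mathbb C\to\mathbb C\tilde\otimes\mathbb C$ that is coassociative, $(m'\tilde\otimes\mathrm{Id})\circ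 m'=(\mathrm{Id}\tilde\otimes m')\circ m'$ as morphisms $\mathbb C\to\mathbb C\tilde\otimes\mathbb C\tilde\otimes\mathbb C$, and a counit, i.e. a morphism of $\mathcal R$-modules $u':\mathbb C\to\mathcal R$ such that $(u'\tilde\otimes\mathrm{Id})\circ m'=\mathrm{Id}=(\mathrm{Id}\tilde\otimes u')\circ m'$, where $u'\tilde\otimes\mathrm{Id}:\mathbb C\tilde\otimes\mathbb C\to\mathcal R\tilde\otimes\mathbb C=\mathbb C^{**}$ and similarly $\mathrm{Id}\tilde\otimes u'$, and $\mathrm{Id}$ in the middle denotes the canonical morphism $\mathbb C\to\mathbb C^{**}$ (the identity of $\mathbb C$ if $\mathbb C$ is reflexive). Here, if $m:\mathbb C^*\otimes\mathbb C^*\to\mathbb C^*$ is the morphism corresponding to $m'$ under $\mathrm{Hom}_{\mathcal R}(\mathbb C^*\otimes\mathbb C^*,\mathbb C^* )=\mathrm{Hom}_{\mathcal R}(\mathbb C,(\mathbb C^*\otimes\mathbb C^* )^* )$, then $m'\tilde\otimes\mathrm{Id}=(m\otimes\mathrm{Id})^*$ and $\mathrm{Id}\tilde\otimes m'=(\mathrm{Id}\otimes m)^*$; likewise $u'\tilde\otimes\mathrm{Id}=(u\otimes\mathrm{Id})^*$ and $\mathrm{Id}\tilde\otimes u'=(\mathrm{Id}\otimes u)^*$ for $u:\mathcal R\to\mathbb C^*$ corresponding to $u'$. *)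

theory Defs
  imports "HOL-Algebra.Module" "HOL-Algebra.AbelCoset" "HOL-Library.Equipollence"
begin

section \<open>Linear maps and tensor products of modules over a commutative ring\<close>

definition lin_hom :: "'r ring \<Rightarrow> ('r, 'm) module \<Rightarrow> ('r, 'n) module \<Rightarrow> ('m \<Rightarrow> 'n) set" where
  "lin_hom R M N = {h \<in> carrier M \<rightarrow> carrier N.
     (\<forall>x\<in>carrier M. \<forall>y\<in>carrier M. h (x \<oplus>\<^bsub>M\<^esub> y) = h x \<oplus>\<^bsub>N\<^esub> h y) \<and>
     (\<forall>a\<in>carrier R. \<forall>x\<in>carrier M. h (a \<odot>\<^bsub>M\<^esub> x) = a \<odot>\<^bsub>N\<^esub> h x)}"

definition ring_as_module :: "'r ring \<Rightarrow> ('r, 'r) module" where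
  "ring_as_module R = \<lparr>carrier = carrier R, mult = mult R, one = one R,
     zero = zero R, add = add R, smult = mult R\<rparr>"

definition restrict_scalars :: "('r \<Rightarrow> 'r) \<Rightarrow> ('r, 'm) module \<Rightarrow> ('r, 'm) module" where
  "restrict_scalars f M = M\<lparr>smult := \<lambda>a. smult M (f a)\<rparr>"

text \<open>The record type \<open>module\<close> extends \<open>ring\<close>; the fields \<open>mult\<close> and \<open>one\<close> play no role for
  modules and are left \<open>undefined\<close> where there is no canonical choice.\<close>

definition free_module :: "'r ring \<Rightarrow> 'x set \<Rightarrow> ('r, 'x \<Rightarrow> 'r) module" where
  "free_module R X = \<lparr>
     carrier = {g. range g \<subseteq> carrier R \<and> finite {x. g x \<noteq> \<zero>\<^bsub>R\<^esub>} \<and> {x. g x \<noteq> \<zero>\<^bsub>R\<^esub>} \<subseteq> X},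
     mult = undefined, one = undefined,
     zero = (\<lambda>x. \<zero>\<^bsub>R\<^esub>), add = (\<lambda>g h x. g x \<oplus>\<^bsub>R\<^esub> h x), smult = (\<lambda>a g x. a \<otimes>\<^bsub>R\<^esub> g x)\<rparr>"

definition free_gen :: "'r ring \<Rightarrow> 'x \<Rightarrow> 'x \<Rightarrow> 'r" where
  "free_gen R p = (\<lambda>q. if q = p then \<one>\<^bsub>R\<^esub> else \<zero>\<^bsub>R\<^esub>)"

definition submodule_span :: "'r ring \<Rightarrow> ('r, 'm) module \<Rightarrow> 'm set \<Rightarrow> 'm set" where
  "submodule_span R M X = \<Inter>{H. submodule H R M \<and> X \<subseteq> H}"

definition quotient_module :: "'r ring \<Rightarrow> ('r, 'm) module \<Rightarrow> 'm set \<Rightarrow> ('r, 'm set) module" where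
  "quotient_module R M H = \<lparr>
     carrier = a_rcosets\<^bsub>M\<^esub> H,
     mult = undefined, one = undefined,
     zero = H, add = set_add M, smult = (\<lambda>a X. \<Union>x\<in>X. H +>\<^bsub>M\<^esub> (a \<odot>\<^bsub>M\<^esub> x))\<rparr>"

definition tensor_relators ::
    "'r ring \<Rightarrow> ('r, 'm) module \<Rightarrow> ('r, 'n) module \<Rightarrow> ('m \<times> 'n \<Rightarrow> 'r) set" where
  "tensor_relators R M N = (let F = free_module R (carrier M \<times> carrier N); e = free_gen R in
     {e (x \<oplus>\<^bsub>M\<^esub> x', y) \<ominus>\<^bsub>F\<^esub> (e (x, y) \<oplus>\<^bsub>F\<^esub> e (x', y)) | x x' y.
        x \<in> carrier M \<and> x' \<in> carrier M \<and> y \<in> carrier N} \<union>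
     {e (x, y \<oplus>\<^bsub>N\<^esub> y') \<ominus>\<^bsub>F\<^esub> (e (x, y) \<oplus>\<^bsub>F\<^esub> e (x, y')) | x y y'.
        x \<in> carrier M \<and> y \<in> carrier N \<and> y' \<in> carrier N} \<union>
     {e (a \<odot>\<^bsub>M\<^esub> x, y) \<ominus>\<^bsub>F\<^esub> a \<odot>\<^bsub>F\<^esub> e (x, y) | a x y.
        a \<in> carrier R \<and> x \<in> carrier M \<and> y \<in> carrier N} \<union>
     {e (x, a \<odot>\<^bsub>N\<^esub> y) \<ominus>\<^bsub>F\<^esub> a \<odot>\<^bsub>F\<^esub> e (x, y) | a x y.
        a \<in> carrier R \<and> x \<in> carrier M \<and> y \<in> carrier N})"

definition tensor_kernel ::
    "'r ring \<Rightarrow> ('r, 'm) module \<Rightarrow> ('r, 'n) module \<Rightarrow> ('m \<times> 'n \<Rightarrow> 'r) set" where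
  "tensor_kernel R M N =
     submodule_span R (free_module R (carrier M \<times> carrier N)) (tensor_relators R M N)"

definition tensor ::
    "'r ring \<Rightarrow> ('r, 'm) module \<Rightarrow> ('r, 'n) module \<Rightarrow> ('r, ('m \<times> 'n \<Rightarrow> 'r) set) module" where
  "tensor R M N =
     quotient_module R (free_module R (carrier M \<times> carrier N)) (tensor_kernel R M N)"

definition pure_tensor ::
    "'r ring \<Rightarrow> ('r, 'm) module \<Rightarrow> ('r, 'n) module \<Rightarrow> 'm \<Rightarrow> 'n \<Rightarrow> ('m \<times> 'n \<Rightarrow> 'r) set" where
  "pure_tensor R M N x y =
     tensor_kernel R M N +>\<^bsub>free_module R (carrier M \<times> carrier N)\<^esub> free_gen R (x, y)"

text \<open>The linear map from a tensor product to \<open>P\<close> induced by a bilinear map \<open>b\<close>. It is computed on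
  a representative, the choice of which is irrelevant when \<open>b\<close> is bilinear.\<close>

definition tensor_lift ::
    "'r ring \<Rightarrow> ('r, 'p) module \<Rightarrow> ('m \<Rightarrow> 'n \<Rightarrow> 'p) \<Rightarrow> ('m \<times> 'n \<Rightarrow> 'r) set \<Rightarrow> 'p" where
  "tensor_lift R P b X = (let g = (SOME g. g \<in> X) in
     finsum P (\<lambda>(x, y). g (x, y) \<odot>\<^bsub>P\<^esub> b x y) {p. g p \<noteq> \<zero>\<^bsub>R\<^esub>})"

text \<open>\<open>tensor_hom R M' N' f g\<close> is \<open>f \<otimes> g\<close>, where \<open>M'\<close> and \<open>N'\<close> are the codomains.\<close>

definition tensor_hom :: "'r ring \<Rightarrow> ('r, 'm2) module \<Rightarrow> ('r, 'n2) module \<Rightarrow>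
    ('m \<Rightarrow> 'm2) \<Rightarrow> ('n \<Rightarrow> 'n2) \<Rightarrow> ('m \<times> 'n \<Rightarrow> 'r) set \<Rightarrow> ('m2 \<times> 'n2 \<Rightarrow> 'r) set" where
  "tensor_hom R M' N' f g =
     tensor_lift R (tensor R M' N') (\<lambda>x y. pure_tensor R M' N' (f x) (g y))"

definition tensor_assoc :: "'r ring \<Rightarrow> ('r, 'm) module \<Rightarrow> ('r, 'n) module \<Rightarrow> ('r, 'p) module \<Rightarrow>
    (('m \<times> 'n \<Rightarrow> 'r) set \<times> 'p \<Rightarrow> 'r) set \<Rightarrow> ('m \<times> ('n \<times> 'p \<Rightarrow> 'r) set \<Rightarrow> 'r) set" where
  "tensor_assoc R M N P = (let T = tensor R M (tensor R N P) in
     tensor_lift R T (\<lambda>t z. tensor_lift R T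
       (\<lambda>x y. pure_tensor R M (tensor R N P) x (pure_tensor R N P y z)) t))"


section \<open>Coalgebras\<close>

definition is_coalgebra :: "'r ring \<Rightarrow> ('r, 'c) module \<Rightarrow> bool" where
  "is_coalgebra R C \<longleftrightarrow> module R C \<and> (\<exists>\<Delta> \<epsilon>.
     \<Delta> \<in> lin_hom R C (tensor R C C) \<and>
     \<epsilon> \<in> lin_hom R C (ring_as_module R) \<and>
     (\<forall>c\<in>carrier C.
        tensor_assoc R C C C (tensor_hom R (tensor R C C) C \<Delta> (\<lambda>x. x) (\<Delta> c)) =
        tensor_hom R C (tensor R C C) (\<lambda>x. x) \<Delta> (\<Delta> c)) \<and>
     (\<forall>c\<in>carrier C. tensor_hom R (ring_as_module R) C \<epsilon> (\<lambda>x. x) (\<Delta> c) =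
        pure_tensor R (ring_as_module R) C \<one>\<^bsub>R\<^esub> c) \<and>
     (\<forall>c\<in>carrier C. tensor_hom R C (ring_as_module R) (\<lambda>x. x) \<epsilon> (\<Delta> c) =
        pure_tensor R C (ring_as_module R) c \<one>\<^bsub>R\<^esub>))"


section \<open>The category of commutative algebras\<close>

text \<open>An algebra is a ring together with its structure map. The type \<open>'u\<close> acts as the universe: the
  category of commutative \<open>R\<close>-algebras consists of all those whose carrier is a set of elements of
  \<open>'u\<close>. For an infinite \<open>'u\<close> these are, up to isomorphism, all commutative \<open>R\<close>-algebras of
  cardinality at most that of \<open>'u\<close>. The values of functors may lie in any type. Structure maps and homomorphisms are \<open>extensional\<close>, so that morphisms that agree on the
  carrier are equal.\<close>

type_synonym 'u alg = "'u ring \<times> ('u \<Rightarrow> 'u)"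

definition Calg :: "'u ring \<Rightarrow> 'u alg set" where
  "Calg R = {S. cring (fst S) \<and> snd S \<in> ring_hom R (fst S) \<and> snd S \<in> extensional (carrier R)}"

definition alg_hom :: "'u ring \<Rightarrow> 'u alg \<Rightarrow> 'u alg \<Rightarrow> ('u \<Rightarrow> 'u) set" where
  "alg_hom R S T = {f \<in> ring_hom (fst S) (fst T). f \<in> extensional (carrier (fst S)) \<and>
     compose (carrier R) f (snd S) = snd T}"

text \<open>\<open>self_alg S\<close> is \<open>S\<close> as an algebra over itself, and \<open>base_alg R S T\<close> is the \<open>R\<close>-algebra
  underlying an algebra \<open>T\<close> over (the ring of) the \<open>R\<close>-algebra \<open>S\<close>.\<close>

definition self_alg :: "'u ring \<Rightarrow> 'u alg" where
  "self_alg S = (S, \<lambda>s\<in>carrier S. s)"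

definition base_alg :: "'u ring \<Rightarrow> 'u alg \<Rightarrow> 'u alg \<Rightarrow> 'u alg" where
  "base_alg R S T = (fst T, compose (carrier R) (snd T) (snd S))"


section \<open>Functors of modules\<close>

locale set_functor =
  fixes R :: "'u ring" and X :: "'u alg \<Rightarrow> 'm set"
    and F :: "'u alg \<Rightarrow> 'u alg \<Rightarrow> ('u \<Rightarrow> 'u) \<Rightarrow> 'm \<Rightarrow> 'm"
  assumes map_closed: "\<lbrakk>S \<in> Calg R; T \<in> Calg R; f \<in> alg_hom R S T; x \<in> X S\<rbrakk> \<Longrightarrow> F S T f x \<in> X T"
    and map_id: "\<lbrakk>S \<in> Calg R; x \<in> X S\<rbrakk> \<Longrightarrow> F S S (\<lambda>s\<in>carrier (fst S). s) x = x"
    and map_comp: "\<lbrakk>S \<in> Calg R; T \<in> Calg R; U \<in> Calg R; f \<in> alg_hom R S T; g \<in> alg_hom R T U;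
      x \<in> X S\<rbrakk> \<Longrightarrow> F S U (compose (carrier (fst S)) g f) x = F T U g (F S T f x)"

record ('u, 'm) mfun =
  Ob :: "'u alg \<Rightarrow> ('u, 'm) module"
  Ar :: "'u alg \<Rightarrow> 'u alg \<Rightarrow> ('u \<Rightarrow> 'u) \<Rightarrow> 'm \<Rightarrow> 'm"

locale module_functor = set_functor R "\<lambda>S. carrier (Ob M S)" "Ar M"
  for R :: "'u ring" and M :: "('u, 'm) mfun" +
  assumes module: "S \<in> Calg R \<Longrightarrow> module (fst S) (Ob M S)"
    and map_add: "\<lbrakk>S \<in> Calg R; T \<in> Calg R; f \<in> alg_hom R S T;
      x \<in> carrier (Ob M S); y \<in> carrier (Ob M S)\<rbrakk> \<Longrightarrow>
      Ar M S T f (x \<oplus>\<^bsub>Ob M S\<^esub> y) = Ar M S T f x \<oplus>\<^bsub>Ob M T\<^esub> Ar M S T f y"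
    and map_smult: "\<lbrakk>S \<in> Calg R; T \<in> Calg R; f \<in> alg_hom R S T;
      a \<in> carrier (fst S); x \<in> carrier (Ob M S)\<rbrakk> \<Longrightarrow>
      Ar M S T f (a \<odot>\<^bsub>Ob M S\<^esub> x) = f a \<odot>\<^bsub>Ob M T\<^esub> Ar M S T f x"

definition module_morphism ::
    "'u ring \<Rightarrow> ('u, 'm) mfun \<Rightarrow> ('u, 'n) mfun \<Rightarrow> ('u alg \<Rightarrow> 'm \<Rightarrow> 'n) \<Rightarrow> bool" where
  "module_morphism R M N \<alpha> \<longleftrightarrow>
     (\<forall>S\<in>Calg R. \<alpha> S \<in> lin_hom (fst S) (Ob M S) (Ob N S)) \<and>
     (\<forall>S\<in>Calg R. \<forall>T\<in>Calg R. \<forall>f\<in>alg_hom R S T. \<forall>x\<in>carrier (Ob M S).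
        \<alpha> T (Ar M S T f x) = Ar N S T f (\<alpha> S x))"

definition ring_mfun :: "('u, 'u) mfun" where
  "ring_mfun = \<lparr>Ob = (\<lambda>S. ring_as_module (fst S)), Ar = (\<lambda>S T f. f)\<rparr>"

definition restr_mfun :: "'u ring \<Rightarrow> 'u alg \<Rightarrow> ('u, 'm) mfun \<Rightarrow> ('u, 'm) mfun" where
  "restr_mfun R S M = \<lparr>Ob = (\<lambda>T. Ob M (base_alg R S T)),
     Ar = (\<lambda>T U. Ar M (base_alg R S T) (base_alg R S U))\<rparr>"

text \<open>The elements of the dual at \<open>S\<close> are the morphisms of functors of modules from the restriction
  of \<open>M\<close> to \<open>S\<close>-algebras to the functor of rings, made extensional.\<close>

definition dual_carrier :: "'u ring \<Rightarrow> ('u, 'm) mfun \<Rightarrow> 'u alg \<Rightarrow> ('u alg \<Rightarrow> 'm \<Rightarrow> 'u) set" where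
  "dual_carrier R M S =
     {w. module_morphism (fst S) (restr_mfun R S M) ring_mfun w \<and> w \<in> extensional (Calg (fst S)) \<and>
         (\<forall>T\<in>Calg (fst S). w T \<in> extensional (carrier (Ob M (base_alg R S T))))}"

definition dual :: "'u ring \<Rightarrow> ('u, 'm) mfun \<Rightarrow> ('u, 'u alg \<Rightarrow> 'm \<Rightarrow> 'u) mfun" where
  "dual R M = \<lparr>
     Ob = (\<lambda>S. \<lparr>
       carrier = dual_carrier R M S,
       mult = undefined, one = undefined,
       zero = (\<lambda>T\<in>Calg (fst S). \<lambda>x\<in>carrier (Ob M (base_alg R S T)). \<zero>\<^bsub>fst T\<^esub>),
       add = (\<lambda>v w. \<lambda>T\<in>Calg (fst S). \<lambda>x\<in>carrier (Ob M (base_alg R S T)).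
                v T x \<oplus>\<^bsub>fst T\<^esub> w T x),
       smult = (\<lambda>s w. \<lambda>T\<in>Calg (fst S). \<lambda>x\<in>carrier (Ob M (base_alg R S T)).
                snd T s \<otimes>\<^bsub>fst T\<^esub> w T x)\<rparr>),
     Ar = (\<lambda>S S' f w. \<lambda>T\<in>Calg (fst S'). w (fst T, compose (carrier (fst S)) (snd T) f))\<rparr>"

definition dual_map ::
    "'u ring \<Rightarrow> ('u, 'm) mfun \<Rightarrow> ('u alg \<Rightarrow> 'm \<Rightarrow> 'n) \<Rightarrow>
     'u alg \<Rightarrow> ('u alg \<Rightarrow> 'n \<Rightarrow> 'u) \<Rightarrow> ('u alg \<Rightarrow> 'm \<Rightarrow> 'u)" where
  "dual_map R M \<alpha> S w = (\<lambda>T\<in>Calg (fst S). \<lambda>x\<in>carrier (Ob M (base_alg R S T)).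
     w T (\<alpha> (base_alg R S T) x))"

text \<open>The canonical morphism from \<open>M\<close> to its bidual.\<close>

definition bidual_can ::
    "'u ring \<Rightarrow> ('u, 'm) mfun \<Rightarrow> 'u alg \<Rightarrow> 'm \<Rightarrow> ('u alg \<Rightarrow> ('u alg \<Rightarrow> 'm \<Rightarrow> 'u) \<Rightarrow> 'u)" where
  "bidual_can R M S x = (\<lambda>T\<in>Calg (fst S). \<lambda>w\<in>carrier (Ob (dual R M) (base_alg R S T)).
     w (self_alg (fst T)) (Ar M S (base_alg R S T) (snd T) x))"

text \<open>The morphism from \<open>N\<close> to the dual of \<open>M\<close> that corresponds to a morphism \<open>\<phi>\<close> from \<open>M\<close> to the
  dual of \<open>N\<close>.\<close>

definition dual_flip ::
    "'u ring \<Rightarrow> ('u, 'm) mfun \<Rightarrow> ('u, 'n) mfun \<Rightarrow> ('u alg \<Rightarrow> 'm \<Rightarrow> ('u alg \<Rightarrow> 'n \<Rightarrow> 'u)) \<Rightarrow>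
     'u alg \<Rightarrow> 'n \<Rightarrow> ('u alg \<Rightarrow> 'm \<Rightarrow> 'u)" where
  "dual_flip R M N \<phi> S y = (\<lambda>T\<in>Calg (fst S). \<lambda>x\<in>carrier (Ob M (base_alg R S T)).
     \<phi> (base_alg R S T) x (self_alg (fst T)) (Ar N S (base_alg R S T) (snd T) y))"

text \<open>The morphism from the functor of rings to the dual of \<open>M\<close> that corresponds to a morphism \<open>\<phi>\<close>
  from \<open>M\<close> to the functor of rings, i.e. to an element of the dual at the base ring.\<close>

definition dual_point ::
    "'u ring \<Rightarrow> ('u, 'm) mfun \<Rightarrow> ('u alg \<Rightarrow> 'm \<Rightarrow> 'u) \<Rightarrow> 'u alg \<Rightarrow> 'u \<Rightarrow> ('u alg \<Rightarrow> 'm \<Rightarrow> 'u)" where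
  "dual_point R M \<phi> S s = (\<lambda>T\<in>Calg (fst S). \<lambda>x\<in>carrier (Ob M (base_alg R S T)).
     snd T s \<otimes>\<^bsub>fst T\<^esub> \<phi> (base_alg R S T) x)"

definition tensor_mfun :: "('u, 'm) mfun \<Rightarrow> ('u, 'n) mfun \<Rightarrow> ('u, ('m \<times> 'n \<Rightarrow> 'u) set) mfun" where
  "tensor_mfun M N = \<lparr>
     Ob = (\<lambda>S. tensor (fst S) (Ob M S) (Ob N S)),
     Ar = (\<lambda>S T f. tensor_lift (fst S)
       (restrict_scalars f (tensor (fst T) (Ob M T) (Ob N T)))
       (\<lambda>x y. pure_tensor (fst T) (Ob M T) (Ob N T) (Ar M S T f x) (Ar N S T f y)))\<rparr>"

definition tensor_mfun_map :: "('u, 'm2) mfun \<Rightarrow> ('u, 'n2) mfun \<Rightarrow>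
    ('u alg \<Rightarrow> 'm \<Rightarrow> 'm2) \<Rightarrow> ('u alg \<Rightarrow> 'n \<Rightarrow> 'n2) \<Rightarrow>
    'u alg \<Rightarrow> ('m \<times> 'n \<Rightarrow> 'u) set \<Rightarrow> ('m2 \<times> 'n2 \<Rightarrow> 'u) set" where
  "tensor_mfun_map M' N' \<alpha> \<beta> S = tensor_hom (fst S) (Ob M' S) (Ob N' S) (\<alpha> S) (\<beta> S)"

definition tensor_mfun_assoc :: "('u, 'm) mfun \<Rightarrow> ('u, 'n) mfun \<Rightarrow> ('u, 'p) mfun \<Rightarrow>
    'u alg \<Rightarrow> (('m \<times> 'n \<Rightarrow> 'u) set \<times> 'p \<Rightarrow> 'u) set \<Rightarrow> ('m \<times> ('n \<times> 'p \<Rightarrow> 'u) set \<Rightarrow> 'u) set" where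
  "tensor_mfun_assoc M N P S = tensor_assoc (fst S) (Ob M S) (Ob N S) (Ob P S)"

text \<open>The functor of modules with value \<open>C \<otimes> S\<close> at \<open>S\<close>, where \<open>S\<close> acts on the second factor.\<close>

definition quasi_coherent ::
    "'u ring \<Rightarrow> ('u, 'c) module \<Rightarrow> ('u, ('c \<times> 'u \<Rightarrow> 'u) set) mfun" where
  "quasi_coherent R C = (let
       SM = (\<lambda>S. restrict_scalars (snd S) (ring_as_module (fst S)));
       CS = (\<lambda>S. tensor R C (SM S))
     in \<lparr>
       Ob = (\<lambda>S. (CS S)\<lparr>smult := \<lambda>s. tensor_hom R C (SM S) (\<lambda>c. c) (\<lambda>t. s \<otimes>\<^bsub>fst S\<^esub> t)\<rparr>),
       Ar = (\<lambda>S T f. tensor_hom R C (SM T) (\<lambda>c. c) f)\<rparr>)"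


section \<open>Functors of algebras and functors of coalgebras\<close>

locale ring_functor = set_functor R "\<lambda>S. carrier (A S)" F
  for R :: "'u ring" and A :: "'u alg \<Rightarrow> ('m, 'x) ring_scheme" and F +
  assumes ring: "S \<in> Calg R \<Longrightarrow> ring (A S)"
    and map_ring_hom: "\<lbrakk>S \<in> Calg R; T \<in> Calg R; f \<in> alg_hom R S T\<rbrakk> \<Longrightarrow>
      F S T f \<in> ring_hom (A S) (A T)"

locale algebra_functor = ring_functor R A F
  for R :: "'u ring" and A :: "'u alg \<Rightarrow> ('m, 'x) ring_scheme" and F
    and \<eta> :: "'u alg \<Rightarrow> 'u \<Rightarrow> 'm" +
  assumes unit_hom: "S \<in> Calg R \<Longrightarrow> \<eta> S \<in> ring_hom (fst S) (A S)"
    and unit_natural: "\<lbrakk>S \<in> Calg R; T \<in> Calg R; f \<in> alg_hom R S T; s \<in> carrier (fst S)\<rbrakk> \<Longrightarrow>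
      \<eta> T (f s) = F S T f (\<eta> S s)"
    and unit_central: "\<lbrakk>S \<in> Calg R; s \<in> carrier (fst S); x \<in> carrier (A S)\<rbrakk> \<Longrightarrow>
      \<eta> S s \<otimes>\<^bsub>A S\<^esub> x = x \<otimes>\<^bsub>A S\<^esub> \<eta> S s"

text \<open>\<open>M\<close> carries a structure of a functor of algebras that induces its given module structure: the
  multiplication and the unit are supplied on the modules \<open>Ob M S\<close>, whose addition and
  zero are kept.\<close>

definition is_algebra_functor :: "'u ring \<Rightarrow> ('u, 'm) mfun \<Rightarrow> bool" where
  "is_algebra_functor R M \<longleftrightarrow> (\<exists>\<mu> e \<eta>.
     let A = (\<lambda>S. (Ob M S)\<lparr>mult := \<mu> S, one := e S\<rparr>) in
       algebra_functor R A (Ar M) \<eta> \<and>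
       (\<forall>S\<in>Calg R. \<forall>s\<in>carrier (fst S). \<forall>x\<in>carrier (Ob M S).
          \<eta> S s \<otimes>\<^bsub>A S\<^esub> x = s \<odot>\<^bsub>Ob M S\<^esub> x))"

definition tensor_tilde :: "'u ring \<Rightarrow> ('u, 'm) mfun \<Rightarrow> ('u, 'n) mfun \<Rightarrow>
    ('u, 'u alg \<Rightarrow> (('u alg \<Rightarrow> 'm \<Rightarrow> 'u) \<times> ('u alg \<Rightarrow> 'n \<Rightarrow> 'u) \<Rightarrow> 'u) set \<Rightarrow> 'u) mfun" where
  "tensor_tilde R M N = dual R (tensor_mfun (dual R M) (dual R N))"

text \<open>Below \<open>D\<close> is the dual of \<open>C\<close>, and \<open>\<Delta>\<close> and \<open>\<epsilon>\<close> are the comultiplication and the counit, with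
  corresponding morphisms \<open>m\<close> and \<open>u\<close>. The triple tensor product is bracketed to the left, and
  \<open>dual_map\<close> of the associator identifies the dual of the other bracketing with its dual. The functor
  of rings \<open>\<R>\<close> is identified with its own dual, and the duals of \<open>\<R> \<otimes> D\<close> and \<open>D \<otimes> \<R>\<close> are identified with the bidual of \<open>C\<close> through \<open>w \<mapsto> 1 \<otimes> w\<close> and
  \<open>w \<mapsto> w \<otimes> 1\<close>.\<close>

definition is_coalgebra_functor :: "'u ring \<Rightarrow> ('u, 'm) mfun \<Rightarrow> bool" where
  "is_coalgebra_functor R C \<longleftrightarrow> module_functor R C \<and> (\<exists>\<Delta> \<epsilon>.
     module_morphism R C (tensor_tilde R C C) \<Delta> \<and>
     module_morphism R C ring_mfun \<epsilon> \<and>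
     (let D = dual R C;
          D2 = tensor_mfun D D;
          m = dual_flip R C D2 \<Delta>;
          u = dual_point R C \<epsilon>
      in \<forall>S\<in>Calg R. \<forall>x\<in>carrier (Ob C S).
        dual_map R (tensor_mfun D2 D) (tensor_mfun_map D D m (\<lambda>_ w. w)) S (\<Delta> S x) =
        dual_map R (tensor_mfun D2 D) (tensor_mfun_assoc D D D) S
          (dual_map R (tensor_mfun D D2) (tensor_mfun_map D D (\<lambda>_ w. w) m) S (\<Delta> S x)) \<and>
        dual_map R D (\<lambda>T. pure_tensor (fst T) (Ob ring_mfun T) (Ob D T) \<one>\<^bsub>fst T\<^esub>) S
          (dual_map R (tensor_mfun ring_mfun D) (tensor_mfun_map D D u (\<lambda>_ w. w)) S (\<Delta> S x)) =
        bidual_can R C S x \<and>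
        dual_map R D (\<lambda>T w. pure_tensor (fst T) (Ob D T) (Ob ring_mfun T) w \<one>\<^bsub>fst T\<^esub>) S
          (dual_map R (tensor_mfun D ring_mfun) (tensor_mfun_map D D (\<lambda>_ w. w) u) S (\<Delta> S x)) =
        bidual_can R C S x))"

end

theory Submission
  imports Defs "HOL-Algebra.Free_Abelian_Groups"
begin

text \<open>For the first equivalence, a morphism \<open>\<Delta>: M \<rightarrow> (M\<^sup>* \<otimes> M\<^sup>*)\<^sup>*\<close> is the same as a bilinear map \<open>m\<close> on
  \<open>M\<^sup>*\<close>: the value of \<open>\<Delta>(x)\<close> at \<open>z\<close> is the value of \<open>m(z)\<close> at \<open>x\<close>. Under this exchange the coalgebra
  axioms for \<open>\<Delta>\<close> become the algebra axioms for \<open>m\<close>.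

  For the second, the dual of the functor of \<open>C\<close> is \<open>S \<mapsto> Hom\<^sub>R(C, S)\<close>, on which a coalgebra structure
  on \<open>C\<close> induces the convolution product. Conversely, let \<open>S\<^sub>1 = R \<oplus> C\<close> and \<open>S\<^sub>2 = S\<^sub>1 \<oplus> (C \<otimes> S\<^sub>1)\<close> be
  trivial square-zero extensions. The product of the two obvious maps \<open>C \<rightarrow> S\<^sub>2\<close> vanishes after either
  map is killed, hence takes values in the summand \<open>C \<otimes> C\<close> of \<open>S\<^sub>2\<close>; this is the comultiplication.
  Naturality gives the product of any two maps with square-zero image, and dual numbers remove this
  restriction. Coassociativity is then read off in a third extension \<open>S\<^sub>3 = S\<^sub>2 \<oplus> (C \<otimes> S\<^sub>2)\<close>, which
  contains \<open>C \<otimes> C \<otimes> C\<close>, and the counit laws in \<open>S\<^sub>1\<close>. The cardinality hypotheses ensure that these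
  algebras exist in the universe.\<close>

section \<open>Tensor products\<close>

text \<open>Pairs of linear maps from C into commutative algebras are represented by Sym(C + C),
  where a comultiplication would have to be isolated in bidegree (1,1). The truncation is taken at
  once instead: as C \<otimes> S1 = C + C \<otimes> C, the algebra S2 is R + C + C + C \<otimes> C,
  the tensor product of two copies of S1, and it represents pairs of maps whose images have square
  zero. In the same way S3 is the tensor product of three copies of S1. Presenting them as iterated
  extensions avoids both symmetric algebras and products on tensor products of algebras. A product
  on the dual is natural only along algebras coded in the type \<open>'u\<close>, so each test
  algebra must be coded there. An infinite \<open>'u\<close> absorbs pairs and finite lists, hence
  sums S + N and tensor products C \<otimes> S. The first equivalence works without test algebras:
  an element of a dual is determined by its values at base changes regarded as algebras over
  themselves, and there the exchange of arguments between \<Delta> and m is literal.\<close>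

lemma lin_homI:
  assumes "\<And>x. x \<in> carrier M \<Longrightarrow> h x \<in> carrier N"
    and "\<And>x y. \<lbrakk>x \<in> carrier M; y \<in> carrier M\<rbrakk> \<Longrightarrow> h (x \<oplus>\<^bsub>M\<^esub> y) = h x \<oplus>\<^bsub>N\<^esub> h y"
    and "\<And>a x. \<lbrakk>a \<in> carrier R; x \<in> carrier M\<rbrakk> \<Longrightarrow> h (a \<odot>\<^bsub>M\<^esub> x) = a \<odot>\<^bsub>N\<^esub> h x"
  shows "h \<in> lin_hom R M N"
  using assms by (auto simp: lin_hom_def)

lemma lin_hom_closed: "\<lbrakk>h \<in> lin_hom R M N; x \<in> carrier M\<rbrakk> \<Longrightarrow> h x \<in> carrier N"
  and lin_hom_add: "\<lbrakk>h \<in> lin_hom R M N; x \<in> carrier M; y \<in> carrier M\<rbrakk> \<Longrightarrow>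
    h (x \<oplus>\<^bsub>M\<^esub> y) = h x \<oplus>\<^bsub>N\<^esub> h y"
  and lin_hom_smult: "\<lbrakk>h \<in> lin_hom R M N; a \<in> carrier R; x \<in> carrier M\<rbrakk> \<Longrightarrow>
    h (a \<odot>\<^bsub>M\<^esub> x) = a \<odot>\<^bsub>N\<^esub> h x"
  by (auto simp: lin_hom_def)

text \<open>Zero is not mentioned in \<open>lin_hom\<close>; the scalar 0 acting on the zero vector
  supplies it.\<close>

lemma lin_hom_zero:
  assumes "module R M" "module R N" "h \<in> lin_hom R M N"
  shows "h \<zero>\<^bsub>M\<^esub> = \<zero>\<^bsub>N\<^esub>"
proof -
  interpret M: module R M by fact
  interpret N: module R N by fact
  have "h (\<zero>\<^bsub>R\<^esub> \<odot>\<^bsub>M\<^esub> \<zero>\<^bsub>M\<^esub>) = \<zero>\<^bsub>R\<^esub> \<odot>\<^bsub>N\<^esub> h \<zero>\<^bsub>M\<^esub>"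
    using assms(3) by (rule lin_hom_smult) auto
  then show ?thesis
    using lin_hom_closed[OF assms(3)] by simp
qed

lemma lin_hom_id: "(\<lambda>x. x) \<in> lin_hom R M M"
  by (rule lin_homI) auto

lemma lin_hom_comp:
  "\<lbrakk>g \<in> lin_hom R N P; f \<in> lin_hom R M N\<rbrakk> \<Longrightarrow> (\<lambda>x. g (f x)) \<in> lin_hom R M P"
  by (rule lin_homI) (auto simp: lin_hom_closed lin_hom_add lin_hom_smult)

text \<open>Only values on the carrier enter \<open>lin_hom\<close>, so a linear map may be
  exchanged for its extensional restriction, as happens throughout for elements of duals and of
  \<open>H\<close>.\<close>

lemma lin_hom_cong:
  assumes "module R M" "f \<in> lin_hom R M N" "\<And>x. x \<in> carrier M \<Longrightarrow> f x = g x"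
  shows "g \<in> lin_hom R M N"
proof -
  interpret M: module R M by fact
  show ?thesis
    using assms(2) by (intro lin_homI) (auto simp: assms(3)[symmetric] lin_hom_def)
qed

lemma lin_hom_sum:
  assumes "module R N" "f \<in> lin_hom R M N" "g \<in> lin_hom R M N"
  shows "(\<lambda>x. f x \<oplus>\<^bsub>N\<^esub> g x) \<in> lin_hom R M N"
proof -
  interpret N: module R N by fact
  note fg = lin_hom_closed[OF assms(2)] lin_hom_closed[OF assms(3)]
  show ?thesis
    by (rule lin_homI)
       (simp_all add: fg lin_hom_add[OF assms(2)] lin_hom_add[OF assms(3)]
         lin_hom_smult[OF assms(2)] lin_hom_smult[OF assms(3)] N.smult_r_distr N.M.a_ac)
qed

text \<open>Prepares \<open>tensor_lift_coset\<close>: once the tensor relators lie in such a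
  kernel, so does the submodule that they span.\<close>

lemma submodule_kernel:
  assumes "module R M" "module R N" "h \<in> lin_hom R M N"
  shows "submodule {x \<in> carrier M. h x = \<zero>\<^bsub>N\<^esub>} R M"
proof -
  interpret M: module R M by fact
  interpret N: module R N by fact
  have neg: "h (\<ominus>\<^bsub>M\<^esub> x) = \<ominus>\<^bsub>N\<^esub> h x" if "x \<in> carrier M" for x
  proof -
    have "h (\<ominus>\<^bsub>M\<^esub> x \<oplus>\<^bsub>M\<^esub> x) = h (\<ominus>\<^bsub>M\<^esub> x) \<oplus>\<^bsub>N\<^esub> h x"
      using that assms(3) by (intro lin_hom_add) auto
    then have "h (\<ominus>\<^bsub>M\<^esub> x) \<oplus>\<^bsub>N\<^esub> h x = \<zero>\<^bsub>N\<^esub>"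
      using that lin_hom_zero[OF assms] by (simp add: M.M.l_neg)
    then show ?thesis
      using that assms(3) by (intro N.M.minus_equality[symmetric]) (auto intro: lin_hom_closed)
  qed
  show ?thesis
    using assms(3) lin_hom_zero[OF assms]
    by (intro M.submoduleI) (auto simp: lin_hom_add lin_hom_smult neg)
qed

section \<open>Free modules and linear extension\<close>

lemma free_module_carrier:
  "g \<in> carrier (free_module R X) \<longleftrightarrow>
     (\<forall>x. g x \<in> carrier R) \<and> finite {x. g x \<noteq> \<zero>\<^bsub>R\<^esub>} \<and> {x. g x \<noteq> \<zero>\<^bsub>R\<^esub>} \<subseteq> X"
  by (auto simp: free_module_def)

lemma free_module_simps:
  "g \<oplus>\<^bsub>free_module R X\<^esub> h = (\<lambda>x. g x \<oplus>\<^bsub>R\<^esub> h x)"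
  "a \<odot>\<^bsub>free_module R X\<^esub> g = (\<lambda>x. a \<otimes>\<^bsub>R\<^esub> g x)"
  "\<zero>\<^bsub>free_module R X\<^esub> = (\<lambda>x. \<zero>\<^bsub>R\<^esub>)"
  by (auto simp: free_module_def)

lemma free_module:
  assumes "cring R"
  shows "module R (free_module R X)"
proof -
  interpret cring R by fact
  have add: "g \<oplus>\<^bsub>free_module R X\<^esub> h \<in> carrier (free_module R X)"
    if "g \<in> carrier (free_module R X)" "h \<in> carrier (free_module R X)" for g h
  proof -
    have "{x. g x \<oplus>\<^bsub>R\<^esub> h x \<noteq> \<zero>\<^bsub>R\<^esub>} \<subseteq> {x. g x \<noteq> \<zero>\<^bsub>R\<^esub>} \<union> {x. h x \<noteq> \<zero>\<^bsub>R\<^esub>}"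
      using that by (auto simp: free_module_carrier)
    then show ?thesis
      using that unfolding free_module_carrier free_module_simps
      by (auto intro: finite_subset)
  qed
  have smult: "a \<odot>\<^bsub>free_module R X\<^esub> g \<in> carrier (free_module R X)"
    if "a \<in> carrier R" "g \<in> carrier (free_module R X)" for a g
  proof -
    have "{x. a \<otimes>\<^bsub>R\<^esub> g x \<noteq> \<zero>\<^bsub>R\<^esub>} \<subseteq> {x. g x \<noteq> \<zero>\<^bsub>R\<^esub>}"
      using that by (auto simp: free_module_carrier)
    then show ?thesis
      using that unfolding free_module_carrier free_module_simps
      by (auto intro: finite_subset)
  qed
  \<comment> \<open>The inverse is taken to be -1 times x, so that closure under scalars already
    provides its finite support.\<close>
  have "\<exists>y\<in>carrier (free_module R X). y \<oplus>\<^bsub>free_module R X\<^esub> x = \<zero>\<^bsub>free_module R X\<^esub>"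
    if "x \<in> carrier (free_module R X)" for x
    using that smult[of "\<ominus>\<^bsub>R\<^esub> \<one>\<^bsub>R\<^esub>" x]
    by (intro bexI[of _ "(\<ominus>\<^bsub>R\<^esub> \<one>\<^bsub>R\<^esub>) \<odot>\<^bsub>free_module R X\<^esub> x"])
       (auto simp: free_module_simps free_module_carrier l_minus l_neg)
  then show ?thesis
    using add smult
    by (intro moduleI abelian_groupI assms)
       (auto simp: free_module_simps free_module_carrier a_ac l_distr r_distr m_assoc)
qed

lemma free_gen_closed: "\<lbrakk>cring R; p \<in> X\<rbrakk> \<Longrightarrow> free_gen R p \<in> carrier (free_module R X)"
  by (auto simp: free_module_carrier free_gen_def cring.cring_simprules
      intro: finite_subset[of _ "{p}"])

text \<open>Induction on the size of the support: setting g to zero at one point p of its support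
  shrinks the support, and adding g p times the generator at p restores g.\<close>

lemma free_module_induct [consumes 2, case_names zero add]:
  assumes "cring R" "g \<in> carrier (free_module R X)"
    and "P (\<lambda>x. \<zero>\<^bsub>R\<^esub>)"
    and "\<And>g a p. \<lbrakk>g \<in> carrier (free_module R X); a \<in> carrier R; p \<in> X; P g\<rbrakk> \<Longrightarrow>
      P (g \<oplus>\<^bsub>free_module R X\<^esub> a \<odot>\<^bsub>free_module R X\<^esub> free_gen R p)"
  shows "P g"
proof -
  interpret cring R by fact
  define n where "n = card {x. g x \<noteq> \<zero>\<^bsub>R\<^esub>}"
  then show ?thesis
    using assms(2)
  proof (induction n arbitrary: g)
    case 0
    then have "g = (\<lambda>x. \<zero>\<^bsub>R\<^esub>)" by (auto simp: free_module_carrier)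
    with assms(3) show ?case by simp
  next
    case (Suc n)
    then obtain p where p: "g p \<noteq> \<zero>\<^bsub>R\<^esub>"
      by (metis (mono_tags, lifting) card.empty empty_Collect_eq nat.distinct(1))
    define h where "h = g(p := \<zero>\<^bsub>R\<^esub>)"
    have supp: "{x. h x \<noteq> \<zero>\<^bsub>R\<^esub>} = {x. g x \<noteq> \<zero>\<^bsub>R\<^esub>} - {p}" by (auto simp: h_def)
    have "n = card {x. h x \<noteq> \<zero>\<^bsub>R\<^esub>}"
      using Suc.prems p unfolding supp by (simp add: free_module_carrier)
    moreover have h: "h \<in> carrier (free_module R X)"
      using Suc.prems(2) unfolding free_module_carrier supp by (auto simp: h_def)
    ultimately have "P h" by (rule Suc.IH)
    moreover have "g = h \<oplus>\<^bsub>free_module R X\<^esub> g p \<odot>\<^bsub>free_module R X\<^esub> free_gen R p"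
      using Suc.prems(2) by (auto simp: free_module_simps free_module_carrier h_def free_gen_def)
    moreover have "p \<in> X" "g p \<in> carrier R"
      using Suc.prems(2) p by (auto simp: free_module_carrier)
    ultimately show ?case using assms(4) h by metis
  qed
qed

text \<open>The sum inside \<open>tensor_lift\<close>, freed from the choice of a representative;
  well-definedness of \<open>tensor_lift\<close> becomes a statement about this linear map.\<close>

definition free_lift :: "'r ring \<Rightarrow> ('r, 'p) module \<Rightarrow> ('x \<Rightarrow> 'p) \<Rightarrow> ('x \<Rightarrow> 'r) \<Rightarrow> 'p" where
  "free_lift R P b g = finsum P (\<lambda>p. g p \<odot>\<^bsub>P\<^esub> b p) {p. g p \<noteq> \<zero>\<^bsub>R\<^esub>}"

text \<open>The supports of g, h and g + h differ, so additivity has to compare the three sums over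
  one common finite index set. The extra terms have coefficient zero.\<close>

lemma free_lift_superset:
  assumes "module R P" "\<And>x. x \<in> X \<Longrightarrow> b x \<in> carrier P" "g \<in> carrier (free_module R X)"
    and "finite A" "{p. g p \<noteq> \<zero>\<^bsub>R\<^esub>} \<subseteq> A" "A \<subseteq> X"
  shows "free_lift R P b g = finsum P (\<lambda>p. g p \<odot>\<^bsub>P\<^esub> b p) A"
proof -
  interpret P: module R P by fact
  show ?thesis
    unfolding free_lift_def using assms(2-)
    by (intro P.M.add.finprod_mono_neutral_cong_left) (auto simp: free_module_carrier)
qed

lemma free_lift_lin:
  assumes "module R P" "\<And>x. x \<in> X \<Longrightarrow> b x \<in> carrier P"
  shows "free_lift R P b \<in> lin_hom R (free_module R X) P"
proof (rule lin_homI)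
  interpret P: module R P by fact
  interpret F: module R "free_module R X" by (rule free_module) (rule P.R.is_cring)
  show "free_lift R P b g \<in> carrier P" if "g \<in> carrier (free_module R X)" for g
    using that assms(2) unfolding free_lift_def
    by (intro P.M.finsum_closed) (auto simp: free_module_carrier)
  fix g assume g: "g \<in> carrier (free_module R X)"
  {
    fix h assume h: "h \<in> carrier (free_module R X)"
    let ?A = "{p. g p \<noteq> \<zero>\<^bsub>R\<^esub>} \<union> {p. h p \<noteq> \<zero>\<^bsub>R\<^esub>}"
    have A: "finite ?A" "?A \<subseteq> X"
      using g h by (auto simp: free_module_carrier)
    have "free_lift R P b (g \<oplus>\<^bsub>free_module R X\<^esub> h) =
        finsum P (\<lambda>p. (g \<oplus>\<^bsub>free_module R X\<^esub> h) p \<odot>\<^bsub>P\<^esub> b p) ?A"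
      using assms g h A F.M.a_closed[OF g h] by (intro free_lift_superset[where X = X])
        (auto simp: free_module_simps free_module_carrier)
    also have "\<dots> = finsum P (\<lambda>p. g p \<odot>\<^bsub>P\<^esub> b p \<oplus>\<^bsub>P\<^esub> h p \<odot>\<^bsub>P\<^esub> b p) ?A"
      using assms g h A by (intro P.M.finsum_cong')
        (auto simp: free_module_simps free_module_carrier P.smult_l_distr)
    also have "\<dots> = finsum P (\<lambda>p. g p \<odot>\<^bsub>P\<^esub> b p) ?A \<oplus>\<^bsub>P\<^esub> finsum P (\<lambda>p. h p \<odot>\<^bsub>P\<^esub> b p) ?A"
      using assms g h A by (intro P.M.finsum_addf) (auto simp: free_module_carrier)
    also have "\<dots> = free_lift R P b g \<oplus>\<^bsub>P\<^esub> free_lift R P b h"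
      using assms g h A by (simp add: free_lift_superset[where X = X and A = ?A])
    finally show "free_lift R P b (g \<oplus>\<^bsub>free_module R X\<^esub> h) =
      free_lift R P b g \<oplus>\<^bsub>P\<^esub> free_lift R P b h" .
  next
    fix a assume a: "a \<in> carrier R"
    let ?A = "{p. g p \<noteq> \<zero>\<^bsub>R\<^esub>}"
    have A: "finite ?A" "?A \<subseteq> X"
      using g by (auto simp: free_module_carrier)
    have "free_lift R P b (a \<odot>\<^bsub>free_module R X\<^esub> g) =
        finsum P (\<lambda>p. (a \<odot>\<^bsub>free_module R X\<^esub> g) p \<odot>\<^bsub>P\<^esub> b p) ?A"
      using assms a g A by (intro free_lift_superset[where X = X] F.smult_closed)
        (auto simp: free_module_simps free_module_carrier)
    also have "\<dots> = finsum P (\<lambda>p. a \<odot>\<^bsub>P\<^esub> (g p \<odot>\<^bsub>P\<^esub> b p)) ?A"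
      using assms a g A by (intro P.M.finsum_cong')
        (auto simp: free_module_simps free_module_carrier P.smult_assoc1)
    also have "\<dots> = a \<odot>\<^bsub>P\<^esub> free_lift R P b g"
      using assms a g A unfolding free_lift_def
      by (intro P.finsum_smult_ldistr[symmetric]) (auto simp: free_module_carrier)
    finally show "free_lift R P b (a \<odot>\<^bsub>free_module R X\<^esub> g) = a \<odot>\<^bsub>P\<^esub> free_lift R P b g" .
  }
qed

lemma free_lift_gen:
  assumes "module R P" "\<And>x. x \<in> X \<Longrightarrow> b x \<in> carrier P" "x \<in> X"
  shows "free_lift R P b (free_gen R x) = b x"
proof -
  interpret P: module R P by fact
  have "free_lift R P b (free_gen R x) = finsum P (\<lambda>p. free_gen R x p \<odot>\<^bsub>P\<^esub> b p) {x}"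
    using assms P.R.is_cring by (intro free_lift_superset[where X = X] free_gen_closed)
      (auto simp: free_gen_def)
  then show ?thesis
    using assms by (simp add: free_gen_def)
qed

section \<open>Quotient modules and spans\<close>

lemma submodule_coset_eqI:
  assumes "module R M" "submodule H R M" "x \<in> carrier M" "y \<in> carrier M" "x \<ominus>\<^bsub>M\<^esub> y \<in> H"
  shows "H +>\<^bsub>M\<^esub> x = H +>\<^bsub>M\<^esub> y"
proof -
  interpret M: module R M by fact
  interpret H: submodule H R M by fact
  interpret H: abelian_subgroup H M
    by (intro abelian_subgroupI3 additive_subgroupI H.subgroup_axioms M.M.abelian_group_axioms)
  have "x \<in> H +>\<^bsub>M\<^esub> y"
    using assms by (simp add: H.a_rcos_module a_minus_def)
  then show ?thesis
    using H.a_repr_independence' assms(4) by metis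
qed

text \<open>In \<open>quotient_module\<close> a scalar acts by a union over all representatives. Two
  representatives differ by an element of H, and H is closed under scalars, so every coset in the
  union is the same one; the union is not empty because x represents its own coset.\<close>

lemma quotient_module_smult:
  assumes "module R M" "submodule H R M" "x \<in> carrier M" "a \<in> carrier R"
  shows "a \<odot>\<^bsub>quotient_module R M H\<^esub> (H +>\<^bsub>M\<^esub> x) = H +>\<^bsub>M\<^esub> (a \<odot>\<^bsub>M\<^esub> x)"
proof -
  interpret M: module R M by fact
  interpret H: submodule H R M by fact
  interpret H: abelian_subgroup H M
    by (intro abelian_subgroupI3 additive_subgroupI H.subgroup_axioms M.M.abelian_group_axioms)
  have *: "H +>\<^bsub>M\<^esub> (a \<odot>\<^bsub>M\<^esub> y) = H +>\<^bsub>M\<^esub> (a \<odot>\<^bsub>M\<^esub> x)" if "y \<in> H +>\<^bsub>M\<^esub> x" for y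
  proof (rule submodule_coset_eqI[OF assms(1,2)])
    have y: "y \<in> carrier M" using that assms H.a_elemrcos_carrier by blast
    then have "y \<ominus>\<^bsub>M\<^esub> x \<in> H"
      using that assms by (simp add: H.a_rcos_module a_minus_def)
    then have "a \<odot>\<^bsub>M\<^esub> (y \<ominus>\<^bsub>M\<^esub> x) \<in> H" using assms by auto
    then show "a \<odot>\<^bsub>M\<^esub> y \<ominus>\<^bsub>M\<^esub> a \<odot>\<^bsub>M\<^esub> x \<in> H"
      using y assms by (simp add: a_minus_def M.smult_r_distr M.smult_r_minus)
    show "a \<odot>\<^bsub>M\<^esub> y \<in> carrier M" "a \<odot>\<^bsub>M\<^esub> x \<in> carrier M" using y assms by auto
  qed
  have "x \<in> H +>\<^bsub>M\<^esub> x" using assms by (simp add: H.a_rcos_self)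
  with * have "(\<Union>y\<in>H +>\<^bsub>M\<^esub> x. H +>\<^bsub>M\<^esub> (a \<odot>\<^bsub>M\<^esub> y)) = H +>\<^bsub>M\<^esub> (a \<odot>\<^bsub>M\<^esub> x)" by blast
  then show ?thesis
    by (simp add: quotient_module_def)
qed

lemma quotient_module:
  assumes "module R M" "submodule H R M"
  shows "module R (quotient_module R M H)"
    and "(\<lambda>x. H +>\<^bsub>M\<^esub> x) \<in> lin_hom R M (quotient_module R M H)"
    and "carrier (quotient_module R M H) = (\<lambda>x. H +>\<^bsub>M\<^esub> x) ` carrier M"
proof -
  interpret M: module R M by fact
  interpret H: submodule H R M by fact
  interpret H: abelian_subgroup H M
    by (intro abelian_subgroupI3 additive_subgroupI H.subgroup_axioms M.M.abelian_group_axioms)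
  let ?Q = "quotient_module R M H"
  show car: "carrier ?Q = (\<lambda>x. H +>\<^bsub>M\<^esub> x) ` carrier M"
    by (auto simp: quotient_module_def A_RCOSETS_def')
  have add: "(H +>\<^bsub>M\<^esub> x) \<oplus>\<^bsub>?Q\<^esub> (H +>\<^bsub>M\<^esub> y) = H +>\<^bsub>M\<^esub> (x \<oplus>\<^bsub>M\<^esub> y)"
    if "x \<in> carrier M" "y \<in> carrier M" for x y
    using that H.a_rcos_sum by (simp add: quotient_module_def)
  note smult = quotient_module_smult[OF assms]
  show "(\<lambda>x. H +>\<^bsub>M\<^esub> x) \<in> lin_hom R M ?Q"
    by (rule lin_homI) (auto simp: car add smult)
  have zero: "\<zero>\<^bsub>?Q\<^esub> = H +>\<^bsub>M\<^esub> \<zero>\<^bsub>M\<^esub>"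
    using H.a_subset by (simp add: quotient_module_def)
  have inv: "\<exists>y\<in>carrier ?Q. y \<oplus>\<^bsub>?Q\<^esub> x = \<zero>\<^bsub>?Q\<^esub>" if x: "x \<in> carrier ?Q" for x
  proof -
    obtain z where "z \<in> carrier M" "x = H +>\<^bsub>M\<^esub> z" using x by (auto simp: car)
    then show ?thesis
      by (intro bexI[of _ "H +>\<^bsub>M\<^esub> (\<ominus>\<^bsub>M\<^esub> z)"]) (auto simp: car add zero M.M.l_neg)
  qed
  have "abelian_group ?Q"
    by (rule abelian_groupI, rule_tac [6] inv) (auto simp: car add zero M.M.a_ac)
  then show "module R ?Q"
    by (rule moduleI[OF M.R.is_cring])
       (auto simp: car add smult M.smult_l_distr M.smult_r_distr M.smult_assoc1)
qed

text \<open>With X inside the carrier, the carrier itself is among the intersected submodules, which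
  keeps the intersection inside M. The closure properties then pass to the intersection one
  submodule at a time.\<close>

lemma submodule_span_submodule:
  assumes "module R M" "X \<subseteq> carrier M"
  shows "submodule (submodule_span R M X) R M"
proof -
  interpret M: module R M by fact
  have mem: "x \<in> submodule_span R M X \<longleftrightarrow> (\<forall>H. submodule H R M \<and> X \<subseteq> H \<longrightarrow> x \<in> H)" for x
    by (auto simp: submodule_span_def)
  show ?thesis
  proof (rule M.submoduleI)
    show "submodule_span R M X \<subseteq> carrier M"
      using M.carrier_is_submodule assms(2) mem by blast
    show "\<zero>\<^bsub>M\<^esub> \<in> submodule_span R M X"
      unfolding mem
    proof (intro allI impI)
      show "\<zero>\<^bsub>M\<^esub> \<in> H" if "submodule H R M \<and> X \<subseteq> H" for H
        using subgroup.one_closed[OF submodule.axioms(1)[of H R M]] that by simp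
    qed
    show "\<ominus>\<^bsub>M\<^esub> a \<in> submodule_span R M X" if "a \<in> submodule_span R M X" for a
      using that unfolding mem by (meson M.submoduleE(3))
    show "a \<oplus>\<^bsub>M\<^esub> b \<in> submodule_span R M X"
      if "a \<in> submodule_span R M X" "b \<in> submodule_span R M X" for a b
      using that unfolding mem by (meson M.submoduleE(5))
    show "a \<odot>\<^bsub>M\<^esub> x \<in> submodule_span R M X" if "a \<in> carrier R" "x \<in> submodule_span R M X" for a x
      using that unfolding mem by (meson M.submoduleE(4))
  qed
qed

lemma submodule_span_least: "\<lbrakk>submodule H R M; X \<subseteq> H\<rbrakk> \<Longrightarrow> submodule_span R M X \<subseteq> H"
  and submodule_span_superset: "x \<in> X \<Longrightarrow> x \<in> submodule_span R M X"
  by (auto simp: submodule_span_def)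

section \<open>Bilinear maps and the universal property of the tensor product\<close>

definition bilin ::
    "'r ring \<Rightarrow> ('r, 'm) module \<Rightarrow> ('r, 'n) module \<Rightarrow> ('r, 'p) module \<Rightarrow> ('m \<Rightarrow> 'n \<Rightarrow> 'p) set" where
  "bilin R M N P = {b. (\<forall>x\<in>carrier M. b x \<in> lin_hom R N P) \<and>
     (\<forall>y\<in>carrier N. (\<lambda>x. b x y) \<in> lin_hom R M P)}"

lemma bilinI:
  assumes "\<And>x. x \<in> carrier M \<Longrightarrow> b x \<in> lin_hom R N P"
    and "\<And>y. y \<in> carrier N \<Longrightarrow> (\<lambda>x. b x y) \<in> lin_hom R M P"
  shows "b \<in> bilin R M N P"
  using assms by (auto simp: bilin_def)

lemma bilinD:
  assumes "b \<in> bilin R M N P"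
  shows "x \<in> carrier M \<Longrightarrow> b x \<in> lin_hom R N P"
    and "y \<in> carrier N \<Longrightarrow> (\<lambda>x. b x y) \<in> lin_hom R M P"
    and "\<lbrakk>x \<in> carrier M; y \<in> carrier N\<rbrakk> \<Longrightarrow> b x y \<in> carrier P"
  using assms by (auto simp: bilin_def lin_hom_closed)

lemma bilin_comp:
  assumes "b \<in> bilin R M N P" "f \<in> lin_hom R M' M" "g \<in> lin_hom R N' N"
  shows "(\<lambda>x y. b (f x) (g y)) \<in> bilin R M' N' P"
proof (rule bilinI)
  show "(\<lambda>y. b (f x) (g y)) \<in> lin_hom R N' P" if "x \<in> carrier M'" for x
    using bilinD(1)[OF assms(1) lin_hom_closed[OF assms(2) that]] assms(3) by (rule lin_hom_comp)
  show "(\<lambda>x. b (f x) (g y)) \<in> lin_hom R M' P" if "y \<in> carrier N'" for y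
    using bilinD(2)[OF assms(1) lin_hom_closed[OF assms(3) that]] assms(2) by (rule lin_hom_comp)
qed

lemma bilin_comp_lin:
  assumes "b \<in> bilin R M N P" "h \<in> lin_hom R P Q"
  shows "(\<lambda>x y. h (b x y)) \<in> bilin R M N Q"
proof (rule bilinI)
  show "(\<lambda>y. h (b x y)) \<in> lin_hom R N Q" if "x \<in> carrier M" for x
    using assms(2) bilinD(1)[OF assms(1) that] by (rule lin_hom_comp)
  show "(\<lambda>x. h (b x y)) \<in> lin_hom R M Q" if "y \<in> carrier N" for y
    using assms(2) bilinD(2)[OF assms(1) that] by (rule lin_hom_comp)
qed

locale module_pair = M: module R M + N: module R N
  for R :: "'r ring" and M :: "('r, 'm) module" and N :: "('r, 'n) module"
begin

abbreviation (input) "F \<equiv> free_module R (carrier M \<times> carrier N)"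

lemma F: "module R F"
  by (rule free_module) (rule M.R.is_cring)

lemma gen_closed: "\<lbrakk>x \<in> carrier M; y \<in> carrier N\<rbrakk> \<Longrightarrow> free_gen R (x, y) \<in> carrier F"
  using M.R.is_cring by (intro free_gen_closed) auto

lemma relators_closed: "tensor_relators R M N \<subseteq> carrier F"
proof -
  interpret F: module R F by (rule F)
  show ?thesis
    by (auto simp: tensor_relators_def Let_def gen_closed)
qed

lemma kernel_submodule: "submodule (tensor_kernel R M N) R F"
  unfolding tensor_kernel_def using F relators_closed by (rule submodule_span_submodule)

lemma tensor_module: "module R (tensor R M N)"
  unfolding tensor_def by (intro quotient_module F kernel_submodule)

lemma coset_lin:
  "(\<lambda>g. tensor_kernel R M N +>\<^bsub>F\<^esub> g) \<in> lin_hom R F (tensor R M N)"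
  unfolding tensor_def by (intro quotient_module F kernel_submodule)

lemma coset_surj:
  "carrier (tensor R M N) = (\<lambda>g. tensor_kernel R M N +>\<^bsub>F\<^esub> g) ` carrier F"
  unfolding tensor_def by (intro quotient_module F kernel_submodule)

lemma pure_closed: "\<lbrakk>x \<in> carrier M; y \<in> carrier N\<rbrakk> \<Longrightarrow> pure_tensor R M N x y \<in> carrier (tensor R M N)"
  unfolding pure_tensor_def by (intro lin_hom_closed[OF coset_lin] gen_closed)

text \<open>Each relator is written as a difference, so it turns directly into an equation of
  cosets. The four kinds of relators give the four clauses of \<open>pure_bilin\<close>.\<close>

lemma coset_relatorI:
  assumes "g \<ominus>\<^bsub>F\<^esub> h \<in> tensor_relators R M N" "g \<in> carrier F" "h \<in> carrier F"
  shows "tensor_kernel R M N +>\<^bsub>F\<^esub> g = tensor_kernel R M N +>\<^bsub>F\<^esub> h"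
  using F kernel_submodule assms(2,3)
  by (rule submodule_coset_eqI)
     (unfold tensor_kernel_def, rule submodule_span_superset, rule assms)

lemma pure_bilin: "pure_tensor R M N \<in> bilin R M N (tensor R M N)"
proof -
  interpret F: module R F by (rule F)
  show ?thesis
  proof (intro bilinI lin_homI)
    fix x x' y assume *: "x \<in> carrier M" "x' \<in> carrier M" "y \<in> carrier N"
    have "pure_tensor R M N (x \<oplus>\<^bsub>M\<^esub> x') y = tensor_kernel R M N +>\<^bsub>F\<^esub> (free_gen R (x, y) \<oplus>\<^bsub>F\<^esub> free_gen R (x', y))"
      unfolding pure_tensor_def using *
      by (intro coset_relatorI) (auto simp: tensor_relators_def Let_def gen_closed)
    then show "pure_tensor R M N (x \<oplus>\<^bsub>M\<^esub> x') y = pure_tensor R M N x y \<oplus>\<^bsub>tensor R M N\<^esub> pure_tensor R M N x' y"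
      using * by (simp add: lin_hom_add[OF coset_lin] gen_closed) (simp add: pure_tensor_def)
  next
    fix x y y' assume *: "x \<in> carrier M" "y \<in> carrier N" "y' \<in> carrier N"
    have "pure_tensor R M N x (y \<oplus>\<^bsub>N\<^esub> y') = tensor_kernel R M N +>\<^bsub>F\<^esub> (free_gen R (x, y) \<oplus>\<^bsub>F\<^esub> free_gen R (x, y'))"
      unfolding pure_tensor_def using *
      by (intro coset_relatorI) (auto simp: tensor_relators_def Let_def gen_closed)
    then show "pure_tensor R M N x (y \<oplus>\<^bsub>N\<^esub> y') = pure_tensor R M N x y \<oplus>\<^bsub>tensor R M N\<^esub> pure_tensor R M N x y'"
      using * by (simp add: lin_hom_add[OF coset_lin] gen_closed) (simp add: pure_tensor_def)
  next
    fix a x y assume *: "a \<in> carrier R" "x \<in> carrier M" "y \<in> carrier N"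
    have "pure_tensor R M N (a \<odot>\<^bsub>M\<^esub> x) y = tensor_kernel R M N +>\<^bsub>F\<^esub> (a \<odot>\<^bsub>F\<^esub> free_gen R (x, y))"
      unfolding pure_tensor_def using *
      by (intro coset_relatorI) (auto simp: tensor_relators_def Let_def gen_closed)
    then show "pure_tensor R M N (a \<odot>\<^bsub>M\<^esub> x) y = a \<odot>\<^bsub>tensor R M N\<^esub> pure_tensor R M N x y"
      using * by (simp add: lin_hom_smult[OF coset_lin] gen_closed) (simp add: pure_tensor_def)
  next
    fix a x y assume *: "a \<in> carrier R" "x \<in> carrier M" "y \<in> carrier N"
    have "pure_tensor R M N x (a \<odot>\<^bsub>N\<^esub> y) = tensor_kernel R M N +>\<^bsub>F\<^esub> (a \<odot>\<^bsub>F\<^esub> free_gen R (x, y))"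
      unfolding pure_tensor_def using *
      by (intro coset_relatorI) (auto simp: tensor_relators_def Let_def gen_closed)
    then show "pure_tensor R M N x (a \<odot>\<^bsub>N\<^esub> y) = a \<odot>\<^bsub>tensor R M N\<^esub> pure_tensor R M N x y"
      using * by (simp add: lin_hom_smult[OF coset_lin] gen_closed) (simp add: pure_tensor_def)
  qed (simp_all add: pure_closed)
qed

lemmas pure_lin_l = bilinD(2)[OF pure_bilin]
lemmas pure_smult_l = lin_hom_smult[OF pure_lin_l]

text \<open>A scalar case is absorbed because scalars move into the first factor of a pure tensor,
  and a zero case because zero is the pure tensor of two zeros.\<close>

lemma tensor_induct [consumes 1, case_names pure add]:
  assumes "t \<in> carrier (tensor R M N)"
    and pure: "\<And>x y. \<lbrakk>x \<in> carrier M; y \<in> carrier N\<rbrakk> \<Longrightarrow> P (pure_tensor R M N x y)"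
    and add: "\<And>s t. \<lbrakk>s \<in> carrier (tensor R M N); t \<in> carrier (tensor R M N); P s; P t\<rbrakk> \<Longrightarrow>
      P (s \<oplus>\<^bsub>tensor R M N\<^esub> t)"
  shows "P t"
proof -
  interpret F: module R F by (rule F)
  interpret T: module R "tensor R M N" by (rule tensor_module)
  obtain g where g: "g \<in> carrier F" and t: "t = tensor_kernel R M N +>\<^bsub>F\<^esub> g"
    using assms(1) coset_surj by auto
  have zero: "\<zero>\<^bsub>tensor R M N\<^esub> = pure_tensor R M N \<zero>\<^bsub>M\<^esub> \<zero>\<^bsub>N\<^esub>"
    using lin_hom_zero[OF M.module_axioms tensor_module pure_lin_l] by simp
  show ?thesis
    unfolding t using M.R.is_cring g
  proof (induction rule: free_module_induct)
    case zero
    have "tensor_kernel R M N +>\<^bsub>F\<^esub> \<zero>\<^bsub>F\<^esub> = \<zero>\<^bsub>tensor R M N\<^esub>"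
      using F tensor_module coset_lin by (rule lin_hom_zero)
    then show ?case
      using pure[of "\<zero>\<^bsub>M\<^esub>" "\<zero>\<^bsub>N\<^esub>"] \<open>_ = pure_tensor R M N \<zero>\<^bsub>M\<^esub> \<zero>\<^bsub>N\<^esub>\<close> by (simp add: free_module_simps)
  next
    case (add g a p)
    obtain x y where p: "p = (x, y)" "x \<in> carrier M" "y \<in> carrier N" using add by auto
    have "tensor_kernel R M N +>\<^bsub>F\<^esub> (g \<oplus>\<^bsub>F\<^esub> a \<odot>\<^bsub>F\<^esub> free_gen R p) =
      (tensor_kernel R M N +>\<^bsub>F\<^esub> g) \<oplus>\<^bsub>tensor R M N\<^esub> pure_tensor R M N (a \<odot>\<^bsub>M\<^esub> x) y"
      using add p
      by (simp add: lin_hom_add[OF coset_lin] lin_hom_smult[OF coset_lin] gen_closed pure_smult_l)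
         (simp add: pure_tensor_def)
    then show ?case
      using add p by (auto intro!: assms(3) pure pure_closed lin_hom_closed[OF coset_lin])
  qed
qed

lemma tensor_hom_ext:
  assumes "f \<in> lin_hom R (tensor R M N) P" "g \<in> lin_hom R (tensor R M N) P"
    and "\<And>x y. \<lbrakk>x \<in> carrier M; y \<in> carrier N\<rbrakk> \<Longrightarrow>
      f (pure_tensor R M N x y) = g (pure_tensor R M N x y)"
    and "t \<in> carrier (tensor R M N)"
  shows "f t = g t"
  using assms(4) by (induction rule: tensor_induct) (simp_all add: assms(3) lin_hom_add[OF assms(1)] lin_hom_add[OF assms(2)])

text \<open>The span of the relators lies in the kernel of \<open>free_lift\<close>, so
  \<open>free_lift\<close> is constant on the coset from which the representative in
  \<open>tensor_lift\<close> is chosen.\<close>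

lemma tensor_lift_coset:
  assumes "module R P" "b \<in> bilin R M N P" "g \<in> carrier F"
  shows "tensor_lift R P b (tensor_kernel R M N +>\<^bsub>F\<^esub> g) = free_lift R P (case_prod b) g"
proof -
  interpret F: module R F by (rule F)
  interpret P: module R P by fact
  interpret K: submodule "tensor_kernel R M N" R F by (rule kernel_submodule)
  interpret K: abelian_subgroup "tensor_kernel R M N" F
    by (intro abelian_subgroupI3 additive_subgroupI K.subgroup_axioms F.M.abelian_group_axioms)
  let ?L = "free_lift R P (case_prod b)"
  have b: "case_prod b p \<in> carrier P" if "p \<in> carrier M \<times> carrier N" for p
    using that bilinD(3)[OF assms(2)] by auto
  have L: "?L \<in> lin_hom R F P" using assms(1) b by (rule free_lift_lin)
  have gen: "?L (free_gen R (x, y)) = b x y" if "x \<in> carrier M" "y \<in> carrier N" for x y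
    using free_lift_gen[where X = "carrier M \<times> carrier N" and b = "case_prod b" and x = "(x, y)",
        OF assms(1) b] that by simp
  note kernel = submodule_kernel[OF F assms(1) L]
  have minus: "?L (u \<ominus>\<^bsub>F\<^esub> v) = \<zero>\<^bsub>P\<^esub>"
    if "?L u = ?L v" "u \<in> carrier F" "v \<in> carrier F" for u v
  proof -
    have "?L ((u \<ominus>\<^bsub>F\<^esub> v) \<oplus>\<^bsub>F\<^esub> v) = ?L (u \<ominus>\<^bsub>F\<^esub> v) \<oplus>\<^bsub>P\<^esub> ?L v"
      using that by (intro lin_hom_add[OF L]) auto
    moreover have "(u \<ominus>\<^bsub>F\<^esub> v) \<oplus>\<^bsub>F\<^esub> v = u"
      using that by (simp add: a_minus_def F.M.a_assoc F.M.l_neg)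
    ultimately show ?thesis
      using that lin_hom_closed[OF L] by auto
  qed
  \<comment> \<open>Bilinearity of \<open>b\<close> says precisely that the four kinds of relators
    are killed.\<close>
  have "tensor_relators R M N \<subseteq> {u \<in> carrier F. ?L u = \<zero>\<^bsub>P\<^esub>}"
    unfolding tensor_relators_def Let_def
    using bilinD(1,2)[OF assms(2)]
    by (auto intro!: minus simp: gen_closed gen lin_hom_add[OF L] lin_hom_smult[OF L] lin_hom_def)
  then have sub: "tensor_kernel R M N \<subseteq> {u \<in> carrier F. ?L u = \<zero>\<^bsub>P\<^esub>}"
    unfolding tensor_kernel_def using kernel by (intro submodule_span_least)
  have eq: "?L h = ?L g" if h: "h \<in> tensor_kernel R M N +>\<^bsub>F\<^esub> g" for h
  proof -
    have hF: "h \<in> carrier F" using h assms(3) K.a_elemrcos_carrier by blast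
    then have "?L (h \<ominus>\<^bsub>F\<^esub> g) = \<zero>\<^bsub>P\<^esub>"
      using h assms(3) sub by (auto simp: K.a_rcos_module a_minus_def)
    moreover have "?L ((h \<ominus>\<^bsub>F\<^esub> g) \<oplus>\<^bsub>F\<^esub> g) = ?L (h \<ominus>\<^bsub>F\<^esub> g) \<oplus>\<^bsub>P\<^esub> ?L g"
      using hF assms(3) by (intro lin_hom_add[OF L]) auto
    moreover have "(h \<ominus>\<^bsub>F\<^esub> g) \<oplus>\<^bsub>F\<^esub> g = h"
      using hF assms(3) by (simp add: a_minus_def F.M.a_assoc F.M.l_neg)
    ultimately show ?thesis
      using lin_hom_closed[OF L assms(3)] by auto
  qed
  \<comment> \<open>The coset contains g, so the choice does return one of its elements, and
    \<open>eq\<close> evaluates it.\<close>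
  have "(SOME h. h \<in> tensor_kernel R M N +>\<^bsub>F\<^esub> g) \<in> tensor_kernel R M N +>\<^bsub>F\<^esub> g"
    using K.a_rcos_self[OF assms(3)] by (rule someI[where P = "\<lambda>h. h \<in> _"])
  from eq[OF this] show ?thesis
    unfolding tensor_lift_def Let_def free_lift_def by (simp add: case_prod_beta')
qed

lemma tensor_lift_lin:
  assumes "module R P" "b \<in> bilin R M N P"
  shows "tensor_lift R P b \<in> lin_hom R (tensor R M N) P"
proof -
  interpret F: module R F by (rule F)
  have "free_lift R P (case_prod b) \<in> lin_hom R F P"
    using bilinD(3)[OF assms(2)] by (intro free_lift_lin assms) auto
  then show ?thesis
    unfolding lin_hom_def
    by (auto simp: coset_surj lin_hom_add[OF coset_lin, symmetric]
      lin_hom_smult[OF coset_lin, symmetric] tensor_lift_coset[OF assms])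
qed

lemma tensor_lift_pure:
  assumes "module R P" "b \<in> bilin R M N P" "x \<in> carrier M" "y \<in> carrier N"
  shows "tensor_lift R P b (pure_tensor R M N x y) = b x y"
proof -
  have "free_lift R P (case_prod b) (free_gen R (x, y)) = case_prod b (x, y)"
    using bilinD(3)[OF assms(2)] assms(3,4)
    by (intro free_lift_gen[where X = "carrier M \<times> carrier N"] assms(1)) auto
  then show ?thesis
    using assms(3,4) by (simp add: pure_tensor_def tensor_lift_coset[OF assms(1,2)] gen_closed)
qed

end

lemma module_pairI: "\<lbrakk>module R M; module R N\<rbrakk> \<Longrightarrow> module_pair R M N"
  by (simp add: module_pair_def)

lemmas module_tensor = module_pair.tensor_module[OF module_pairI]
lemmas pure_tensor_closed = module_pair.pure_closed[OF module_pairI]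
lemmas pure_tensor_bilin = module_pair.pure_bilin[OF module_pairI]
lemmas tensor_lift_lin = module_pair.tensor_lift_lin[OF module_pairI]
lemmas tensor_lift_pure = module_pair.tensor_lift_pure[OF module_pairI]
lemmas tensor_hom_ext = module_pair.tensor_hom_ext[OF module_pairI]

section \<open>Functoriality and associativity of the tensor product\<close>

lemma
  assumes "module R M" "module R N" "module R M'" "module R N'"
    and "f \<in> lin_hom R M M'" "g \<in> lin_hom R N N'"
  shows tensor_hom_lin: "tensor_hom R M' N' f g \<in> lin_hom R (tensor R M N) (tensor R M' N')"
    and tensor_hom_pure: "\<lbrakk>x \<in> carrier M; y \<in> carrier N\<rbrakk> \<Longrightarrow>
      tensor_hom R M' N' f g (pure_tensor R M N x y) = pure_tensor R M' N' (f x) (g y)"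
proof -
  have b: "(\<lambda>x y. pure_tensor R M' N' (f x) (g y)) \<in> bilin R M N (tensor R M' N')"
    using pure_tensor_bilin[OF assms(3,4)] assms(5,6) by (rule bilin_comp)
  show "tensor_hom R M' N' f g \<in> lin_hom R (tensor R M N) (tensor R M' N')"
    unfolding tensor_hom_def by (intro tensor_lift_lin module_tensor assms b)
  show "\<lbrakk>x \<in> carrier M; y \<in> carrier N\<rbrakk> \<Longrightarrow>
      tensor_hom R M' N' f g (pure_tensor R M N x y) = pure_tensor R M' N' (f x) (g y)"
    unfolding tensor_hom_def by (intro tensor_lift_pure module_tensor assms b)
qed

text \<open>Currying for a trilinear \<open>c\<close>, as the nested lift in
  \<open>tensor_assoc\<close> requires. For linearity in z the tensor t is fixed, so the universal
  property does not apply directly and induction on t takes its place.\<close>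

lemma bilin_tensor_lift:
  assumes "module R M" "module R N" "module R P" "module R Q"
    and "\<And>z. z \<in> carrier P \<Longrightarrow> (\<lambda>x y. c x y z) \<in> bilin R M N Q"
    and "\<And>x y. \<lbrakk>x \<in> carrier M; y \<in> carrier N\<rbrakk> \<Longrightarrow> c x y \<in> lin_hom R P Q"
  shows "(\<lambda>t z. tensor_lift R Q (\<lambda>x y. c x y z) t) \<in> bilin R (tensor R M N) P Q"
proof (rule bilinI)
  interpret P: module R P by fact
  interpret Q: module R Q by fact
  interpret module_pair R M N by (intro module_pairI assms)
  note lift = assms(4) assms(5)
  show "(\<lambda>x. tensor_lift R Q (\<lambda>x y. c x y z) x) \<in> lin_hom R (tensor R M N) Q"
    if "z \<in> carrier P" for z
    using tensor_lift_lin[OF lift] that by simp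
  note lift_lin = this
  fix t assume "t \<in> carrier (tensor R M N)"
  then show "(\<lambda>z. tensor_lift R Q (\<lambda>x y. c x y z) t) \<in> lin_hom R P Q"
  proof (induction rule: tensor_induct)
    case (pure x y)
    show ?case
      by (rule lin_hom_cong[OF assms(3) assms(6)[OF pure]]) (simp add: tensor_lift_pure[OF lift] pure)
  next
    case (add s t)
    have "(\<lambda>z. tensor_lift R Q (\<lambda>x y. c x y z) s \<oplus>\<^bsub>Q\<^esub> tensor_lift R Q (\<lambda>x y. c x y z) t)
        \<in> lin_hom R P Q"
      using assms(4) add(3,4) by (rule lin_hom_sum)
    then show ?case
      by (rule lin_hom_cong[OF assms(3)]) (simp add: lin_hom_add[OF lift_lin] add)
  qed
qed

lemma
  assumes "module R M" "module R N" "module R P"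
  shows tensor_assoc_lin: "tensor_assoc R M N P \<in>
      lin_hom R (tensor R (tensor R M N) P) (tensor R M (tensor R N P))"
    and tensor_assoc_pure: "\<lbrakk>x \<in> carrier M; y \<in> carrier N; z \<in> carrier P\<rbrakk> \<Longrightarrow>
      tensor_assoc R M N P (pure_tensor R (tensor R M N) P (pure_tensor R M N x y) z) =
      pure_tensor R M (tensor R N P) x (pure_tensor R N P y z)"
proof -
  let ?T = "tensor R M (tensor R N P)"
  let ?c = "\<lambda>x y z. pure_tensor R M (tensor R N P) x (pure_tensor R N P y z)"
  note pNP = pure_tensor_bilin[OF assms(2,3)]
  note pT = pure_tensor_bilin[OF assms(1) module_tensor[OF assms(2,3)]]
  have T: "module R ?T" by (intro module_tensor assms)
  have c1: "(\<lambda>x y. ?c x y z) \<in> bilin R M N ?T" if "z \<in> carrier P" for z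
    using bilin_comp[OF pT lin_hom_id bilinD(2)[OF pNP that]] .
  have c2: "?c x y \<in> lin_hom R P ?T" if "x \<in> carrier M" "y \<in> carrier N" for x y
    by (rule lin_hom_comp[OF bilinD(1)[OF pT that(1)] bilinD(1)[OF pNP that(2)]])
  note b = bilin_tensor_lift[OF assms T c1 c2]
  show "tensor_assoc R M N P \<in> lin_hom R (tensor R (tensor R M N) P) ?T"
    unfolding tensor_assoc_def Let_def by (intro tensor_lift_lin module_tensor T assms b)
  show "\<lbrakk>x \<in> carrier M; y \<in> carrier N; z \<in> carrier P\<rbrakk> \<Longrightarrow>
      tensor_assoc R M N P (pure_tensor R (tensor R M N) P (pure_tensor R M N x y) z) = ?c x y z"
    unfolding tensor_assoc_def Let_def
    by (simp add: tensor_lift_pure[OF module_tensor assms(3) T b] assms pure_tensor_closed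
        tensor_lift_pure[OF _ _ T c1])
qed

lemma module_restrict_scalars:
  assumes "cring R" "module S M" "f \<in> ring_hom R S"
  shows "module R (restrict_scalars f M)"
proof -
  interpret R: cring R by fact
  interpret M: module S M by fact
  note [simp] = ring_hom_closed[OF assms(3)] ring_hom_add[OF assms(3)] ring_hom_mult[OF assms(3)]
    ring_hom_one[OF assms(3)]
  show ?thesis
    unfolding restrict_scalars_def
    by (intro moduleI abelian_groupI R.is_cring)
       (simp_all add: M.smult_l_distr M.smult_r_distr M.smult_assoc1 M.M.a_ac
         M.M.add.l_inv_ex[simplified])
qed

lemma module_ring: "cring R \<Longrightarrow> module R (ring_as_module R)"
proof -
  assume "cring R"
  then interpret cring R .
  show ?thesis
    unfolding ring_as_module_def
    by (intro moduleI abelian_groupI is_cring)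
       (simp_all add: l_distr r_distr m_assoc a_ac add.l_inv_ex[simplified])
qed

section \<open>Algebras and functors of modules\<close>

lemma CalgD:
  assumes "S \<in> Calg R"
  shows "cring (fst S)" "snd S \<in> ring_hom R (fst S)" "snd S \<in> extensional (carrier R)"
    and "r \<in> carrier R \<Longrightarrow> snd S r \<in> carrier (fst S)"
  using assms by (auto simp: Calg_def ring_hom_closed)

lemma alg_homD:
  assumes "f \<in> alg_hom R S T"
  shows "f \<in> ring_hom (fst S) (fst T)" "f \<in> extensional (carrier (fst S))"
    and "compose (carrier R) f (snd S) = snd T"
    and "s \<in> carrier (fst S) \<Longrightarrow> f s \<in> carrier (fst T)"
  using assms by (auto simp: alg_hom_def ring_hom_closed)

lemma ring_hom_cong:
  assumes "ring R" "h \<in> ring_hom R S" "\<And>x. x \<in> carrier R \<Longrightarrow> k x = h x"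
  shows "k \<in> ring_hom R S"
proof -
  interpret ring R by fact
  show ?thesis
    using assms(2) by (auto simp: ring_hom_def assms(3))
qed

lemma ring_hom_compose:
  assumes "ring R" "f \<in> ring_hom R S" "g \<in> ring_hom S T"
  shows "compose (carrier R) g f \<in> ring_hom R T"
  by (rule ring_hom_cong[OF assms(1) ring_hom_trans[OF assms(2,3)]]) (simp add: compose_def)

lemma ring_hom_restrict_id: "ring R \<Longrightarrow> (\<lambda>x\<in>carrier R. x) \<in> ring_hom R R"
  by (rule ring_hom_cong[of R "\<lambda>x. x"]) (auto simp: ring_hom_def)

lemma self_alg_simps [simp]: "fst (self_alg S) = S" "snd (self_alg S) = (\<lambda>s\<in>carrier S. s)"
  by (auto simp: self_alg_def)

lemma self_alg_Calg: "cring S \<Longrightarrow> self_alg S \<in> Calg S"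
  by (auto simp: Calg_def intro: ring_hom_restrict_id cring.axioms(1))

lemma fst_base_alg [simp]: "fst (base_alg R S T) = fst T"
  by (simp add: base_alg_def)

lemma base_alg_Calg:
  assumes "cring R" "S \<in> Calg R" "T \<in> Calg (fst S)"
  shows "base_alg R S T \<in> Calg R"
  using assms CalgD(1,2)[OF assms(2)] CalgD(1,2)[OF assms(3)]
  by (auto simp: Calg_def base_alg_def intro: ring_hom_compose cring.axioms(1))

text \<open>A literal equality of algebras, which holds because structure maps are extensional. It
  is what makes evaluation at \<open>self_alg\<close> an operation on the value of a functor at S
  itself.\<close>

lemma base_alg_self:
  assumes "S \<in> Calg R"
  shows "base_alg R S (self_alg (fst S)) = S"
  using CalgD(3,4)[OF assms]
  by (intro prod_eqI) (auto simp: base_alg_def compose_def extensional_def fun_eq_iff)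

lemma base_alg_assoc:
  assumes "S \<in> Calg R"
  shows "base_alg R S (base_alg (fst S) T U) = base_alg R (base_alg R S T) U"
  using CalgD(4)[OF assms]
  by (auto simp: base_alg_def compose_def fun_eq_iff)

lemma snd_alg_hom:
  assumes "T \<in> Calg (fst S)"
  shows "snd T \<in> alg_hom R S (base_alg R S T)"
  using assms by (auto simp: alg_hom_def Calg_def base_alg_def)

lemma alg_hom_base_alg:
  assumes "S \<in> Calg R" "f \<in> alg_hom (fst S) T U"
  shows "f \<in> alg_hom R (base_alg R S T) (base_alg R S U)"
proof -
  have "compose (carrier R) f (compose (carrier R) (snd T) (snd S)) =
      compose (carrier R) (compose (carrier (fst S)) f (snd T)) (snd S)"
    using CalgD(4)[OF assms(1)] by (auto simp: compose_def fun_eq_iff)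
  then show ?thesis
    using assms(2) alg_homD(3)[OF assms(2)] by (simp add: alg_hom_def base_alg_def)
qed

lemma alg_hom_id: "S \<in> Calg R \<Longrightarrow> (\<lambda>s\<in>carrier (fst S). s) \<in> alg_hom R S S"
  by (auto simp: alg_hom_def Calg_def extensional_def compose_def ring_hom_closed
      intro!: ring_hom_restrict_id cring.axioms(1))

lemma alg_hom_compose:
  assumes "S \<in> Calg R" "f \<in> alg_hom R S T" "g \<in> alg_hom R T U"
  shows "compose (carrier (fst S)) g f \<in> alg_hom R S U"
proof -
  have "compose (carrier R) (compose (carrier (fst S)) g f) (snd S) =
      compose (carrier R) g (compose (carrier R) f (snd S))"
    using CalgD(4)[OF assms(1)] by (auto simp: compose_def fun_eq_iff)
  then have "compose (carrier R) (compose (carrier (fst S)) g f) (snd S) = snd U"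
    by (simp add: alg_homD(3)[OF assms(2)] alg_homD(3)[OF assms(3)])
  moreover have "ring (fst S)" using CalgD(1)[OF assms(1)] by (rule cring.axioms(1))
  ultimately show ?thesis
    using alg_homD(1)[OF assms(2)] alg_homD(1)[OF assms(3)]
    by (auto simp: alg_hom_def intro: ring_hom_compose)
qed

lemma snd_alg_hom_self: "\<lbrakk>cring R; T \<in> Calg R\<rbrakk> \<Longrightarrow> snd T \<in> alg_hom R (self_alg R) T"
  by (auto simp: alg_hom_def Calg_def compose_def extensional_def fun_eq_iff)

text \<open>An R-algebra map out of S is the same as an S-algebra structure compatible with R.
  Elements of a dual at S are indexed by S-algebras, so this is how naturality over R is brought to
  bear on them.\<close>

lemma alg_hom_base:
  assumes "S \<in> Calg R" "f \<in> alg_hom R S T" "T \<in> Calg R"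
  shows "(fst T, f) \<in> Calg (fst S)" "base_alg R S (fst T, f) = T"
  using assms CalgD[OF assms(3)] alg_homD[OF assms(2)]
  by (auto simp: Calg_def base_alg_def intro: prod_eqI)

section \<open>Semilinear transition maps and tensor products of functors\<close>

lemma ring_as_module_simps [simp]:
  "carrier (ring_as_module R) = carrier R" "add (ring_as_module R) = add R"
  "\<zero>\<^bsub>ring_as_module R\<^esub> = \<zero>\<^bsub>R\<^esub>" "smult (ring_as_module R) = mult R"
  by (auto simp: ring_as_module_def)

lemma ring_mfun_simps [simp]:
  "Ob ring_mfun S = ring_as_module (fst S)" "Ar ring_mfun S T f = f"
  by (auto simp: ring_mfun_def)

lemma restrict_scalars_simps [simp]:
  "carrier (restrict_scalars f M) = carrier M" "add (restrict_scalars f M) = add M"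
  "\<zero>\<^bsub>restrict_scalars f M\<^esub> = \<zero>\<^bsub>M\<^esub>" "smult (restrict_scalars f M) = (\<lambda>a. smult M (f a))"
  by (auto simp: restrict_scalars_def)

text \<open>Semilinearity along f is linearity over the source ring after restricting the scalars of
  the target along f. In this form transition maps fall under the lemmas on \<open>lin_hom\<close>
  and under the universal property of tensor products.\<close>

lemma module_functorI:
  assumes "\<And>S. S \<in> Calg R \<Longrightarrow> module (fst S) (Ob M S)"
    and "\<And>S x. \<lbrakk>S \<in> Calg R; x \<in> carrier (Ob M S)\<rbrakk> \<Longrightarrow> Ar M S S (\<lambda>s\<in>carrier (fst S). s) x = x"
    and "\<And>S T U f g x. \<lbrakk>S \<in> Calg R; T \<in> Calg R; U \<in> Calg R; f \<in> alg_hom R S T; g \<in> alg_hom R T U;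
      x \<in> carrier (Ob M S)\<rbrakk> \<Longrightarrow>
      Ar M S U (compose (carrier (fst S)) g f) x = Ar M T U g (Ar M S T f x)"
    and "\<And>S T f. \<lbrakk>S \<in> Calg R; T \<in> Calg R; f \<in> alg_hom R S T\<rbrakk> \<Longrightarrow>
      Ar M S T f \<in> lin_hom (fst S) (Ob M S) (restrict_scalars f (Ob M T))"
  shows "module_functor R M"
  using assms(1-3) lin_hom_closed[OF assms(4)] lin_hom_add[OF assms(4)] lin_hom_smult[OF assms(4)]
  by (intro module_functor.intro set_functor.intro module_functor_axioms.intro) simp_all

lemma module_functor_Ar_lin:
  assumes "module_functor R M" "S \<in> Calg R" "T \<in> Calg R" "f \<in> alg_hom R S T"
  shows "Ar M S T f \<in> lin_hom (fst S) (Ob M S) (restrict_scalars f (Ob M T))"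
proof -
  interpret module_functor R M by fact
  show ?thesis
    using assms(2-) by (intro lin_homI) (auto simp: map_closed map_add map_smult)
qed

lemma lin_hom_restrict:
  assumes "h \<in> lin_hom S M N" "f \<in> ring_hom R S"
  shows "h \<in> lin_hom R (restrict_scalars f M) (restrict_scalars f N)"
  using assms by (auto simp: lin_hom_def ring_hom_closed)

lemma bilin_restrict:
  assumes "b \<in> bilin S M N P" "f \<in> ring_hom R S"
  shows "b \<in> bilin R (restrict_scalars f M) (restrict_scalars f N) (restrict_scalars f P)"
  by (rule bilinI) (auto intro!: lin_hom_restrict[OF _ assms(2)] bilinD(1,2)[OF assms(1)])

text \<open>The map to be lifted takes values in a tensor product over the target ring; restricting
  its scalars along f makes it bilinear over the source ring, where the lift is formed.\<close>

lemma
  assumes "module_functor R M" "module_functor R N" "S \<in> Calg R" "T \<in> Calg R"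
    and "f \<in> alg_hom R S T"
  shows tensor_mfun_Ar_lin: "Ar (tensor_mfun M N) S T f \<in>
      lin_hom (fst S) (Ob (tensor_mfun M N) S) (restrict_scalars f (Ob (tensor_mfun M N) T))"
    and tensor_mfun_Ar_pure: "\<lbrakk>x \<in> carrier (Ob M S); y \<in> carrier (Ob N S)\<rbrakk> \<Longrightarrow>
      Ar (tensor_mfun M N) S T f (pure_tensor (fst S) (Ob M S) (Ob N S) x y) =
      pure_tensor (fst T) (Ob M T) (Ob N T) (Ar M S T f x) (Ar N S T f y)"
proof -
  interpret M: module_functor R M by fact
  interpret N: module_functor R N by fact
  note mods = M.module[OF assms(3)] M.module[OF assms(4)] N.module[OF assms(3)] N.module[OF assms(4)]
  note f = alg_homD(1)[OF assms(5)]
  have b: "(\<lambda>x y. pure_tensor (fst T) (Ob M T) (Ob N T) (Ar M S T f x) (Ar N S T f y)) \<in>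
      bilin (fst S) (Ob M S) (Ob N S) (restrict_scalars f (tensor (fst T) (Ob M T) (Ob N T)))"
    using bilin_restrict[OF pure_tensor_bilin[OF mods(2,4)] f]
      module_functor_Ar_lin[OF assms(1,3,4,5)] module_functor_Ar_lin[OF assms(2,3,4,5)]
    by (rule bilin_comp)
  have P: "module (fst S) (restrict_scalars f (tensor (fst T) (Ob M T) (Ob N T)))"
    by (intro module_restrict_scalars[OF CalgD(1)[OF assms(3)] _ f] module_tensor mods)
  show "Ar (tensor_mfun M N) S T f \<in>
      lin_hom (fst S) (Ob (tensor_mfun M N) S) (restrict_scalars f (Ob (tensor_mfun M N) T))"
    using tensor_lift_lin[OF mods(1,3) P b] by (simp add: tensor_mfun_def)
  show "\<lbrakk>x \<in> carrier (Ob M S); y \<in> carrier (Ob N S)\<rbrakk> \<Longrightarrow>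
      Ar (tensor_mfun M N) S T f (pure_tensor (fst S) (Ob M S) (Ob N S) x y) =
      pure_tensor (fst T) (Ob M T) (Ob N T) (Ar M S T f x) (Ar N S T f y)"
    using tensor_lift_pure[OF mods(1,3) P b] by (simp add: tensor_mfun_def)
qed

lemma tensor_mfun_Ob [simp]: "Ob (tensor_mfun M N) S = tensor (fst S) (Ob M S) (Ob N S)"
  by (simp add: tensor_mfun_def)

lemma tensor_mfun_functor:
  assumes "module_functor R M" "module_functor R N"
  shows "module_functor R (tensor_mfun M N)"
proof -
  interpret M: module_functor R M by fact
  interpret N: module_functor R N by fact
  note lin = tensor_mfun_Ar_lin[OF assms, simplified]
  note pure = tensor_mfun_Ar_pure[OF assms]
  show ?thesis
  proof (rule module_functorI)
    fix S assume S: "S \<in> Calg R"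
    interpret MN: module_pair "fst S" "Ob M S" "Ob N S"
      using S M.module N.module by (intro module_pairI)
    show "module (fst S) (Ob (tensor_mfun M N) S)"
      using MN.tensor_module by simp
    show "Ar (tensor_mfun M N) S S (\<lambda>s\<in>carrier (fst S). s) x = x"
      if "x \<in> carrier (Ob (tensor_mfun M N) S)" for x
    proof -
      note id = alg_hom_id[OF S]
      have "x \<in> carrier (tensor (fst S) (Ob M S) (Ob N S))" using that by simp
      then show ?thesis
      proof (induction rule: MN.tensor_induct)
        case (pure x y)
        then show ?case
          by (simp add: tensor_mfun_Ar_pure[OF assms S S id] M.map_id[OF S] N.map_id[OF S] del: restrict_apply)
      next
        case (add s t)
        then show ?case
          using lin_hom_add[OF lin[OF S S id]] by (simp del: restrict_apply)
      qed
    qed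
    show "Ar (tensor_mfun M N) S U (compose (carrier (fst S)) g f) x =
        Ar (tensor_mfun M N) T U g (Ar (tensor_mfun M N) S T f x)"
      if T: "T \<in> Calg R" and U: "U \<in> Calg R" and f: "f \<in> alg_hom R S T" and g: "g \<in> alg_hom R T U"
        and "x \<in> carrier (Ob (tensor_mfun M N) S)" for T U f g x
    proof -
      note gf = alg_hom_compose[OF S f g]
      have "x \<in> carrier (tensor (fst S) (Ob M S) (Ob N S))" using that by simp
      then show ?thesis
      proof (induction rule: MN.tensor_induct)
        case (pure x y)
        then show ?case
          using S T U f g gf by (simp add: tensor_mfun_Ar_pure[OF assms] M.map_closed N.map_closed
              M.map_comp[OF S T U f g] N.map_comp[OF S T U f g])
      next
        case (add s t)
        then show ?case
          using lin_hom_add[OF lin[OF S U gf]] lin_hom_add[OF lin[OF S T f]]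
            lin_hom_add[OF lin[OF T U g]] lin_hom_closed[OF lin[OF S T f]] by simp
      qed
    qed
  qed (rule tensor_mfun_Ar_lin[OF assms])
qed

subsection \<open>Dual functors\<close>

lemma dual_Ob_simps [simp]:
  "carrier (Ob (dual R M) S) = dual_carrier R M S"
  "\<zero>\<^bsub>Ob (dual R M) S\<^esub> = (\<lambda>T\<in>Calg (fst S). \<lambda>x\<in>carrier (Ob M (base_alg R S T)). \<zero>\<^bsub>fst T\<^esub>)"
  "v \<oplus>\<^bsub>Ob (dual R M) S\<^esub> w =
     (\<lambda>T\<in>Calg (fst S). \<lambda>x\<in>carrier (Ob M (base_alg R S T)). v T x \<oplus>\<^bsub>fst T\<^esub> w T x)"
  "s \<odot>\<^bsub>Ob (dual R M) S\<^esub> w =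
     (\<lambda>T\<in>Calg (fst S). \<lambda>x\<in>carrier (Ob M (base_alg R S T)). snd T s \<otimes>\<^bsub>fst T\<^esub> w T x)"
  by (auto simp: dual_def)

lemma dual_Ar: "Ar (dual R M) S S' f w =
    (\<lambda>T\<in>Calg (fst S'). w (fst T, compose (carrier (fst S)) (snd T) f))"
  by (simp add: dual_def)

lemma dual_carrierD:
  assumes "w \<in> dual_carrier R M S" "T \<in> Calg (fst S)"
  shows "w T \<in> lin_hom (fst T) (Ob M (base_alg R S T)) (ring_as_module (fst T))"
    and "\<lbrakk>U \<in> Calg (fst S); f \<in> alg_hom (fst S) T U; x \<in> carrier (Ob M (base_alg R S T))\<rbrakk> \<Longrightarrow>
      w U (Ar M (base_alg R S T) (base_alg R S U) f x) = f (w T x)"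
    and "w T \<in> extensional (carrier (Ob M (base_alg R S T)))"
    and "x \<in> carrier (Ob M (base_alg R S T)) \<Longrightarrow> w T x \<in> carrier (fst T)"
  using assms by (auto simp: dual_carrier_def module_morphism_def restr_mfun_def lin_hom_def)

lemma dual_carrier_extensional: "w \<in> dual_carrier R M S \<Longrightarrow> w \<in> extensional (Calg (fst S))"
  by (simp add: dual_carrier_def)

text \<open>Cutting \<phi> down to the carriers settles the extensionality clauses, so that later
  constructions of dual elements only have to check linearity and naturality of plain
  formulas.\<close>

lemma dual_carrierI:
  assumes "cring R" "module_functor R M" "S \<in> Calg R"
    and "\<And>T. T \<in> Calg (fst S) \<Longrightarrow>
      \<phi> T \<in> lin_hom (fst T) (Ob M (base_alg R S T)) (ring_as_module (fst T))"
    and "\<And>T U f x. \<lbrakk>T \<in> Calg (fst S); U \<in> Calg (fst S); f \<in> alg_hom (fst S) T U;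
      x \<in> carrier (Ob M (base_alg R S T))\<rbrakk> \<Longrightarrow>
      \<phi> U (Ar M (base_alg R S T) (base_alg R S U) f x) = f (\<phi> T x)"
  shows "(\<lambda>T\<in>Calg (fst S). \<lambda>x\<in>carrier (Ob M (base_alg R S T)). \<phi> T x) \<in> dual_carrier R M S"
proof -
  interpret M: module_functor R M by fact
  have lin: "(\<lambda>x\<in>carrier (Ob M (base_alg R S T)). \<phi> T x) \<in>
      lin_hom (fst T) (Ob M (base_alg R S T)) (ring_as_module (fst T))" if "T \<in> Calg (fst S)" for T
    using M.module[OF base_alg_Calg[OF assms(1,3) that]]
    by (intro lin_hom_cong[OF _ assms(4)[OF that]]) simp_all
  show ?thesis
    unfolding dual_carrier_def module_morphism_def
  proof (intro CollectI conjI ballI)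
    fix T U f x assume TU: "T \<in> Calg (fst S)" "U \<in> Calg (fst S)" and f: "f \<in> alg_hom (fst S) T U"
      and "x \<in> carrier (Ob (restr_mfun R S M) T)"
    then have x: "x \<in> carrier (Ob M (base_alg R S T))" by (simp add: restr_mfun_def)
    have "Ar M (base_alg R S T) (base_alg R S U) f x \<in> carrier (Ob M (base_alg R S U))"
      using TU f x by (intro M.map_closed base_alg_Calg[OF assms(1,3)] alg_hom_base_alg[OF assms(3)])
    then show "(\<lambda>T\<in>Calg (fst S). \<lambda>x\<in>carrier (Ob M (base_alg R S T)). \<phi> T x) U
          (Ar (restr_mfun R S M) T U f x) =
        Ar ring_mfun T U f ((\<lambda>T\<in>Calg (fst S). \<lambda>x\<in>carrier (Ob M (base_alg R S T)). \<phi> T x) T x)"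
      using TU x assms(5)[OF TU f x] by (simp add: restr_mfun_def)
  qed (simp_all add: restr_mfun_def lin)
qed

lemma dual_eqI:
  assumes "v \<in> dual_carrier R M S" "w \<in> dual_carrier R M S"
    and "\<And>T x. \<lbrakk>T \<in> Calg (fst S); x \<in> carrier (Ob M (base_alg R S T))\<rbrakk> \<Longrightarrow> v T x = w T x"
  shows "v = w"
proof (rule extensionalityI[OF dual_carrier_extensional dual_carrier_extensional])
  fix T assume T: "T \<in> Calg (fst S)"
  show "v T = w T"
    using dual_carrierD(3)[OF assms(1) T] dual_carrierD(3)[OF assms(2) T] assms(3)[OF T]
    by (rule extensionalityI)
qed (use assms in auto)

lemma dual_Ar_snd:
  assumes "T \<in> Calg (fst S)" "U \<in> Calg (fst T)"
  shows "Ar (dual R M) S (base_alg R S T) (snd T) w U = w (base_alg (fst S) T U)"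
  using assms by (simp add: dual_Ar base_alg_def)

text \<open>Evaluating at T equals pushing w forward along the structure map of T and evaluating at
  T over itself. Hence evaluations at \<open>self_alg\<close>, after all base changes, determine an
  element of the dual.\<close>

lemma dual_Ar_self:
  assumes "T \<in> Calg (fst S)"
  shows "Ar (dual R M) S (base_alg R S T) (snd T) w (self_alg (fst T)) = w T"
  using dual_Ar_snd[OF assms self_alg_Calg[OF CalgD(1)[OF assms]]] base_alg_self[OF assms] by simp

context
  fixes R :: "'u ring" and M :: "('u, 'm) mfun"
  assumes R: "cring R" and M: "module_functor R M"
begin

interpretation M: module_functor R M by (rule M)

lemma dual_pull:
  assumes "S \<in> Calg R" "S' \<in> Calg R" "f \<in> alg_hom R S S'" "T \<in> Calg (fst S')"
  shows "(fst T, compose (carrier (fst S)) (snd T) f) \<in> Calg (fst S)"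
    and "base_alg R S (fst T, compose (carrier (fst S)) (snd T) f) = base_alg R S' T"
    and "g \<in> alg_hom (fst S') T U \<Longrightarrow> g \<in> alg_hom (fst S)
      (fst T, compose (carrier (fst S)) (snd T) f) (fst U, compose (carrier (fst S)) (snd U) f)"
proof -
  note B = alg_hom_base[OF assms(1,3,2)]
  \<comment> \<open>Reading f as the structure map of an S-algebra turns restriction along f into an
    instance of \<open>base_alg\<close>.\<close>
  have eq: "(fst T, compose (carrier (fst S)) (snd T) f) = base_alg (fst S) (fst S', f) T" for T
    by (simp add: base_alg_def)
  show "(fst T, compose (carrier (fst S)) (snd T) f) \<in> Calg (fst S)"
    unfolding eq by (rule base_alg_Calg[OF CalgD(1)[OF assms(1)] B(1)]) (simp add: assms(4))
  show "base_alg R S (fst T, compose (carrier (fst S)) (snd T) f) = base_alg R S' T"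
    unfolding eq base_alg_assoc[OF assms(1)] B(2) ..
  show "g \<in> alg_hom (fst S)
      (fst T, compose (carrier (fst S)) (snd T) f) (fst U, compose (carrier (fst S)) (snd U) f)"
    if "g \<in> alg_hom (fst S') T U"
    unfolding eq by (rule alg_hom_base_alg[OF B(1)]) (simp add: that)
qed

text \<open>The module laws hold pointwise in the rings \<open>fst T\<close>. The content is that
  the operations preserve naturality; for scalars this uses that an S-algebra map from T to U
  carries the structure map of T to that of U.\<close>

lemma dual_module:
  assumes S: "S \<in> Calg R"
  shows "module (fst S) (Ob (dual R M) S)"
proof -
  let ?Q = "Ob (dual R M) S"
  note I = dual_carrierI[OF R M S]
  have cr: "cring (fst T)" if "T \<in> Calg (fst S)" for T using CalgD(1)[OF that] .
  have mod: "module (fst T) (Ob M (base_alg R S T))" if "T \<in> Calg (fst S)" for T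
    using M.module[OF base_alg_Calg[OF R S that]] by simp
  have add: "v \<oplus>\<^bsub>?Q\<^esub> w \<in> dual_carrier R M S"
    if v: "v \<in> dual_carrier R M S" and w: "w \<in> dual_carrier R M S" for v w
    unfolding dual_Ob_simps
  proof (rule I)
    fix T assume T: "T \<in> Calg (fst S)"
    show "(\<lambda>x. v T x \<oplus>\<^bsub>fst T\<^esub> w T x) \<in> lin_hom (fst T) (Ob M (base_alg R S T)) (ring_as_module (fst T))"
      using lin_hom_sum[OF module_ring[OF cr[OF T]] dual_carrierD(1)[OF v T] dual_carrierD(1)[OF w T]]
      by simp
    fix U f x assume "U \<in> Calg (fst S)" "f \<in> alg_hom (fst S) T U" "x \<in> carrier (Ob M (base_alg R S T))"
    with T v w dual_carrierD(4)[OF v T] dual_carrierD(4)[OF w T] show "v U (Ar M (base_alg R S T) (base_alg R S U) f x) \<oplus>\<^bsub>fst U\<^esub>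
        w U (Ar M (base_alg R S T) (base_alg R S U) f x) = f (v T x \<oplus>\<^bsub>fst T\<^esub> w T x)"
      by (simp add: dual_carrierD(2) ring_hom_add[OF alg_homD(1)])
  qed
  have smult: "s \<odot>\<^bsub>?Q\<^esub> w \<in> dual_carrier R M S"
    if s: "s \<in> carrier (fst S)" and w: "w \<in> dual_carrier R M S" for s w
    unfolding dual_Ob_simps
  proof (rule I)
    fix T assume T: "T \<in> Calg (fst S)"
    interpret T: cring "fst T" using T by (rule cr)
    interpret MT: module "fst T" "Ob M (base_alg R S T)" using T by (rule mod)
    have sT: "snd T s \<in> carrier (fst T)" using CalgD(4)[OF T] s by simp
    note wT = dual_carrierD(1)[OF w T]
    show "(\<lambda>x. snd T s \<otimes>\<^bsub>fst T\<^esub> w T x) \<in> lin_hom (fst T) (Ob M (base_alg R S T)) (ring_as_module (fst T))"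
      using sT lin_hom_closed[OF wT] lin_hom_add[OF wT] lin_hom_smult[OF wT]
      by (intro lin_homI) (auto simp: T.r_distr T.m_lcomm)
    fix U f x assume *: "U \<in> Calg (fst S)" "f \<in> alg_hom (fst S) T U" "x \<in> carrier (Ob M (base_alg R S T))"
    have "snd U s = f (snd T s)"
      using alg_homD(3)[OF *(2)] s by (metis compose_eq)
    with * T w sT dual_carrierD(4)[OF w T] show "snd U s \<otimes>\<^bsub>fst U\<^esub> w U (Ar M (base_alg R S T) (base_alg R S U) f x) =
        f (snd T s \<otimes>\<^bsub>fst T\<^esub> w T x)"
      by (simp add: dual_carrierD(2) ring_hom_mult[OF alg_homD(1)])
  qed
  have zero: "\<zero>\<^bsub>?Q\<^esub> \<in> dual_carrier R M S"
    unfolding dual_Ob_simps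
  proof (rule I)
    fix T assume T: "T \<in> Calg (fst S)"
    interpret T: cring "fst T" using T by (rule cr)
    show "(\<lambda>x. \<zero>\<^bsub>fst T\<^esub>) \<in> lin_hom (fst T) (Ob M (base_alg R S T)) (ring_as_module (fst T))"
      by (intro lin_homI) auto
    fix U f x assume *: "U \<in> Calg (fst S)" "f \<in> alg_hom (fst S) T U"
    interpret U: cring "fst U" using *(1) by (rule cr)
    show "\<zero>\<^bsub>fst U\<^esub> = f \<zero>\<^bsub>fst T\<^esub>"
      using ring_hom_zero[OF alg_homD(1)[OF *(2)] T.ring_axioms U.ring_axioms] by simp
  qed
  interpret S: cring "fst S" using CalgD(1)[OF S] .
  have inv: "\<exists>v\<in>carrier ?Q. v \<oplus>\<^bsub>?Q\<^esub> w = \<zero>\<^bsub>?Q\<^esub>"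
    if w: "w \<in> carrier ?Q" for w
  proof (intro bexI)
    have sw: "(\<ominus>\<^bsub>fst S\<^esub> \<one>\<^bsub>fst S\<^esub>) \<odot>\<^bsub>?Q\<^esub> w \<in> dual_carrier R M S"
      using w by (intro smult) auto
    then show "(\<ominus>\<^bsub>fst S\<^esub> \<one>\<^bsub>fst S\<^esub>) \<odot>\<^bsub>?Q\<^esub> w \<in> carrier ?Q" by simp
    show "(\<ominus>\<^bsub>fst S\<^esub> \<one>\<^bsub>fst S\<^esub>) \<odot>\<^bsub>?Q\<^esub> w \<oplus>\<^bsub>?Q\<^esub> w = \<zero>\<^bsub>?Q\<^esub>"
    proof (rule dual_eqI[OF add[OF sw] zero])
      show "w \<in> dual_carrier R M S" using w by simp
      fix T x assume T: "T \<in> Calg (fst S)" and x: "x \<in> carrier (Ob M (base_alg R S T))"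
      interpret T: cring "fst T" using T by (rule cr)
      interpret h: ring_hom_cring "fst S" "fst T" "snd T"
        using CalgD(2)[OF T] by unfold_locales
      show "((\<ominus>\<^bsub>fst S\<^esub> \<one>\<^bsub>fst S\<^esub>) \<odot>\<^bsub>?Q\<^esub> w \<oplus>\<^bsub>?Q\<^esub> w) T x = \<zero>\<^bsub>?Q\<^esub> T x"
        using T x w dual_carrierD(4)[where R = R and M = M and S = S, OF _ T x]
        by (simp add: T.l_minus T.l_neg)
    qed
  qed
  note pointwise = dual_eqI[where R = R and M = M and S = S]
  note val = dual_carrierD(4)[where R = R and M = M and S = S]
  let ?D = "dual_carrier R M S"
  have car: "carrier ?Q = ?D" by simp
  have "abelian_group ?Q"
  proof (rule abelian_groupI, unfold car)
    fix u assume u: "u \<in> ?D"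
    from inv[unfolded car, OF u] show "\<exists>v\<in>?D. v \<oplus>\<^bsub>?Q\<^esub> u = \<zero>\<^bsub>?Q\<^esub>" .
    show "\<zero>\<^bsub>?Q\<^esub> \<oplus>\<^bsub>?Q\<^esub> u = u"
    proof (rule pointwise)
      show "\<zero>\<^bsub>?Q\<^esub> \<oplus>\<^bsub>?Q\<^esub> u \<in> dual_carrier R M S" by (intro add zero u)
      show "u \<in> dual_carrier R M S" by (rule u)
      fix T x assume T: "T \<in> Calg (fst S)" and x: "x \<in> carrier (Ob M (base_alg R S T))"
      interpret T: cring "fst T" using T by (rule cr)
      show "(\<zero>\<^bsub>?Q\<^esub> \<oplus>\<^bsub>?Q\<^esub> u) T x = (u) T x"
        using T x val u by (simp)
    qed
    fix v assume v: "v \<in> ?D"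
    show "u \<oplus>\<^bsub>?Q\<^esub> v \<in> ?D" using u v by (rule add)
    show "u \<oplus>\<^bsub>?Q\<^esub> v = v \<oplus>\<^bsub>?Q\<^esub> u"
    proof (rule pointwise)
      show "u \<oplus>\<^bsub>?Q\<^esub> v \<in> dual_carrier R M S" by (intro add u v)
      show "v \<oplus>\<^bsub>?Q\<^esub> u \<in> dual_carrier R M S" by (intro add u v)
      fix T x assume T: "T \<in> Calg (fst S)" and x: "x \<in> carrier (Ob M (base_alg R S T))"
      interpret T: cring "fst T" using T by (rule cr)
      show "(u \<oplus>\<^bsub>?Q\<^esub> v) T x = (v \<oplus>\<^bsub>?Q\<^esub> u) T x"
        using T x val u v by (simp add: T.a_comm)
    qed
    fix w assume w: "w \<in> ?D"
    show "(u \<oplus>\<^bsub>?Q\<^esub> v) \<oplus>\<^bsub>?Q\<^esub> w = u \<oplus>\<^bsub>?Q\<^esub> (v \<oplus>\<^bsub>?Q\<^esub> w)"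
    proof (rule pointwise)
      show "(u \<oplus>\<^bsub>?Q\<^esub> v) \<oplus>\<^bsub>?Q\<^esub> w \<in> dual_carrier R M S" by (intro add u v w)
      show "u \<oplus>\<^bsub>?Q\<^esub> (v \<oplus>\<^bsub>?Q\<^esub> w) \<in> dual_carrier R M S" by (intro add u v w)
      fix T x assume T: "T \<in> Calg (fst S)" and x: "x \<in> carrier (Ob M (base_alg R S T))"
      interpret T: cring "fst T" using T by (rule cr)
      show "((u \<oplus>\<^bsub>?Q\<^esub> v) \<oplus>\<^bsub>?Q\<^esub> w) T x = (u \<oplus>\<^bsub>?Q\<^esub> (v \<oplus>\<^bsub>?Q\<^esub> w)) T x"
        using T x val u v w by (simp add: T.a_assoc)
    qed
  qed (rule zero)
  then show ?thesis
  proof (rule moduleI[OF S.is_cring], unfold car)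
    fix u assume u: "u \<in> ?D"
    show "\<one>\<^bsub>fst S\<^esub> \<odot>\<^bsub>?Q\<^esub> u = u"
    proof (rule pointwise)
      show "\<one>\<^bsub>fst S\<^esub> \<odot>\<^bsub>?Q\<^esub> u \<in> dual_carrier R M S" by (intro smult u S.one_closed)
      show "u \<in> dual_carrier R M S" by (rule u)
      fix T x assume T: "T \<in> Calg (fst S)" and x: "x \<in> carrier (Ob M (base_alg R S T))"
      interpret T: cring "fst T" using T by (rule cr)
      show "(\<one>\<^bsub>fst S\<^esub> \<odot>\<^bsub>?Q\<^esub> u) T x = (u) T x"
        using T x val u by (simp add: ring_hom_one[OF CalgD(2)[OF T]])
    qed
    fix a assume a: "a \<in> carrier (fst S)"
    show "a \<odot>\<^bsub>?Q\<^esub> u \<in> ?D" using a u by (rule smult)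
    {
      fix b assume b: "b \<in> carrier (fst S)"
      show "(a \<oplus>\<^bsub>fst S\<^esub> b) \<odot>\<^bsub>?Q\<^esub> u = a \<odot>\<^bsub>?Q\<^esub> u \<oplus>\<^bsub>?Q\<^esub> b \<odot>\<^bsub>?Q\<^esub> u"
      proof (rule pointwise)
        show "(a \<oplus>\<^bsub>fst S\<^esub> b) \<odot>\<^bsub>?Q\<^esub> u \<in> dual_carrier R M S" by (intro smult u a b S.a_closed)
        show "a \<odot>\<^bsub>?Q\<^esub> u \<oplus>\<^bsub>?Q\<^esub> b \<odot>\<^bsub>?Q\<^esub> u \<in> dual_carrier R M S" by (intro add smult u a b)
        fix T x assume T: "T \<in> Calg (fst S)" and x: "x \<in> carrier (Ob M (base_alg R S T))"
        interpret T: cring "fst T" using T by (rule cr)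
        show "((a \<oplus>\<^bsub>fst S\<^esub> b) \<odot>\<^bsub>?Q\<^esub> u) T x = (a \<odot>\<^bsub>?Q\<^esub> u \<oplus>\<^bsub>?Q\<^esub> b \<odot>\<^bsub>?Q\<^esub> u) T x"
          using T x val a b u CalgD(4)[OF T] by (simp add: ring_hom_add[OF CalgD(2)[OF T]] T.l_distr)
      qed
      show "(a \<otimes>\<^bsub>fst S\<^esub> b) \<odot>\<^bsub>?Q\<^esub> u = a \<odot>\<^bsub>?Q\<^esub> (b \<odot>\<^bsub>?Q\<^esub> u)"
      proof (rule pointwise)
        show "(a \<otimes>\<^bsub>fst S\<^esub> b) \<odot>\<^bsub>?Q\<^esub> u \<in> dual_carrier R M S" by (intro smult u a b S.m_closed)
        show "a \<odot>\<^bsub>?Q\<^esub> (b \<odot>\<^bsub>?Q\<^esub> u) \<in> dual_carrier R M S" by (intro smult u a b)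
        fix T x assume T: "T \<in> Calg (fst S)" and x: "x \<in> carrier (Ob M (base_alg R S T))"
        interpret T: cring "fst T" using T by (rule cr)
        show "((a \<otimes>\<^bsub>fst S\<^esub> b) \<odot>\<^bsub>?Q\<^esub> u) T x = (a \<odot>\<^bsub>?Q\<^esub> (b \<odot>\<^bsub>?Q\<^esub> u)) T x"
          using T x val a b u CalgD(4)[OF T] by (simp add: ring_hom_mult[OF CalgD(2)[OF T]] T.m_assoc)
      qed
    next
      fix v assume v: "v \<in> ?D"
      show "a \<odot>\<^bsub>?Q\<^esub> (u \<oplus>\<^bsub>?Q\<^esub> v) = a \<odot>\<^bsub>?Q\<^esub> u \<oplus>\<^bsub>?Q\<^esub> a \<odot>\<^bsub>?Q\<^esub> v"
      proof (rule pointwise)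
        show "a \<odot>\<^bsub>?Q\<^esub> (u \<oplus>\<^bsub>?Q\<^esub> v) \<in> dual_carrier R M S" by (intro smult add u a v)
        show "a \<odot>\<^bsub>?Q\<^esub> u \<oplus>\<^bsub>?Q\<^esub> a \<odot>\<^bsub>?Q\<^esub> v \<in> dual_carrier R M S" by (intro add smult u a v)
        fix T x assume T: "T \<in> Calg (fst S)" and x: "x \<in> carrier (Ob M (base_alg R S T))"
        interpret T: cring "fst T" using T by (rule cr)
        show "(a \<odot>\<^bsub>?Q\<^esub> (u \<oplus>\<^bsub>?Q\<^esub> v)) T x = (a \<odot>\<^bsub>?Q\<^esub> u \<oplus>\<^bsub>?Q\<^esub> a \<odot>\<^bsub>?Q\<^esub> v) T x"
          using T x val a v u CalgD(4)[OF T] by (simp add: T.r_distr)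
      qed
    }
  qed
qed

lemma dual_Ar_closed:
  assumes "S \<in> Calg R" "S' \<in> Calg R" "f \<in> alg_hom R S S'" "w \<in> dual_carrier R M S"
  shows "Ar (dual R M) S S' f w \<in> dual_carrier R M S'"
proof -
  note pull = dual_pull[OF assms(1-3)]
  have "(\<lambda>T\<in>Calg (fst S'). \<lambda>x\<in>carrier (Ob M (base_alg R S' T)).
      w (fst T, compose (carrier (fst S)) (snd T) f) x) \<in> dual_carrier R M S'"
  proof (rule dual_carrierI[OF R M assms(2)])
    fix T assume T: "T \<in> Calg (fst S')"
    show "w (fst T, compose (carrier (fst S)) (snd T) f) \<in>
        lin_hom (fst T) (Ob M (base_alg R S' T)) (ring_as_module (fst T))"
      using dual_carrierD(1)[OF assms(4) pull(1)[OF T]] pull(2)[OF T] by simp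
    fix U g x assume U: "U \<in> Calg (fst S')" "g \<in> alg_hom (fst S') T U"
      "x \<in> carrier (Ob M (base_alg R S' T))"
    then show "w (fst U, compose (carrier (fst S)) (snd U) f)
          (Ar M (base_alg R S' T) (base_alg R S' U) g x) =
        g (w (fst T, compose (carrier (fst S)) (snd T) f) x)"
      using dual_carrierD(2)[OF assms(4) pull(1)[OF T] pull(1)[OF U(1)] pull(3)[OF T U(2)]]
        pull(2)[OF T] pull(2)[OF U(1)] by simp
  qed
  also have "(\<lambda>T\<in>Calg (fst S'). \<lambda>x\<in>carrier (Ob M (base_alg R S' T)).
      w (fst T, compose (carrier (fst S)) (snd T) f) x) = Ar (dual R M) S S' f w"
    unfolding dual_Ar
  proof (rule restrict_ext)
    fix T assume T: "T \<in> Calg (fst S')"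
    show "(\<lambda>x\<in>carrier (Ob M (base_alg R S' T)). w (fst T, compose (carrier (fst S)) (snd T) f) x) =
        w (fst T, compose (carrier (fst S)) (snd T) f)"
      using dual_carrierD(3)[OF assms(4) pull(1)[OF T]] pull(2)[OF T]
      by (simp add: extensional_restrict)
  qed
  finally show ?thesis .
qed

lemma dual_functor: "module_functor R (dual R M)"
proof (rule module_functorI)
  fix S assume S: "S \<in> Calg R"
  show "module (fst S) (Ob (dual R M) S)" using S by (rule dual_module)
  fix w assume w: "w \<in> carrier (Ob (dual R M) S)"
  show "Ar (dual R M) S S (\<lambda>s\<in>carrier (fst S). s) w = w"
  proof (rule extensionalityI)
    fix T assume T: "T \<in> Calg (fst S)"
    have "compose (carrier (fst S)) (snd T) (\<lambda>s\<in>carrier (fst S). s) = snd T"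
      using CalgD(3)[OF T] by (auto simp: compose_def extensional_def fun_eq_iff)
    then show "Ar (dual R M) S S (\<lambda>s\<in>carrier (fst S). s) w T = w T"
      using T by (simp add: dual_Ar)
  qed (use w dual_carrier_extensional[of w R M S] in \<open>simp_all add: dual_Ar\<close>)
  fix T f assume T: "T \<in> Calg R" and f: "f \<in> alg_hom R S T"
  note pull = dual_pull[OF S T f]
  show "Ar (dual R M) S U (compose (carrier (fst S)) g f) w =
      Ar (dual R M) T U g (Ar (dual R M) S T f w)"
    if U: "U \<in> Calg R" and g: "g \<in> alg_hom R T U" for U g
    unfolding dual_Ar
  proof (rule restrict_ext)
    fix V assume V: "V \<in> Calg (fst U)"
    have "compose (carrier (fst S)) (snd V) (compose (carrier (fst S)) g f) =
        compose (carrier (fst S)) (compose (carrier (fst T)) (snd V) g) f"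
      using alg_homD(4)[OF f] by (auto simp: compose_def fun_eq_iff)
    then show "w (fst V, compose (carrier (fst S)) (snd V) (compose (carrier (fst S)) g f)) =
        (\<lambda>T'\<in>Calg (fst T). w (fst T', compose (carrier (fst S)) (snd T') f))
          (fst V, compose (carrier (fst T)) (snd V) g)"
      using dual_pull(1)[OF T U g V] by simp
  qed
next
  fix S T f assume S: "S \<in> Calg R" and T: "T \<in> Calg R" and f: "f \<in> alg_hom R S T"
  note pull = dual_pull[OF S T f]
  show "Ar (dual R M) S T f \<in>
      lin_hom (fst S) (Ob (dual R M) S) (restrict_scalars f (Ob (dual R M) T))"
  proof (rule lin_homI)
    fix w assume w: "w \<in> carrier (Ob (dual R M) S)"
    show "Ar (dual R M) S T f w \<in> carrier (restrict_scalars f (Ob (dual R M) T))"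
      using dual_Ar_closed[OF S T f] w by simp
    show "Ar (dual R M) S T f (w \<oplus>\<^bsub>Ob (dual R M) S\<^esub> v) =
        Ar (dual R M) S T f w \<oplus>\<^bsub>restrict_scalars f (Ob (dual R M) T)\<^esub> Ar (dual R M) S T f v" for v
      by (rule extensionalityI[where A = "Calg (fst T)"]) (simp_all add: dual_Ar pull(1,2))
    show "Ar (dual R M) S T f (a \<odot>\<^bsub>Ob (dual R M) S\<^esub> w) =
        a \<odot>\<^bsub>restrict_scalars f (Ob (dual R M) T)\<^esub> Ar (dual R M) S T f w" if "a \<in> carrier (fst S)" for a
      by (rule extensionalityI[where A = "Calg (fst T)"])
         (simp_all add: dual_Ar pull(1,2) compose_eq that)
  qed
qed

end

subsection \<open>Morphisms into dual functors\<close>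

lemma module_morphismD:
  assumes "module_morphism R M N \<alpha>"
  shows "S \<in> Calg R \<Longrightarrow> \<alpha> S \<in> lin_hom (fst S) (Ob M S) (Ob N S)"
    and "\<lbrakk>S \<in> Calg R; T \<in> Calg R; f \<in> alg_hom R S T; x \<in> carrier (Ob M S)\<rbrakk> \<Longrightarrow>
      \<alpha> T (Ar M S T f x) = Ar N S T f (\<alpha> S x)"
    and "\<lbrakk>S \<in> Calg R; x \<in> carrier (Ob M S)\<rbrakk> \<Longrightarrow> \<alpha> S x \<in> carrier (Ob N S)"
  using assms by (auto simp: module_morphism_def lin_hom_closed)

lemma module_morphismI:
  assumes "\<And>S. S \<in> Calg R \<Longrightarrow> \<alpha> S \<in> lin_hom (fst S) (Ob M S) (Ob N S)"
    and "\<And>S T f x. \<lbrakk>S \<in> Calg R; T \<in> Calg R; f \<in> alg_hom R S T; x \<in> carrier (Ob M S)\<rbrakk> \<Longrightarrow>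
      \<alpha> T (Ar M S T f x) = Ar N S T f (\<alpha> S x)"
  shows "module_morphism R M N \<alpha>"
  using assms by (simp add: module_morphism_def)

text \<open>Combines \<open>dual_eqI\<close> with \<open>dual_Ar_self\<close>. Identities in the
  dual are checked in this form because a flipped morphism has a simple value at
  \<open>self_alg\<close>.\<close>

lemma dual_eqI_self:
  assumes "v \<in> dual_carrier R M S" "w \<in> dual_carrier R M S"
    and "\<And>T x. \<lbrakk>T \<in> Calg (fst S); x \<in> carrier (Ob M (base_alg R S T))\<rbrakk> \<Longrightarrow>
      Ar (dual R M) S (base_alg R S T) (snd T) v (self_alg (fst T)) x =
      Ar (dual R M) S (base_alg R S T) (snd T) w (self_alg (fst T)) x"
  shows "v = w"
  using assms(1,2)
proof (rule dual_eqI)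
  fix T x assume *: "T \<in> Calg (fst S)" "x \<in> carrier (Ob M (base_alg R S T))"
  from assms(3)[OF this] show "v T x = w T x"
    by (simp add: dual_Ar_self[OF *(1)])
qed

lemma dual_eval_lin:
  assumes "module_functor R M" "S \<in> Calg R" "x \<in> carrier (Ob M S)"
  shows "(\<lambda>w. w (self_alg (fst S)) x) \<in> lin_hom (fst S) (Ob (dual R M) S) (ring_as_module (fst S))"
  using assms(2,3) self_alg_Calg[OF CalgD(1)[OF assms(2)]] dual_carrierD(4)[of _ R M S "self_alg (fst S)" x]
  by (intro lin_homI) (simp_all add: base_alg_self)

text \<open>Naturality of \<phi> along the structure map of T, read off at T over itself.\<close>

lemma module_morphism_dual_self:
  assumes "cring R" "module_morphism R M (dual R N) \<phi>" "S \<in> Calg R" "T \<in> Calg (fst S)"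
    and "x \<in> carrier (Ob M S)"
  shows "\<phi> (base_alg R S T) (Ar M S (base_alg R S T) (snd T) x) (self_alg (fst T)) = \<phi> S x T"
  using module_morphismD(2)[OF assms(2,3) base_alg_Calg[OF assms(1,3,4)] snd_alg_hom[OF assms(4)] assms(5)]
  by (simp add: dual_Ar_self[OF assms(4)])

context
  fixes R :: "'u ring" and M :: "('u, 'm) mfun" and N :: "('u, 'n) mfun"
  assumes R: "cring R" and M: "module_functor R M" and N: "module_functor R N"
begin

interpretation M: module_functor R M by (rule M)
interpretation N: module_functor R N by (rule N)

text \<open>Two different naturalities are combined along f: that of the morphism \<phi> in its
  algebra argument, and that of the single dual element \<phi>(x) in the algebra at which it is
  evaluated.\<close>

lemma dual_flip_closed:
  assumes \<phi>: "module_morphism R M (dual R N) \<phi>" and S: "S \<in> Calg R" and y: "y \<in> carrier (Ob N S)"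
  shows "dual_flip R M N \<phi> S y \<in> dual_carrier R M S"
  unfolding dual_flip_def
proof (rule dual_carrierI[OF R M S])
  fix T assume T: "T \<in> Calg (fst S)"
  let ?B = "base_alg R S T" and ?yT = "Ar N S (base_alg R S T) (snd T) y"
  note B = base_alg_Calg[OF R S T]
  have yT: "?yT \<in> carrier (Ob N ?B)"
    using N.map_closed[OF S B snd_alg_hom[OF T] y] .
  have "(\<lambda>x. \<phi> ?B x (self_alg (fst ?B)) ?yT) \<in> lin_hom (fst ?B) (Ob M ?B) (ring_as_module (fst ?B))"
    by (rule lin_hom_comp[OF dual_eval_lin[OF N B yT] module_morphismD(1)[OF \<phi> B]])
  then show "(\<lambda>x. \<phi> ?B x (self_alg (fst T)) ?yT) \<in> lin_hom (fst T) (Ob M ?B) (ring_as_module (fst T))"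
    by simp
  fix U f x assume U: "U \<in> Calg (fst S)" and f: "f \<in> alg_hom (fst S) T U" and x: "x \<in> carrier (Ob M ?B)"
  let ?C = "base_alg R S U"
  note C = base_alg_Calg[OF R S U] and fR = alg_hom_base_alg[OF S f]
  note fU = alg_hom_base[OF B fR C]
  have w: "\<phi> ?B x \<in> dual_carrier R N ?B"
    using module_morphismD(3)[OF \<phi> B x] by simp
  have "compose (carrier (fst T)) (snd (self_alg (fst U))) f = f"
    using alg_homD(2,4)[OF f] by (auto simp: compose_def extensional_def fun_eq_iff)
  \<comment> \<open>Naturality of \<phi>: evaluating at U over itself after the transition amounts
    to evaluating the old element at U, seen as an algebra through f.\<close>
  then have 1: "\<phi> ?C (Ar M ?B ?C f x) (self_alg (fst U)) = \<phi> ?B x (fst U, f)"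
    using module_morphismD(2)[OF \<phi> B C fR x] self_alg_Calg[OF CalgD(1)[OF U]]
    by (simp add: dual_Ar)
  have "compose (carrier (fst S)) f (snd T) = snd U" using alg_homD(3)[OF f] .
  then have 2: "Ar N S ?C (snd U) y = Ar N ?B ?C f ?yT"
    using N.map_comp[OF S B C snd_alg_hom[OF T] fR y] by simp
  have fB: "f \<in> alg_hom (fst ?B) (self_alg (fst ?B)) (fst U, f)"
    using snd_alg_hom_self[OF CalgD(1)[OF B] fU(1)] by simp
  \<comment> \<open>Naturality of the dual element itself, along f as a map from the base ring over
    itself to U.\<close>
  have "\<phi> ?B x (fst U, f) (Ar N ?B ?C f ?yT) = f (\<phi> ?B x (self_alg (fst ?B)) ?yT)"
    using dual_carrierD(2)[OF w self_alg_Calg[OF CalgD(1)[OF B]] _ fB, of ?yT] fU yT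
    by (simp add: base_alg_self[OF B, simplified])
  then show "\<phi> ?C (Ar M ?B ?C f x) (self_alg (fst U)) (Ar N S ?C (snd U) y) =
      f (\<phi> ?B x (self_alg (fst T)) ?yT)"
    by (simp add: 1 2)
qed

lemma dual_flip_apply:
  assumes "T \<in> Calg (fst S)" "x \<in> carrier (Ob M (base_alg R S T))"
  shows "dual_flip R M N \<phi> S y T x =
    \<phi> (base_alg R S T) x (self_alg (fst T)) (Ar N S (base_alg R S T) (snd T) y)"
  using assms by (simp add: dual_flip_def)

lemma dual_flip_self:
  assumes "S \<in> Calg R" "x \<in> carrier (Ob M S)" "y \<in> carrier (Ob N S)"
  shows "dual_flip R M N \<phi> S y (self_alg (fst S)) x = \<phi> S x (self_alg (fst S)) y"
  using dual_flip_apply[of "self_alg (fst S)" S x \<phi> y] self_alg_Calg[OF CalgD(1)[OF assms(1)]]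
    base_alg_self[OF assms(1)] assms N.map_id[OF assms(1,3)] by simp

lemma dual_flip_morphism:
  assumes \<phi>: "module_morphism R M (dual R N) \<phi>"
  shows "module_morphism R N (dual R M) (dual_flip R M N \<phi>)"
proof (rule module_morphismI)
  note D = dual_functor[OF R M]
  interpret D: module_functor R "dual R M" by (rule D)
  show "dual_flip R M N \<phi> S \<in> lin_hom (fst S) (Ob N S) (Ob (dual R M) S)" if S: "S \<in> Calg R" for S
  proof (rule lin_homI)
    interpret NS: module "fst S" "Ob N S" using S by (rule N.module)
    interpret DS: module "fst S" "Ob (dual R M) S" using S by (rule D.module)
    note closed = dual_flip_closed[OF \<phi> S]
    show "dual_flip R M N \<phi> S y \<in> carrier (Ob (dual R M) S)" if "y \<in> carrier (Ob N S)" for y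
      using closed[OF that] by simp
    fix y assume y: "y \<in> carrier (Ob N S)"
    {
      fix z assume z: "z \<in> carrier (Ob N S)"
      have sum: "dual_flip R M N \<phi> S y \<oplus>\<^bsub>Ob (dual R M) S\<^esub> dual_flip R M N \<phi> S z \<in> dual_carrier R M S"
        using closed[OF y] closed[OF z] DS.M.a_closed[of "dual_flip R M N \<phi> S y" "dual_flip R M N \<phi> S z"] by simp
      show "dual_flip R M N \<phi> S (y \<oplus>\<^bsub>Ob N S\<^esub> z) =
          dual_flip R M N \<phi> S y \<oplus>\<^bsub>Ob (dual R M) S\<^esub> dual_flip R M N \<phi> S z"
      proof (rule dual_eqI[OF closed[OF NS.M.a_closed[OF y z]] sum])
        fix T x assume T: "T \<in> Calg (fst S)" and x: "x \<in> carrier (Ob M (base_alg R S T))"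
        note B = base_alg_Calg[OF R S T]
        have w: "\<phi> (base_alg R S T) x \<in> dual_carrier R N (base_alg R S T)"
          using module_morphismD(3)[OF \<phi> B x] by simp
        note lin = dual_carrierD(1)[OF w, of "self_alg (fst T)", unfolded fst_base_alg, OF self_alg_Calg[OF CalgD(1)[OF T]], folded fst_base_alg[of R S T], unfolded base_alg_self[OF B]]
        show "dual_flip R M N \<phi> S (y \<oplus>\<^bsub>Ob N S\<^esub> z) T x =
            (dual_flip R M N \<phi> S y \<oplus>\<^bsub>Ob (dual R M) S\<^esub> dual_flip R M N \<phi> S z) T x"
          using T x y z B snd_alg_hom[OF T] lin_hom_add[OF lin] S
          by (simp add: dual_flip_apply N.map_add N.map_closed)
      qed
    next
      fix a assume a: "a \<in> carrier (fst S)"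
      have sum: "a \<odot>\<^bsub>Ob (dual R M) S\<^esub> dual_flip R M N \<phi> S y \<in> dual_carrier R M S"
        using closed[OF y] a DS.smult_closed[of a "dual_flip R M N \<phi> S y"] by simp
      show "dual_flip R M N \<phi> S (a \<odot>\<^bsub>Ob N S\<^esub> y) = a \<odot>\<^bsub>Ob (dual R M) S\<^esub> dual_flip R M N \<phi> S y"
      proof (rule dual_eqI[OF closed[OF NS.smult_closed[OF a y]] sum])
        fix T x assume T: "T \<in> Calg (fst S)" and x: "x \<in> carrier (Ob M (base_alg R S T))"
        note B = base_alg_Calg[OF R S T]
        have w: "\<phi> (base_alg R S T) x \<in> dual_carrier R N (base_alg R S T)"
          using module_morphismD(3)[OF \<phi> B x] by simp
        note lin = dual_carrierD(1)[OF w, of "self_alg (fst T)", unfolded fst_base_alg, OF self_alg_Calg[OF CalgD(1)[OF T]], folded fst_base_alg[of R S T], unfolded base_alg_self[OF B]]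
        show "dual_flip R M N \<phi> S (a \<odot>\<^bsub>Ob N S\<^esub> y) T x =
            (a \<odot>\<^bsub>Ob (dual R M) S\<^esub> dual_flip R M N \<phi> S y) T x"
          using T x y a B snd_alg_hom[OF T] lin_hom_smult[OF lin] S CalgD(4)[OF T a]
          by (simp add: dual_flip_apply N.map_smult N.map_closed)
      qed
    }
  qed
  fix S S' f y assume S: "S \<in> Calg R" and S': "S' \<in> Calg R" and f: "f \<in> alg_hom R S S'"
    and y: "y \<in> carrier (Ob N S)"
  note y' = N.map_closed[OF S S' f y] and pull = dual_pull[OF R M S S' f]
  show "dual_flip R M N \<phi> S' (Ar N S S' f y) = Ar (dual R M) S S' f (dual_flip R M N \<phi> S y)"
  proof (rule dual_eqI[OF dual_flip_closed[OF \<phi> S' y']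
        dual_Ar_closed[OF R M S S' f dual_flip_closed[OF \<phi> S y]]])
    fix T x assume T: "T \<in> Calg (fst S')" and x: "x \<in> carrier (Ob M (base_alg R S' T))"
    note B = base_alg_Calg[OF R S' T]
    have "Ar N S' (base_alg R S' T) (snd T) (Ar N S S' f y) =
        Ar N S (base_alg R S' T) (compose (carrier (fst S)) (snd T) f) y"
      using N.map_comp[OF S S' B f snd_alg_hom[OF T] y] by simp
    then show "dual_flip R M N \<phi> S' (Ar N S S' f y) T x =
        Ar (dual R M) S S' f (dual_flip R M N \<phi> S y) T x"
      using T x pull(1,2)[OF T] by (simp add: dual_flip_apply dual_Ar)
  qed
qed

end

text \<open>Flipping exchanges the two arguments at \<open>self_alg\<close>, so doing it twice
  restores the value there, and naturality of \<phi> transports this to every T. It shows that the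
  multiplication read back from a transposed comultiplication is the original one.\<close>

lemma dual_flip_flip:
  assumes R: "cring R" and M: "module_functor R M" and N: "module_functor R N"
    and \<phi>: "module_morphism R M (dual R N) \<phi>" and S: "S \<in> Calg R" and x: "x \<in> carrier (Ob M S)"
  shows "dual_flip R N M (dual_flip R M N \<phi>) S x = \<phi> S x"
proof (rule dual_eqI)
  interpret M: module_functor R M by (rule M)
  interpret N: module_functor R N by (rule N)
  note \<psi> = dual_flip_morphism[OF R M N \<phi>]
  show "dual_flip R N M (dual_flip R M N \<phi>) S x \<in> dual_carrier R N S"
    by (rule dual_flip_closed[OF R N M \<psi> S x])
  show "\<phi> S x \<in> dual_carrier R N S" using module_morphismD(3)[OF \<phi> S x] by simp
  fix T y assume T: "T \<in> Calg (fst S)" and y: "y \<in> carrier (Ob N (base_alg R S T))"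
  note B = base_alg_Calg[OF R S T]
  have x': "Ar M S (base_alg R S T) (snd T) x \<in> carrier (Ob M (base_alg R S T))"
    by (rule M.map_closed[OF S B snd_alg_hom[OF T] x])
  show "dual_flip R N M (dual_flip R M N \<phi>) S x T y = \<phi> S x T y"
    using dual_flip_self[OF R M N B x' y, of \<phi>] module_morphism_dual_self[OF R \<phi> S T x]
    by (simp add: dual_flip_apply[OF R N M T y])
qed

lemma dual_point_morphism:
  assumes R: "cring R" and M: "module_functor R M" and \<phi>: "module_morphism R M ring_mfun \<phi>"
  shows "module_morphism R ring_mfun (dual R M) (dual_point R M \<phi>)"
proof -
  interpret M: module_functor R M by (rule M)
  interpret D: module_functor R "dual R M" by (rule dual_functor[OF R M])
  have val: "\<phi> (base_alg R S T) x \<in> carrier (fst T)"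
    if "S \<in> Calg R" "T \<in> Calg (fst S)" "x \<in> carrier (Ob M (base_alg R S T))" for S T x
    using module_morphismD(3)[OF \<phi> base_alg_Calg[OF R that(1,2)] that(3)] by simp
  have closed: "dual_point R M \<phi> S s \<in> dual_carrier R M S"
    if S: "S \<in> Calg R" and s: "s \<in> carrier (fst S)" for S s
    unfolding dual_point_def
  proof (rule dual_carrierI[OF R M S])
    fix T assume T: "T \<in> Calg (fst S)"
    interpret T: cring "fst T" using CalgD(1)[OF T] .
    note B = base_alg_Calg[OF R S T] and sT = CalgD(4)[OF T s]
    note lin = module_morphismD(1)[OF \<phi> B, simplified]
    show "(\<lambda>x. snd T s \<otimes>\<^bsub>fst T\<^esub> \<phi> (base_alg R S T) x) \<in>
        lin_hom (fst T) (Ob M (base_alg R S T)) (ring_as_module (fst T))"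
      using sT val[OF S T] lin_hom_add[OF lin] lin_hom_smult[OF lin]
      by (intro lin_homI) (simp_all add: T.r_distr T.m_lcomm)
    fix U f x assume U: "U \<in> Calg (fst S)" and f: "f \<in> alg_hom (fst S) T U"
      and x: "x \<in> carrier (Ob M (base_alg R S T))"
    have "snd U s = f (snd T s)"
      using alg_homD(3)[OF f] s by (metis compose_eq)
    moreover have "\<phi> (base_alg R S U) (Ar M (base_alg R S T) (base_alg R S U) f x) =
        f (\<phi> (base_alg R S T) x)"
      using module_morphismD(2)[OF \<phi> B base_alg_Calg[OF R S U] alg_hom_base_alg[OF S f] x] by simp
    ultimately show "snd U s \<otimes>\<^bsub>fst U\<^esub> \<phi> (base_alg R S U) (Ar M (base_alg R S T) (base_alg R S U) f x) =
        f (snd T s \<otimes>\<^bsub>fst T\<^esub> \<phi> (base_alg R S T) x)"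
      using sT val[OF S T x] by (simp add: ring_hom_mult[OF alg_homD(1)[OF f]])
  qed
  show ?thesis
  proof (rule module_morphismI)
    fix S :: "'a alg" assume S: "S \<in> Calg R"
    interpret S: cring "fst S" using CalgD(1)[OF S] .
    interpret DS: module "fst S" "Ob (dual R M) S" using S by (rule D.module)
    note [simp del] = dual_Ob_simps(3,4)
    show "dual_point R M \<phi> S \<in> lin_hom (fst S) (Ob ring_mfun S) (Ob (dual R M) S)"
    proof (rule lin_homI)
      show "dual_point R M \<phi> S s \<in> carrier (Ob (dual R M) S)" if "s \<in> carrier (Ob ring_mfun S)" for s
        using closed[OF S] that by simp
      fix s t assume "s \<in> carrier (Ob ring_mfun S)" "t \<in> carrier (Ob ring_mfun S)"
      then have s: "s \<in> carrier (fst S)" and t: "t \<in> carrier (fst S)" by simp_all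
      have "dual_point R M \<phi> S (s \<oplus>\<^bsub>fst S\<^esub> t) =
          dual_point R M \<phi> S s \<oplus>\<^bsub>Ob (dual R M) S\<^esub> dual_point R M \<phi> S t"
      proof (rule dual_eqI[OF closed[OF S S.a_closed[OF s t]]])
        show "dual_point R M \<phi> S s \<oplus>\<^bsub>Ob (dual R M) S\<^esub> dual_point R M \<phi> S t \<in> dual_carrier R M S"
          using DS.M.a_closed closed[OF S s] closed[OF S t] by simp
        fix T x assume T: "T \<in> Calg (fst S)" and x: "x \<in> carrier (Ob M (base_alg R S T))"
        interpret T: cring "fst T" using CalgD(1)[OF T] .
        show "dual_point R M \<phi> S (s \<oplus>\<^bsub>fst S\<^esub> t) T x =
            (dual_point R M \<phi> S s \<oplus>\<^bsub>Ob (dual R M) S\<^esub> dual_point R M \<phi> S t) T x"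
          using T x s t val[OF S T x] CalgD(4)[OF T]
          by (simp add: dual_point_def dual_Ob_simps(3) ring_hom_add[OF CalgD(2)[OF T]] T.l_distr)
      qed
      then show "dual_point R M \<phi> S (s \<oplus>\<^bsub>Ob ring_mfun S\<^esub> t) =
          dual_point R M \<phi> S s \<oplus>\<^bsub>Ob (dual R M) S\<^esub> dual_point R M \<phi> S t" by simp
    next
      fix s t assume "s \<in> carrier (fst S)" "t \<in> carrier (Ob ring_mfun S)"
      then have s: "s \<in> carrier (fst S)" and t: "t \<in> carrier (fst S)" by simp_all
      have "dual_point R M \<phi> S (s \<otimes>\<^bsub>fst S\<^esub> t) = s \<odot>\<^bsub>Ob (dual R M) S\<^esub> dual_point R M \<phi> S t"
      proof (rule dual_eqI[OF closed[OF S S.m_closed[OF s t]]])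
        show "s \<odot>\<^bsub>Ob (dual R M) S\<^esub> dual_point R M \<phi> S t \<in> dual_carrier R M S"
          using DS.smult_closed s closed[OF S t] by simp
        fix T x assume T: "T \<in> Calg (fst S)" and x: "x \<in> carrier (Ob M (base_alg R S T))"
        interpret T: cring "fst T" using CalgD(1)[OF T] .
        show "dual_point R M \<phi> S (s \<otimes>\<^bsub>fst S\<^esub> t) T x =
            (s \<odot>\<^bsub>Ob (dual R M) S\<^esub> dual_point R M \<phi> S t) T x"
          using T x s t val[OF S T x] CalgD(4)[OF T]
          by (simp add: dual_point_def dual_Ob_simps(4) ring_hom_mult[OF CalgD(2)[OF T]] T.m_assoc)
      qed
      then show "dual_point R M \<phi> S (s \<odot>\<^bsub>Ob ring_mfun S\<^esub> t) = s \<odot>\<^bsub>Ob (dual R M) S\<^esub> dual_point R M \<phi> S t"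
        by simp
    qed
    fix S' f s assume S': "S' \<in> Calg R" and f: "f \<in> alg_hom R S S'"
    assume "s \<in> carrier (Ob ring_mfun S)"
    then have s: "s \<in> carrier (fst S)" by simp
    note pull = dual_pull[OF R M S S' f]
    have "dual_point R M \<phi> S' (f s) = Ar (dual R M) S S' f (dual_point R M \<phi> S s)"
    proof (rule dual_eqI[OF closed[OF S' alg_homD(4)[OF f s]] dual_Ar_closed[OF R M S S' f closed[OF S s]]])
      fix T x assume T: "T \<in> Calg (fst S')" and x: "x \<in> carrier (Ob M (base_alg R S' T))"
      then show "dual_point R M \<phi> S' (f s) T x = Ar (dual R M) S S' f (dual_point R M \<phi> S s) T x"
        using pull(1,2)[OF T] s by (simp add: dual_point_def dual_Ar compose_eq)
    qed
    then show "dual_point R M \<phi> S' (Ar ring_mfun S S' f s) = Ar (dual R M) S S' f (dual_point R M \<phi> S s)"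
      by simp
  qed
qed

section \<open>Algebra structures and coalgebra structures\<close>

text \<open>A functor of algebras reduced to a product and a unit element: the morphism from the
  functor of rings has to be s \<mapsto> s e, and its centrality together with compatibility with
  scalars becomes bilinearity of \<mu>.\<close>

definition alg_structure ::
    "'u ring \<Rightarrow> ('u, 'm) mfun \<Rightarrow> ('u alg \<Rightarrow> 'm \<Rightarrow> 'm \<Rightarrow> 'm) \<Rightarrow> ('u alg \<Rightarrow> 'm) \<Rightarrow> bool" where
  "alg_structure R M \<mu> e \<longleftrightarrow>
     (\<forall>S\<in>Calg R. \<mu> S \<in> bilin (fst S) (Ob M S) (Ob M S) (Ob M S) \<and> e S \<in> carrier (Ob M S) \<and>
        (\<forall>x\<in>carrier (Ob M S). \<mu> S (e S) x = x \<and> \<mu> S x (e S) = x) \<and>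
        (\<forall>x\<in>carrier (Ob M S). \<forall>y\<in>carrier (Ob M S). \<forall>z\<in>carrier (Ob M S).
           \<mu> S (\<mu> S x y) z = \<mu> S x (\<mu> S y z))) \<and>
     (\<forall>S\<in>Calg R. \<forall>T\<in>Calg R. \<forall>f\<in>alg_hom R S T. Ar M S T f (e S) = e T \<and>
        (\<forall>x\<in>carrier (Ob M S). \<forall>y\<in>carrier (Ob M S).
           Ar M S T f (\<mu> S x y) = \<mu> T (Ar M S T f x) (Ar M S T f y)))"

lemma alg_structureD:
  assumes "alg_structure R M \<mu> e" "S \<in> Calg R"
  shows "\<mu> S \<in> bilin (fst S) (Ob M S) (Ob M S) (Ob M S)" "e S \<in> carrier (Ob M S)"
    and "x \<in> carrier (Ob M S) \<Longrightarrow> \<mu> S (e S) x = x" "x \<in> carrier (Ob M S) \<Longrightarrow> \<mu> S x (e S) = x"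
    and "\<lbrakk>x \<in> carrier (Ob M S); y \<in> carrier (Ob M S); z \<in> carrier (Ob M S)\<rbrakk> \<Longrightarrow>
      \<mu> S (\<mu> S x y) z = \<mu> S x (\<mu> S y z)"
    and "\<lbrakk>T \<in> Calg R; f \<in> alg_hom R S T\<rbrakk> \<Longrightarrow> Ar M S T f (e S) = e T"
    and "\<lbrakk>T \<in> Calg R; f \<in> alg_hom R S T; x \<in> carrier (Ob M S); y \<in> carrier (Ob M S)\<rbrakk> \<Longrightarrow>
      Ar M S T f (\<mu> S x y) = \<mu> T (Ar M S T f x) (Ar M S T f y)"
  using assms by (auto simp: alg_structure_def)

lemma is_algebra_functor_iff:
  assumes "module_functor R M"
  shows "is_algebra_functor R M \<longleftrightarrow> (\<exists>\<mu> e. alg_structure R M \<mu> e)"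
proof
  interpret M: module_functor R M by fact
  assume "is_algebra_functor R M"
  then obtain \<mu> e \<eta> where A: "algebra_functor R (\<lambda>S. (Ob M S)\<lparr>mult := \<mu> S, one := e S\<rparr>) (Ar M) \<eta>"
    and \<eta>s: "\<And>S s x. \<lbrakk>S \<in> Calg R; s \<in> carrier (fst S); x \<in> carrier (Ob M S)\<rbrakk> \<Longrightarrow>
      \<mu> S (\<eta> S s) x = s \<odot>\<^bsub>Ob M S\<^esub> x"
    unfolding is_algebra_functor_def Let_def by auto
  interpret A: algebra_functor R "\<lambda>S. (Ob M S)\<lparr>mult := \<mu> S, one := e S\<rparr>" "Ar M" \<eta> by (rule A)
  have "alg_structure R M \<mu> e"
    unfolding alg_structure_def
  proof (intro conjI ballI)
    fix S assume S: "S \<in> Calg R"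
    interpret MS: module "fst S" "Ob M S" using S by (rule M.module)
    interpret AS: ring "(Ob M S)\<lparr>mult := \<mu> S, one := e S\<rparr>" using S by (rule A.ring)
    have \<eta>: "\<eta> S s \<in> carrier (Ob M S)" if "s \<in> carrier (fst S)" for s
      using ring_hom_closed[OF A.unit_hom[OF S] that] by simp
    note cen = A.unit_central[OF S, simplified]
    note m_closed = AS.m_closed[simplified] and m_assoc = AS.m_assoc[simplified]
      and l_distr = AS.l_distr[simplified] and r_distr = AS.r_distr[simplified]
    show "\<mu> S \<in> bilin (fst S) (Ob M S) (Ob M S) (Ob M S)"
    proof (intro bilinI lin_homI)
      fix a x y assume a: "a \<in> carrier (fst S)" and x: "x \<in> carrier (Ob M S)" and y: "y \<in> carrier (Ob M S)"
      have "\<mu> S (a \<odot>\<^bsub>Ob M S\<^esub> x) y = \<mu> S (\<mu> S (\<eta> S a) x) y"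
        using \<eta>s[OF S a x] by simp
      also have "\<dots> = a \<odot>\<^bsub>Ob M S\<^esub> \<mu> S x y"
        using m_assoc[OF \<eta>[OF a] x y] \<eta>s[OF S a m_closed[OF x y]] by simp
      finally show "\<mu> S (a \<odot>\<^bsub>Ob M S\<^esub> x) y = a \<odot>\<^bsub>Ob M S\<^esub> \<mu> S x y" .
      have "\<mu> S x (a \<odot>\<^bsub>Ob M S\<^esub> y) = \<mu> S x (\<mu> S (\<eta> S a) y)"
        using \<eta>s[OF S a y] by simp
      \<comment> \<open>Centrality of \<open>\<eta> S a\<close> moves the scalar past x; this gives
        linearity in the second argument.\<close>
      also have "\<dots> = \<mu> S (\<mu> S (\<eta> S a) x) y"
        using m_assoc[OF x \<eta>[OF a] y] cen[OF a x] by simp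
      also have "\<dots> = a \<odot>\<^bsub>Ob M S\<^esub> \<mu> S x y"
        using m_assoc[OF \<eta>[OF a] x y] \<eta>s[OF S a m_closed[OF x y]] by simp
      finally show "\<mu> S x (a \<odot>\<^bsub>Ob M S\<^esub> y) = a \<odot>\<^bsub>Ob M S\<^esub> \<mu> S x y" .
    qed (simp_all add: m_closed l_distr r_distr)
    show "e S \<in> carrier (Ob M S)" using AS.one_closed by simp
    show "\<mu> S (e S) x = x" "\<mu> S x (e S) = x" if "x \<in> carrier (Ob M S)" for x
      using AS.l_one AS.r_one that by simp_all
    show "\<mu> S (\<mu> S x y) z = \<mu> S x (\<mu> S y z)"
      if "x \<in> carrier (Ob M S)" "y \<in> carrier (Ob M S)" "z \<in> carrier (Ob M S)" for x y z
      using m_assoc that by simp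
    fix T f assume "T \<in> Calg R" "f \<in> alg_hom R S T"
    note hom = A.map_ring_hom[OF S this]
    show "Ar M S T f (e S) = e T" using ring_hom_one[OF hom] by simp
    show "Ar M S T f (\<mu> S x y) = \<mu> T (Ar M S T f x) (Ar M S T f y)"
      if "x \<in> carrier (Ob M S)" "y \<in> carrier (Ob M S)" for x y
      using ring_hom_mult[OF hom] that by simp
  qed
  then show "\<exists>\<mu> e. alg_structure R M \<mu> e" by blast
next
  interpret M: module_functor R M by fact
  assume "\<exists>\<mu> e. alg_structure R M \<mu> e"
  then obtain \<mu> e where A: "alg_structure R M \<mu> e" by blast
  let ?A = "\<lambda>S. (Ob M S)\<lparr>mult := \<mu> S, one := e S\<rparr>"
  \<comment> \<open>The only possible choice, since the action of \<open>\<eta> S s\<close> on the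
    unit element must be multiplication by s.\<close>
  let ?\<eta> = "\<lambda>S s. s \<odot>\<^bsub>Ob M S\<^esub> e S"
  have \<eta>: "\<mu> S (?\<eta> S s) x = s \<odot>\<^bsub>Ob M S\<^esub> x \<and> \<mu> S x (?\<eta> S s) = s \<odot>\<^bsub>Ob M S\<^esub> x"
    if S: "S \<in> Calg R" and s: "s \<in> carrier (fst S)" and x: "x \<in> carrier (Ob M S)" for S s x
    using lin_hom_smult[OF bilinD(2)[OF alg_structureD(1)[OF A S] x] s]
      lin_hom_smult[OF bilinD(1)[OF alg_structureD(1)[OF A S] x] s]
      alg_structureD(2)[OF A S] alg_structureD(3,4)[OF A S x] by simp
  have "algebra_functor R ?A (Ar M) ?\<eta>"
  proof (intro algebra_functor.intro ring_functor.intro algebra_functor_axioms.intro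
      ring_functor_axioms.intro)
    have "set_functor R (\<lambda>S. carrier (Ob M S)) (Ar M)" ..
    then show "set_functor R (\<lambda>S. carrier (?A S)) (Ar M)" by simp
    fix S assume S: "S \<in> Calg R"
    interpret MS: module "fst S" "Ob M S" using S by (rule M.module)
    note D = alg_structureD[OF A S]
    note bil = bilinD[OF D(1)]
    show "ring (?A S)"
    proof (rule ringI)
      show "abelian_group (?A S)"
        by (rule abelian_groupI) (simp_all add: MS.M.a_ac MS.M.add.l_inv_ex[simplified])
      show "monoid (?A S)"
        by (rule monoidI) (simp_all add: bil(3) D(2-5))
    qed (simp_all add: lin_hom_add[OF bil(1)] lin_hom_add[OF bil(2)])
    show "?\<eta> S \<in> ring_hom (fst S) (?A S)"
      by (rule ring_hom_memI)
         (simp_all add: D(2) conjunct1[OF \<eta>[OF S]] MS.smult_assoc1 MS.smult_l_distr)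
    fix T f assume T: "T \<in> Calg R" and f: "f \<in> alg_hom R S T"
    show "Ar M S T f \<in> ring_hom (?A S) (?A T)"
      by (rule ring_hom_memI) (simp_all add: M.map_closed[OF S T f] M.map_add[OF S T f] D(6,7) T f)
    show "?\<eta> T (f s) = Ar M S T f (?\<eta> S s)" if "s \<in> carrier (fst S)" for s
      using M.map_smult[OF S T f that D(2)] D(6)[OF T f] by simp
  qed (simp add: \<eta>)
  then show "is_algebra_functor R M"
    unfolding is_algebra_functor_def Let_def using \<eta>
    by (intro exI[of _ \<mu>] exI[of _ e] exI[of _ ?\<eta>]) simp
qed

text \<open>Transport of structure; it allows the dual of a quasi-coherent functor to be replaced by
  its model \<open>H\<close>.\<close>

lemma alg_structure_transfer:
  assumes \<alpha>: "module_morphism R M N \<alpha>" and \<beta>: "module_morphism R N M \<beta>"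
    and \<beta>\<alpha>: "\<And>S x. \<lbrakk>S \<in> Calg R; x \<in> carrier (Ob M S)\<rbrakk> \<Longrightarrow> \<beta> S (\<alpha> S x) = x"
    and \<alpha>\<beta>: "\<And>S y. \<lbrakk>S \<in> Calg R; y \<in> carrier (Ob N S)\<rbrakk> \<Longrightarrow> \<alpha> S (\<beta> S y) = y"
    and A: "alg_structure R M \<mu> e"
  shows "alg_structure R N (\<lambda>S x y. \<alpha> S (\<mu> S (\<beta> S x) (\<beta> S y))) (\<lambda>S. \<alpha> S (e S))"
  unfolding alg_structure_def
proof (intro conjI ballI)
  fix S assume S: "S \<in> Calg R"
  note D = alg_structureD[OF A S]
  note a = module_morphismD[OF \<alpha>] and b = module_morphismD[OF \<beta>]
  note cl = a(3)[OF S] b(3)[OF S] bilinD(3)[OF D(1)]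
  show "(\<lambda>x y. \<alpha> S (\<mu> S (\<beta> S x) (\<beta> S y))) \<in> bilin (fst S) (Ob N S) (Ob N S) (Ob N S)"
    by (rule bilin_comp[OF bilin_comp_lin[OF D(1) a(1)[OF S]] b(1)[OF S] b(1)[OF S]])
  show "\<alpha> S (e S) \<in> carrier (Ob N S)" using cl D(2) by simp
  show "\<alpha> S (\<mu> S (\<beta> S (\<alpha> S (e S))) (\<beta> S x)) = x" "\<alpha> S (\<mu> S (\<beta> S x) (\<beta> S (\<alpha> S (e S)))) = x"
    if "x \<in> carrier (Ob N S)" for x
    using that cl D S by (simp_all add: \<beta>\<alpha> \<alpha>\<beta>)
  show "\<alpha> S (\<mu> S (\<beta> S (\<alpha> S (\<mu> S (\<beta> S x) (\<beta> S y)))) (\<beta> S z)) =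
      \<alpha> S (\<mu> S (\<beta> S x) (\<beta> S (\<alpha> S (\<mu> S (\<beta> S y) (\<beta> S z)))))"
    if "x \<in> carrier (Ob N S)" "y \<in> carrier (Ob N S)" "z \<in> carrier (Ob N S)" for x y z
    using that cl D S by (simp add: \<beta>\<alpha>)
  fix T f assume T: "T \<in> Calg R" and f: "f \<in> alg_hom R S T"
  show "Ar N S T f (\<alpha> S (e S)) = \<alpha> T (e T)"
    using a(2)[OF S T f D(2)] D(6)[OF T f] by simp
  show "Ar N S T f (\<alpha> S (\<mu> S (\<beta> S x) (\<beta> S y))) = \<alpha> T (\<mu> T (\<beta> T (Ar N S T f x)) (\<beta> T (Ar N S T f y)))"
    if "x \<in> carrier (Ob N S)" "y \<in> carrier (Ob N S)" for x y
    using that cl by (simp add: a(2)[OF S T f, symmetric] b(2)[OF S T f] D(7)[OF T f])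
qed

text \<open>Extensionality on pure tensors is used twice, the inner time for the maps t \<mapsto>
  f(t \<otimes> z) with z fixed, which are again linear.\<close>

lemma tensor_hom_ext3:
  assumes "module R M" "module R N" "module R P"
    and "f \<in> lin_hom R (tensor R (tensor R M N) P) Q" "g \<in> lin_hom R (tensor R (tensor R M N) P) Q"
    and eq: "\<And>x y z. \<lbrakk>x \<in> carrier M; y \<in> carrier N; z \<in> carrier P\<rbrakk> \<Longrightarrow>
      f (pure_tensor R (tensor R M N) P (pure_tensor R M N x y) z) =
      g (pure_tensor R (tensor R M N) P (pure_tensor R M N x y) z)"
    and "t \<in> carrier (tensor R (tensor R M N) P)"
  shows "f t = g t"
proof -
  note MN = module_tensor[OF assms(1,2)]
  note b = pure_tensor_bilin[OF MN assms(3)]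
  show ?thesis
  proof (rule tensor_hom_ext[OF MN assms(3) assms(4,5) _ assms(7)])
    fix t z assume t: "t \<in> carrier (tensor R M N)" and z: "z \<in> carrier P"
    from assms(1,2) lin_hom_comp[OF assms(4) bilinD(2)[OF b z]] lin_hom_comp[OF assms(5) bilinD(2)[OF b z]]
      eq[OF _ _ z] t
    show "f (pure_tensor R (tensor R M N) P t z) = g (pure_tensor R (tensor R M N) P t z)"
      by (rule tensor_hom_ext)
  qed
qed

lemma tensor_hom_ext3':
  assumes "module R M" "module R N" "module R P"
    and "f \<in> lin_hom R (tensor R M (tensor R N P)) Q" "g \<in> lin_hom R (tensor R M (tensor R N P)) Q"
    and eq: "\<And>x y z. \<lbrakk>x \<in> carrier M; y \<in> carrier N; z \<in> carrier P\<rbrakk> \<Longrightarrow>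
      f (pure_tensor R M (tensor R N P) x (pure_tensor R N P y z)) =
      g (pure_tensor R M (tensor R N P) x (pure_tensor R N P y z))"
    and "t \<in> carrier (tensor R M (tensor R N P))"
  shows "f t = g t"
proof -
  note NP = module_tensor[OF assms(2,3)]
  note b = pure_tensor_bilin[OF assms(1) NP]
  show ?thesis
  proof (rule tensor_hom_ext[OF assms(1) NP assms(4,5) _ assms(7)])
    fix x t assume x: "x \<in> carrier M" and t: "t \<in> carrier (tensor R N P)"
    from assms(2,3) lin_hom_comp[OF assms(4) bilinD(1)[OF b x]] lin_hom_comp[OF assms(5) bilinD(1)[OF b x]]
      eq[OF x] t
    show "f (pure_tensor R M (tensor R N P) x t) = g (pure_tensor R M (tensor R N P) x t)"
      by (rule tensor_hom_ext)
  qed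
qed

subsection \<open>Comultiplications on a functor and multiplications on its dual\<close>

lemma dual_map_apply:
  "\<lbrakk>T \<in> Calg (fst S); x \<in> carrier (Ob M (base_alg R S T))\<rbrakk> \<Longrightarrow>
    dual_map R M \<alpha> S w T x = w T (\<alpha> (base_alg R S T) x)"
  by (simp add: dual_map_def)

locale dual_setup =
  fixes R :: "'u ring" and C :: "('u, 'm) mfun"
  assumes R: "cring R" and C: "module_functor R C"
begin

sublocale C: module_functor R C by (rule C)

abbreviation "D \<equiv> dual R C"
abbreviation "D2 \<equiv> tensor_mfun D D"
abbreviation "tens S \<equiv> pure_tensor (fst S) (Ob D S) (Ob D S)"

lemma D: "module_functor R D" by (rule dual_functor[OF R C])

sublocale D: module_functor R D by (rule D)

lemma D2: "module_functor R D2" by (rule tensor_mfun_functor[OF D D])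

sublocale D2: module_functor R D2 by (rule D2)

lemma pure_D: "\<lbrakk>S \<in> Calg R; v \<in> carrier (Ob D S); w \<in> carrier (Ob D S)\<rbrakk> \<Longrightarrow>
    tens S v w \<in> carrier (Ob D2 S)"
  using pure_tensor_closed[OF D.module D.module] by simp

text \<open>With \<open>m\<close> the transpose of a comultiplication \<open>\<Delta>\<close>, coassociativity of \<open>\<Delta>\<close> at \<open>x\<close>, evaluated at
  \<open>(v \<otimes> w) \<otimes> p\<close>, is associativity of \<open>m\<close> evaluated at \<open>x\<close>.\<close>

lemma coalgebra_imp_alg_structure:
  assumes \<Delta>: "module_morphism R C (tensor_tilde R C C) \<Delta>" and \<epsilon>: "module_morphism R C ring_mfun \<epsilon>"
    and m_def: "m = dual_flip R C D2 \<Delta>" and u_def: "u = dual_point R C \<epsilon>"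
    and coassoc: "\<And>S x. \<lbrakk>S \<in> Calg R; x \<in> carrier (Ob C S)\<rbrakk> \<Longrightarrow>
      dual_map R (tensor_mfun D2 D) (tensor_mfun_map D D m (\<lambda>_ w. w)) S (\<Delta> S x) =
      dual_map R (tensor_mfun D2 D) (tensor_mfun_assoc D D D) S
        (dual_map R (tensor_mfun D D2) (tensor_mfun_map D D (\<lambda>_ w. w) m) S (\<Delta> S x))"
    and counit_l: "\<And>S x. \<lbrakk>S \<in> Calg R; x \<in> carrier (Ob C S)\<rbrakk> \<Longrightarrow>
      dual_map R D (\<lambda>T. pure_tensor (fst T) (Ob ring_mfun T) (Ob D T) \<one>\<^bsub>fst T\<^esub>) S
        (dual_map R (tensor_mfun ring_mfun D) (tensor_mfun_map D D u (\<lambda>_ w. w)) S (\<Delta> S x)) =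
      bidual_can R C S x"
    and counit_r: "\<And>S x. \<lbrakk>S \<in> Calg R; x \<in> carrier (Ob C S)\<rbrakk> \<Longrightarrow>
      dual_map R D (\<lambda>T w. pure_tensor (fst T) (Ob D T) (Ob ring_mfun T) w \<one>\<^bsub>fst T\<^esub>) S
        (dual_map R (tensor_mfun D ring_mfun) (tensor_mfun_map D D (\<lambda>_ w. w) u) S (\<Delta> S x)) =
      bidual_can R C S x"
  shows "alg_structure R D (\<lambda>S v w. m S (tens S v w))
    (\<lambda>S. u S \<one>\<^bsub>fst S\<^esub>)"
proof -
  have \<Delta>': "module_morphism R C (dual R D2) \<Delta>" using \<Delta> by (simp add: tensor_tilde_def)
  have m: "module_morphism R D2 D m" unfolding m_def by (rule dual_flip_morphism[OF R C D2 \<Delta>'])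
  have u: "module_morphism R ring_mfun D u" unfolding u_def by (rule dual_point_morphism[OF R C \<epsilon>])
  let ?\<mu> = "\<lambda>S v w. m S (tens S v w)"
  have \<mu>_closed: "?\<mu> S v w \<in> carrier (Ob D S)"
    if "S \<in> Calg R" "v \<in> carrier (Ob D S)" "w \<in> carrier (Ob D S)" for S v w
    using module_morphismD(3)[OF m that(1) pure_D[OF that]] .
  have \<mu>_nat: "Ar D S T f (?\<mu> S v w) = ?\<mu> T (Ar D S T f v) (Ar D S T f w)"
    if "S \<in> Calg R" "T \<in> Calg R" "f \<in> alg_hom R S T" "v \<in> carrier (Ob D S)" "w \<in> carrier (Ob D S)"
    for S T f v w
    using module_morphismD(2)[OF m that(1-3) pure_D[OF that(1,4,5)]]
    by (simp only: tensor_mfun_Ar_pure[OF D D that])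
  have u1: "u S \<one>\<^bsub>fst S\<^esub> \<in> carrier (Ob D S)" if "S \<in> Calg R" for S
    using module_morphismD(3)[OF u that] cring.cring_simprules(6)[OF CalgD(1)[OF that]] by simp
  have u_nat: "Ar D S T f (u S \<one>\<^bsub>fst S\<^esub>) = u T \<one>\<^bsub>fst T\<^esub>"
    if "S \<in> Calg R" "T \<in> Calg R" "f \<in> alg_hom R S T" for S T f
    using module_morphismD(2)[OF u that, of "\<one>\<^bsub>fst S\<^esub>"] cring.cring_simprules(6)[OF CalgD(1)[OF that(1)]]
      ring_hom_one[OF alg_homD(1)[OF that(3)]] by simp
  have self: "self_alg (fst S) \<in> Calg (fst S)" "base_alg R S (self_alg (fst S)) = S" if "S \<in> Calg R" for S
    using self_alg_Calg[OF CalgD(1)[OF that]] base_alg_self[OF that] .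
  have m_self: "m S z (self_alg (fst S)) x = \<Delta> S x (self_alg (fst S)) z"
    if "S \<in> Calg R" "x \<in> carrier (Ob C S)" "z \<in> carrier (Ob D2 S)" for S x z
    unfolding m_def by (rule dual_flip_self[OF R C D2 that])
  \<comment> \<open>Values at \<open>self_alg\<close> suffice: naturality of the product and
    \<open>dual_eqI_self\<close> extend the identity to all base changes.\<close>
  have assoc_self: "?\<mu> S (?\<mu> S v w) p (self_alg (fst S)) x = ?\<mu> S v (?\<mu> S w p) (self_alg (fst S)) x"
    if S: "S \<in> Calg R" and v: "v \<in> carrier (Ob D S)" and w: "w \<in> carrier (Ob D S)"
      and p: "p \<in> carrier (Ob D S)" and x: "x \<in> carrier (Ob C S)" for S v w p x
  proof -
    note modD = D.module[OF S]
    have modD2: "module (fst S) (tensor (fst S) (Ob D S) (Ob D S))" by (rule module_tensor[OF modD modD])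
    have mS: "m S \<in> lin_hom (fst S) (tensor (fst S) (Ob D S) (Ob D S)) (Ob D S)"
      using module_morphismD(1)[OF m S] by simp
    let ?z = "pure_tensor (fst S) (Ob D2 S) (Ob D S) (tens S v w) p"
    let ?z' = "pure_tensor (fst S) (Ob D S) (Ob D2 S) v (tens S w p)"
    have z: "?z \<in> carrier (Ob (tensor_mfun D2 D) S)"
      using pure_tensor_closed[OF modD2 modD] pure_D[OF S v w] p by simp
    have z': "?z' \<in> carrier (Ob (tensor_mfun D D2) S)"
      using pure_tensor_closed[OF modD modD2] pure_D[OF S w p] v by simp
    have as: "tensor_mfun_assoc D D D S ?z = ?z'"
      using tensor_assoc_pure[OF modD modD modD v w p] by (simp add: tensor_mfun_assoc_def)
    have 1: "tensor_mfun_map D D m (\<lambda>_ w. w) S ?z =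
        tens S (?\<mu> S v w) p"
      unfolding tensor_mfun_map_def tensor_mfun_Ob
      by (rule tensor_hom_pure[OF modD2 modD modD modD mS lin_hom_id pure_D[OF S v w, simplified tensor_mfun_Ob] p])
    have 2: "tensor_mfun_map D D (\<lambda>_ w. w) m S ?z' =
        tens S v (?\<mu> S w p)"
      unfolding tensor_mfun_map_def tensor_mfun_Ob
      by (rule tensor_hom_pure[OF modD modD2 modD modD lin_hom_id mS v pure_D[OF S w p, simplified tensor_mfun_Ob]])
    \<comment> \<open>Coassociativity is an equation between elements of a dual; it is evaluated at
      S over itself and at one pure tensor, which the associator rebrackets from \<open>?z\<close>
      to \<open>?z'\<close>.\<close>
    from fun_cong[OF fun_cong[OF coassoc[OF S x]], of "self_alg (fst S)" ?z]
    have "\<Delta> S x (self_alg (fst S)) (tens S (?\<mu> S v w) p) =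
        \<Delta> S x (self_alg (fst S)) (tens S v (?\<mu> S w p))"
      using z z' self[OF S] by (simp only: dual_map_apply as 1 2)
    then show ?thesis
      using m_self[OF S x] pure_D[OF S] \<mu>_closed[OF S] v w p by metis
  qed
  have unit_self: "?\<mu> S (u S \<one>\<^bsub>fst S\<^esub>) w (self_alg (fst S)) x = w (self_alg (fst S)) x \<and>
      ?\<mu> S w (u S \<one>\<^bsub>fst S\<^esub>) (self_alg (fst S)) x = w (self_alg (fst S)) x"
    if S: "S \<in> Calg R" and w: "w \<in> carrier (Ob D S)" and x: "x \<in> carrier (Ob C S)" for S w x
  proof -
    interpret S: cring "fst S" using CalgD(1)[OF S] .
    note modD = D.module[OF S]
    have modR: "module (fst S) (ring_as_module (fst S))" by (rule module_ring[OF S.is_cring])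
    have uS: "u S \<in> lin_hom (fst S) (ring_as_module (fst S)) (Ob D S)"
      using module_morphismD(1)[OF u S] by simp
    have one: "\<one>\<^bsub>fst S\<^esub> \<in> carrier (ring_as_module (fst S))" by simp
    let ?l = "pure_tensor (fst S) (Ob ring_mfun S) (Ob D S) \<one>\<^bsub>fst S\<^esub> w"
    let ?r = "pure_tensor (fst S) (Ob D S) (Ob ring_mfun S) w \<one>\<^bsub>fst S\<^esub>"
    have l: "?l \<in> carrier (Ob (tensor_mfun ring_mfun D) S)"
      using pure_tensor_closed[OF modR modD one w] by simp
    have r: "?r \<in> carrier (Ob (tensor_mfun D ring_mfun) S)"
      using pure_tensor_closed[OF modD modR w one] by simp
    have 1: "tensor_mfun_map D D u (\<lambda>_ w. w) S ?l = tens S (u S \<one>\<^bsub>fst S\<^esub>) w"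
      using tensor_hom_pure[OF modR modD modD modD uS lin_hom_id one w] by (simp add: tensor_mfun_map_def)
    have 2: "tensor_mfun_map D D (\<lambda>_ w. w) u S ?r = tens S w (u S \<one>\<^bsub>fst S\<^esub>)"
      using tensor_hom_pure[OF modD modR modD modD lin_hom_id uS w one] by (simp add: tensor_mfun_map_def)
    have can: "bidual_can R C S x (self_alg (fst S)) w = w (self_alg (fst S)) x"
      using w self[OF S] C.map_id[OF S x] by (simp add: bidual_can_def)
    have "\<Delta> S x (self_alg (fst S)) (tens S (u S \<one>\<^bsub>fst S\<^esub>) w) =
        w (self_alg (fst S)) x"
      using fun_cong[OF fun_cong[OF counit_l[OF S x]], of "self_alg (fst S)" w] w l self[OF S] can
      by (simp only: dual_map_apply 1)
    moreover have "\<Delta> S x (self_alg (fst S)) (tens S w (u S \<one>\<^bsub>fst S\<^esub>)) =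
        w (self_alg (fst S)) x"
      using fun_cong[OF fun_cong[OF counit_r[OF S x]], of "self_alg (fst S)" w] w r self[OF S] can
      by (simp only: dual_map_apply 2)
    ultimately show ?thesis
      using m_self[OF S x] pure_D[OF S] u1[OF S] w by metis
  qed
  show ?thesis
    unfolding alg_structure_def
  proof (intro conjI ballI)
    fix S assume S: "S \<in> Calg R"
    note modD = D.module[OF S]
    show "(\<lambda>v w. ?\<mu> S v w) \<in> bilin (fst S) (Ob D S) (Ob D S) (Ob D S)"
      using bilin_comp_lin[OF pure_tensor_bilin[OF modD modD]] module_morphismD(1)[OF m S] by simp
    show "u S \<one>\<^bsub>fst S\<^esub> \<in> carrier (Ob D S)" by (rule u1[OF S])
    fix v assume v: "v \<in> carrier (Ob D S)"
    show "?\<mu> S (u S \<one>\<^bsub>fst S\<^esub>) v = v" "?\<mu> S v (u S \<one>\<^bsub>fst S\<^esub>) = v"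
    \<comment> \<open>Both sides are carried along the structure map of T, where naturality of the
      product and of the unit turns the claim into \<open>unit_self\<close> over the base
      change.\<close>
    proof (rule_tac [!] dual_eqI_self[of _ R C S])
      show "v \<in> dual_carrier R C S" "v \<in> dual_carrier R C S" using v by simp_all
      show "?\<mu> S (u S \<one>\<^bsub>fst S\<^esub>) v \<in> dual_carrier R C S" "?\<mu> S v (u S \<one>\<^bsub>fst S\<^esub>) \<in> dual_carrier R C S"
        using \<mu>_closed[OF S] u1[OF S] v by simp_all
      fix T x assume T: "T \<in> Calg (fst S)" and x: "x \<in> carrier (Ob C (base_alg R S T))"
      note B = base_alg_Calg[OF R S T] and sT = snd_alg_hom[OF T]
      note vB = D.map_closed[OF S B sT v]
      show "Ar D S (base_alg R S T) (snd T) (?\<mu> S (u S \<one>\<^bsub>fst S\<^esub>) v) (self_alg (fst T)) x =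
          Ar D S (base_alg R S T) (snd T) v (self_alg (fst T)) x"
        using unit_self[OF B vB x] by (simp only: \<mu>_nat[OF S B sT u1[OF S] v] u_nat[OF S B sT] fst_base_alg)
      show "Ar D S (base_alg R S T) (snd T) (?\<mu> S v (u S \<one>\<^bsub>fst S\<^esub>)) (self_alg (fst T)) x =
          Ar D S (base_alg R S T) (snd T) v (self_alg (fst T)) x"
        using unit_self[OF B vB x] by (simp only: \<mu>_nat[OF S B sT v u1[OF S]] u_nat[OF S B sT] fst_base_alg)
    qed
    fix w p assume w: "w \<in> carrier (Ob D S)" and p: "p \<in> carrier (Ob D S)"
    show "?\<mu> S (?\<mu> S v w) p = ?\<mu> S v (?\<mu> S w p)"
    proof (rule dual_eqI_self[of _ R C S])
      show "?\<mu> S (?\<mu> S v w) p \<in> dual_carrier R C S" "?\<mu> S v (?\<mu> S w p) \<in> dual_carrier R C S"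
        using \<mu>_closed[OF S \<mu>_closed[OF S v w] p] \<mu>_closed[OF S v \<mu>_closed[OF S w p]] by simp_all
      fix T x assume T: "T \<in> Calg (fst S)" and x: "x \<in> carrier (Ob C (base_alg R S T))"
      note B = base_alg_Calg[OF R S T] and sT = snd_alg_hom[OF T]
      note DB = D.map_closed[OF S B sT]
      show "Ar D S (base_alg R S T) (snd T) (?\<mu> S (?\<mu> S v w) p) (self_alg (fst T)) x =
          Ar D S (base_alg R S T) (snd T) (?\<mu> S v (?\<mu> S w p)) (self_alg (fst T)) x"
        using assoc_self[OF B DB[OF v] DB[OF w] DB[OF p] x]
        by (simp only: \<mu>_nat[OF S B sT] \<mu>_closed[OF S] v w p fst_base_alg)
    qed
  next
    fix S T f v w assume "S \<in> Calg R" "T \<in> Calg R" "f \<in> alg_hom R S T"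
    then show "Ar D S T f (u S \<one>\<^bsub>fst S\<^esub>) = u T \<one>\<^bsub>fst T\<^esub>" by (rule u_nat)
    assume "v \<in> carrier (Ob D S)" "w \<in> carrier (Ob D S)"
    with \<open>S \<in> Calg R\<close> \<open>T \<in> Calg R\<close> \<open>f \<in> alg_hom R S T\<close>
    show "Ar D S T f (?\<mu> S v w) = ?\<mu> T (Ar D S T f v) (Ar D S T f w)" by (rule \<mu>_nat)
  qed
qed

text \<open>The transpose of the linearised product serves as comultiplication. The coalgebra axioms
  speak of the m and u recovered from \<Delta> and \<epsilon>, so the point is that recovery returns
  the given product and unit; this is \<open>m'\<close> and \<open>u1\<close>.\<close>

lemma alg_structure_imp_coalgebra:
  assumes A: "alg_structure R D \<mu> e"
  shows "is_coalgebra_functor R C"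
proof -
  define m where "m S = tensor_lift (fst S) (Ob D S) (\<mu> S)" for S
  define \<Delta> where "\<Delta> = dual_flip R D2 C m"
  \<comment> \<open>The unit at S is a family indexed by S-algebras; its member at S over itself is
    the counit at S.\<close>
  define \<epsilon> where "\<epsilon> S x = e S (self_alg (fst S)) x" for S x
  define m' where "m' = dual_flip R C D2 \<Delta>"
  define u where "u = dual_point R C \<epsilon>"
  have self: "self_alg (fst S) \<in> Calg (fst S)" "base_alg R S (self_alg (fst S)) = S" if "S \<in> Calg R" for S
    using self_alg_Calg[OF CalgD(1)[OF that]] base_alg_self[OF that] .
  have m_pure: "m S (tens S v w) = \<mu> S v w"
    if S: "S \<in> Calg R" and "v \<in> carrier (Ob D S)" "w \<in> carrier (Ob D S)" for S v w
    unfolding m_def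
    by (rule tensor_lift_pure[OF D.module[OF S] D.module[OF S] D.module[OF S] alg_structureD(1)[OF A S] that(2,3)])
  have m: "module_morphism R D2 D m"
  proof (rule module_morphismI)
    fix S assume S: "S \<in> Calg R"
    show lin: "m S \<in> lin_hom (fst S) (Ob D2 S) (Ob D S)"
      unfolding m_def tensor_mfun_Ob
      by (rule tensor_lift_lin[OF D.module[OF S] D.module[OF S] D.module[OF S] alg_structureD(1)[OF A S]])
    fix T f z assume T: "T \<in> Calg R" and f: "f \<in> alg_hom R S T" and z: "z \<in> carrier (Ob D2 S)"
    have linT: "m T \<in> lin_hom (fst T) (Ob D2 T) (Ob D T)"
      unfolding m_def tensor_mfun_Ob
      by (rule tensor_lift_lin[OF D.module[OF T] D.module[OF T] D.module[OF T] alg_structureD(1)[OF A T]])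
    have L: "(\<lambda>z. m T (Ar D2 S T f z)) \<in>
        lin_hom (fst S) (tensor (fst S) (Ob D S) (Ob D S)) (restrict_scalars f (Ob D T))"
      using lin_hom_comp[OF lin_hom_restrict[OF linT alg_homD(1)[OF f]] module_functor_Ar_lin[OF D2 S T f]]
      by simp
    have L': "(\<lambda>z. Ar D S T f (m S z)) \<in>
        lin_hom (fst S) (tensor (fst S) (Ob D S) (Ob D S)) (restrict_scalars f (Ob D T))"
      using lin_hom_comp[OF module_functor_Ar_lin[OF D S T f] lin] by simp
    show "m T (Ar D2 S T f z) = Ar D S T f (m S z)"
    proof (rule tensor_hom_ext[OF D.module[OF S] D.module[OF S] L L'])
      show "z \<in> carrier (tensor (fst S) (Ob D S) (Ob D S))" using z by simp
      fix v w assume v: "v \<in> carrier (Ob D S)" and w: "w \<in> carrier (Ob D S)"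
      then show "m T (Ar D2 S T f (tens S v w)) =
          Ar D S T f (m S (tens S v w))"
        by (simp only: tensor_mfun_Ar_pure[OF D D S T f] m_pure[OF S] m_pure[OF T] D.map_closed[OF S T f]
            alg_structureD(7)[OF A S T f])
    qed
  qed
  have \<Delta>: "module_morphism R C (dual R D2) \<Delta>"
    unfolding \<Delta>_def by (rule dual_flip_morphism[OF R D2 C m])
  have m': "m' S z = m S z" if "S \<in> Calg R" "z \<in> carrier (Ob D2 S)" for S z
    unfolding m'_def \<Delta>_def by (rule dual_flip_flip[OF R D2 C m that])
  have m'_lin: "m' S \<in> lin_hom (fst S) (tensor (fst S) (Ob D S) (Ob D S)) (Ob D S)" if S: "S \<in> Calg R" for S
    using module_morphismD(1)[OF dual_flip_morphism[OF R C D2 \<Delta>] S] by (simp add: m'_def)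
  have m'_pure: "m' S (tens S v w) = \<mu> S v w"
    if "S \<in> Calg R" "v \<in> carrier (Ob D S)" "w \<in> carrier (Ob D S)" for S v w
    by (simp only: m'[OF that(1) pure_D[OF that]] m_pure[OF that])
  have \<epsilon>: "module_morphism R C ring_mfun \<epsilon>"
  proof (rule module_morphismI)
    fix S assume S: "S \<in> Calg R"
    have eS: "e S \<in> dual_carrier R C S" using alg_structureD(2)[OF A S] by simp
    show "\<epsilon> S \<in> lin_hom (fst S) (Ob C S) (Ob ring_mfun S)"
      using dual_carrierD(1)[OF eS self(1)[OF S]] self(2)[OF S] by (simp add: \<epsilon>_def[abs_def])
    fix T f x assume T: "T \<in> Calg R" and f: "f \<in> alg_hom R S T" and x: "x \<in> carrier (Ob C S)"
    note B = alg_hom_base[OF S f T]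
    have "f \<in> alg_hom (fst S) (self_alg (fst S)) (fst T, f)"
      using snd_alg_hom_self[OF CalgD(1)[OF S] B(1)] by simp
    then have "e S (fst T, f) (Ar C S T f x) = f (e S (self_alg (fst S)) x)"
      using dual_carrierD(2)[OF eS self(1)[OF S] B(1)] self(2)[OF S] B(2) x by simp
    \<comment> \<open>The unit is preserved by the transition map along f, so the unit at T,
      evaluated at T over itself, is the unit at S evaluated at T as an algebra through f.\<close>
    moreover have "e T (self_alg (fst T)) = e S (fst T, f)"
    proof -
      have "compose (carrier (fst S)) (\<lambda>s\<in>carrier (fst T). s) f = f"
        using alg_homD(2,4)[OF f] by (auto simp: compose_def extensional_def fun_eq_iff)
      then show ?thesis
        using self(1)[OF T] unfolding alg_structureD(6)[OF A S T f, symmetric] by (simp add: dual_Ar)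
    qed
    ultimately show "\<epsilon> T (Ar C S T f x) = Ar ring_mfun S T f (\<epsilon> S x)"
      by (simp add: \<epsilon>_def)
  qed
  have u: "module_morphism R ring_mfun D u" unfolding u_def by (rule dual_point_morphism[OF R C \<epsilon>])
  have u1: "u S \<one>\<^bsub>fst S\<^esub> = e S" if S: "S \<in> Calg R" for S
  proof (rule dual_eqI[of _ R C S])
    interpret S: cring "fst S" using CalgD(1)[OF S] .
    have eS: "e S \<in> carrier (Ob D S)" using alg_structureD(2)[OF A S] .
    show "u S \<one>\<^bsub>fst S\<^esub> \<in> dual_carrier R C S"
      using module_morphismD(3)[OF u S, of "\<one>\<^bsub>fst S\<^esub>"] by simp
    show "e S \<in> dual_carrier R C S" using eS by simp
    fix T x assume T: "T \<in> Calg (fst S)" and x: "x \<in> carrier (Ob C (base_alg R S T))"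
    interpret T: cring "fst T" using CalgD(1)[OF T] .
    note B = base_alg_Calg[OF R S T]
    have "e (base_alg R S T) (self_alg (fst T)) = e S T"
      using alg_structureD(6)[OF A S B snd_alg_hom[OF T]] dual_Ar_self[OF T, of R C "e S"] by simp
    moreover have "e S T x \<in> carrier (fst T)"
      using dual_carrierD(4)[of "e S" R C S T x] eS T x by simp
    ultimately show "u S \<one>\<^bsub>fst S\<^esub> T x = e S T x"
      using T x by (simp add: u_def dual_point_def \<epsilon>_def ring_hom_one[OF CalgD(2)[OF T]])
  qed
  have \<Delta>_apply: "\<Delta> S x T z = m (base_alg R S T) z (self_alg (fst T)) (Ar C S (base_alg R S T) (snd T) x)"
    if "T \<in> Calg (fst S)" "z \<in> carrier (Ob D2 (base_alg R S T))" for S x T z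
    unfolding \<Delta>_def by (rule dual_flip_apply[OF R D2 C that])
  have coassoc: "dual_map R (tensor_mfun D2 D) (tensor_mfun_map D D m' (\<lambda>_ w. w)) S (\<Delta> S x) =
      dual_map R (tensor_mfun D2 D) (tensor_mfun_assoc D D D) S
        (dual_map R (tensor_mfun D D2) (tensor_mfun_map D D (\<lambda>_ w. w) m') S (\<Delta> S x))"
    if S: "S \<in> Calg R" and x: "x \<in> carrier (Ob C S)" for S x
    unfolding dual_map_def[of R "tensor_mfun D2 D"]
  proof (intro restrict_ext)
    fix T z assume T: "T \<in> Calg (fst S)" and z: "z \<in> carrier (Ob (tensor_mfun D2 D) (base_alg R S T))"
    define B where "B = base_alg R S T"
    have B: "B \<in> Calg R" unfolding B_def by (rule base_alg_Calg[OF R S T])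
    note modD = D.module[OF B]
    have modD2: "module (fst B) (tensor (fst B) (Ob D B) (Ob D B))" by (rule module_tensor[OF modD modD])
    have zB: "z \<in> carrier (tensor (fst B) (tensor (fst B) (Ob D B) (Ob D B)) (Ob D B))"
      using z by (simp add: B_def)
    note mB = m'_lin[OF B]
    have mB': "m B \<in> lin_hom (fst B) (tensor (fst B) (Ob D B) (Ob D B)) (Ob D B)"
      using module_morphismD(1)[OF m B] by simp
    note L = tensor_hom_lin[OF modD2 modD modD modD mB lin_hom_id]
    note L' = tensor_hom_lin[OF modD modD2 modD modD lin_hom_id mB]
    note as = tensor_assoc_lin[OF modD modD modD]
    have \<mu>cl: "\<mu> B v w \<in> carrier (Ob D B)" if "v \<in> carrier (Ob D B)" "w \<in> carrier (Ob D B)" for v w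
      using bilinD(3)[OF alg_structureD(1)[OF A B]] that .
    have pcl: "tens B v w \<in> carrier (tensor (fst B) (Ob D B) (Ob D B))"
      if "v \<in> carrier (Ob D B)" "w \<in> carrier (Ob D B)" for v w
      using pure_tensor_closed[OF modD modD that] .
    have eq: "m B (tensor_hom (fst B) (Ob D B) (Ob D B) (m' B) (\<lambda>w. w) z) =
        m B (tensor_hom (fst B) (Ob D B) (Ob D B) (\<lambda>w. w) (m' B)
          (tensor_assoc (fst B) (Ob D B) (Ob D B) (Ob D B) z))"
    \<comment> \<open>Both sides are linear in z, so it is enough to take z pure; there the claim is
      associativity of \<mu>.\<close>
    proof (rule tensor_hom_ext3[OF modD modD modD lin_hom_comp[OF mB' L]
          lin_hom_comp[OF mB' lin_hom_comp[OF L' as]] _ zB])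
      fix v w p assume vwp: "v \<in> carrier (Ob D B)" "w \<in> carrier (Ob D B)" "p \<in> carrier (Ob D B)"
      show "m B (tensor_hom (fst B) (Ob D B) (Ob D B) (m' B) (\<lambda>w. w)
          (pure_tensor (fst B) (tensor (fst B) (Ob D B) (Ob D B)) (Ob D B) (tens B v w) p)) =
        m B (tensor_hom (fst B) (Ob D B) (Ob D B) (\<lambda>w. w) (m' B)
          (tensor_assoc (fst B) (Ob D B) (Ob D B) (Ob D B)
          (pure_tensor (fst B) (tensor (fst B) (Ob D B) (Ob D B)) (Ob D B) (tens B v w) p)))"
        using vwp by (simp only: tensor_hom_pure[OF modD2 modD modD modD mB lin_hom_id]
          tensor_hom_pure[OF modD modD2 modD modD lin_hom_id mB] tensor_assoc_pure[OF modD modD modD]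
          pcl m'_pure[OF B] m_pure[OF B] \<mu>cl alg_structureD(5)[OF A B])
    qed
    have 1: "tensor_mfun_map D D m' (\<lambda>_ w. w) B z \<in> carrier (Ob D2 B)"
      using lin_hom_closed[OF L zB] by (simp add: tensor_mfun_map_def)
    have 2: "tensor_mfun_assoc D D D B z \<in> carrier (Ob (tensor_mfun D D2) B)"
      using lin_hom_closed[OF as zB] by (simp add: tensor_mfun_assoc_def)
    have 3: "tensor_mfun_map D D (\<lambda>_ w. w) m' B (tensor_mfun_assoc D D D B z) \<in> carrier (Ob D2 B)"
      using lin_hom_closed[OF L' lin_hom_closed[OF as zB]]
      by (simp add: tensor_mfun_map_def tensor_mfun_assoc_def)
    show "\<Delta> S x T (tensor_mfun_map D D m' (\<lambda>_ w. w) (base_alg R S T) z) =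
        dual_map R (tensor_mfun D D2) (tensor_mfun_map D D (\<lambda>_ w. w) m') S (\<Delta> S x) T
          (tensor_mfun_assoc D D D (base_alg R S T) z)"
      unfolding dual_map_apply[OF T 2[unfolded B_def]] \<Delta>_apply[OF T 1[unfolded B_def]]
        \<Delta>_apply[OF T 3[unfolded B_def]]
      using eq by (simp add: tensor_mfun_map_def tensor_mfun_assoc_def B_def)
  qed
  have counit: "dual_map R D (\<lambda>T. pure_tensor (fst T) (Ob ring_mfun T) (Ob D T) \<one>\<^bsub>fst T\<^esub>) S
        (dual_map R (tensor_mfun ring_mfun D) (tensor_mfun_map D D u (\<lambda>_ w. w)) S (\<Delta> S x)) =
      bidual_can R C S x \<and>
      dual_map R D (\<lambda>T w. pure_tensor (fst T) (Ob D T) (Ob ring_mfun T) w \<one>\<^bsub>fst T\<^esub>) S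
        (dual_map R (tensor_mfun D ring_mfun) (tensor_mfun_map D D (\<lambda>_ w. w) u) S (\<Delta> S x)) =
      bidual_can R C S x"
    if S: "S \<in> Calg R" and x: "x \<in> carrier (Ob C S)" for S x
    unfolding dual_map_def[of R D] bidual_can_def
  proof (intro conjI restrict_ext)
    fix T w assume T: "T \<in> Calg (fst S)" and w: "w \<in> carrier (Ob D (base_alg R S T))"
    define B where "B = base_alg R S T"
    have B: "B \<in> Calg R" and [simp]: "fst B = fst T"
      unfolding B_def using base_alg_Calg[OF R S T] by simp_all
    interpret T: cring "fst T" using CalgD(1)[OF T] .
    have w: "w \<in> carrier (Ob D B)" using w by (simp add: B_def)
    note modD = D.module[OF B, simplified]
    have modR: "module (fst T) (ring_as_module (fst T))" by (rule module_ring[OF T.is_cring])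
    have uS: "u B \<in> lin_hom (fst T) (ring_as_module (fst T)) (Ob D B)"
      using module_morphismD(1)[OF u B] by simp
    have one: "\<one>\<^bsub>fst T\<^esub> \<in> carrier (ring_as_module (fst T))" by simp
    have eB: "e B \<in> carrier (Ob D B)" by (rule alg_structureD(2)[OF A B])
    have l: "pure_tensor (fst T) (ring_as_module (fst T)) (Ob D B) \<one>\<^bsub>fst T\<^esub> w
        \<in> carrier (Ob (tensor_mfun ring_mfun D) B)"
      using pure_tensor_closed[OF modR modD one w] by simp
    have r: "pure_tensor (fst T) (Ob D B) (ring_as_module (fst T)) w \<one>\<^bsub>fst T\<^esub>
        \<in> carrier (Ob (tensor_mfun D ring_mfun) B)"
      using pure_tensor_closed[OF modD modR w one] by simp
    have 1: "tensor_mfun_map D D u (\<lambda>_ w. w) B (pure_tensor (fst T) (ring_as_module (fst T)) (Ob D B) \<one>\<^bsub>fst T\<^esub> w) =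
        tens B (e B) w"
      using tensor_hom_pure[OF modR modD modD modD uS lin_hom_id one w] u1[OF B] by (simp add: tensor_mfun_map_def)
    have 2: "tensor_mfun_map D D (\<lambda>_ w. w) u B (pure_tensor (fst T) (Ob D B) (ring_as_module (fst T)) w \<one>\<^bsub>fst T\<^esub>) =
        tens B w (e B)"
      using tensor_hom_pure[OF modD modR modD modD lin_hom_id uS w one] u1[OF B] by (simp add: tensor_mfun_map_def)
    note Bf = B_def[symmetric]
    have "dual_map R (tensor_mfun ring_mfun D) (tensor_mfun_map D D u (\<lambda>_ w. w)) S (\<Delta> S x) T
        (pure_tensor (fst T) (ring_as_module (fst T)) (Ob D B) \<one>\<^bsub>fst T\<^esub> w) =
        \<Delta> S x T (tens B (e B) w)"
      by (simp only: dual_map_apply[OF T l[unfolded B_def], unfolded Bf] 1)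
    also have "\<dots> = w (self_alg (fst T)) (Ar C S B (snd T) x)"
      using \<Delta>_apply[OF T, unfolded Bf, OF pure_D[OF B eB w]]
      by (simp only: m_pure[OF B eB w] alg_structureD(3)[OF A B w])
    finally show "dual_map R (tensor_mfun ring_mfun D) (tensor_mfun_map D D u (\<lambda>_ w. w)) S (\<Delta> S x) T
        (pure_tensor (fst (base_alg R S T)) (Ob ring_mfun (base_alg R S T)) (Ob D (base_alg R S T))
           \<one>\<^bsub>fst (base_alg R S T)\<^esub> w) =
        w (self_alg (fst T)) (Ar C S (base_alg R S T) (snd T) x)"
      by (simp only: Bf ring_mfun_simps \<open>fst B = fst T\<close>)
    have "dual_map R (tensor_mfun D ring_mfun) (tensor_mfun_map D D (\<lambda>_ w. w) u) S (\<Delta> S x) T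
        (pure_tensor (fst T) (Ob D B) (ring_as_module (fst T)) w \<one>\<^bsub>fst T\<^esub>) =
        \<Delta> S x T (tens B w (e B))"
      by (simp only: dual_map_apply[OF T r[unfolded B_def], unfolded Bf] 2)
    also have "\<dots> = w (self_alg (fst T)) (Ar C S B (snd T) x)"
      using \<Delta>_apply[OF T, unfolded Bf, OF pure_D[OF B w eB]]
      by (simp only: m_pure[OF B w eB] alg_structureD(4)[OF A B w])
    finally show "dual_map R (tensor_mfun D ring_mfun) (tensor_mfun_map D D (\<lambda>_ w. w) u) S (\<Delta> S x) T
        (pure_tensor (fst (base_alg R S T)) (Ob D (base_alg R S T)) (Ob ring_mfun (base_alg R S T))
           w \<one>\<^bsub>fst (base_alg R S T)\<^esub>) =
        w (self_alg (fst T)) (Ar C S (base_alg R S T) (snd T) x)"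
      by (simp only: Bf ring_mfun_simps \<open>fst B = fst T\<close>)
  qed
  show ?thesis
    unfolding is_coalgebra_functor_def Let_def
    using C \<Delta> \<epsilon> coassoc counit unfolding m'_def u_def tensor_tilde_def[symmetric] by blast
qed

theorem coalgebra_functor_iff: "is_coalgebra_functor R C \<longleftrightarrow> is_algebra_functor R D"
proof
  assume "is_coalgebra_functor R C"
  then show "is_algebra_functor R D"
    unfolding is_coalgebra_functor_def Let_def is_algebra_functor_iff[OF D]
    using coalgebra_imp_alg_structure[OF _ _ refl refl] by blast
next
  assume "is_algebra_functor R D"
  then show "is_coalgebra_functor R C"
    unfolding is_algebra_functor_iff[OF D] using alg_structure_imp_coalgebra by blast
qed

end

section \<open>Quasi-coherent functors and their duals\<close>

lemma bilin_cong:
  assumes "module R M" "module R N" "\<And>x y. \<lbrakk>x \<in> carrier M; y \<in> carrier N\<rbrakk> \<Longrightarrow> b x y = b' x y"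
    and "b \<in> bilin R M N P"
  shows "b' \<in> bilin R M N P"
proof (rule bilinI)
  show "b' x \<in> lin_hom R N P" if "x \<in> carrier M" for x
    using assms(2) bilinD(1)[OF assms(4) that] by (rule lin_hom_cong) (simp add: assms(3) that)
  show "(\<lambda>x. b' x y) \<in> lin_hom R M P" if "y \<in> carrier N" for y
    using assms(1) bilinD(2)[OF assms(4) that] by (rule lin_hom_cong) (simp add: assms(3) that)
qed

locale quasi_coherent_setup =
  fixes R :: "'u ring" and C :: "('u, 'c) module"
  assumes R: "cring R" and C: "module R C"
begin

sublocale R: cring R by (rule R)
sublocale C: module R C by (rule C)

abbreviation "alg_mod S \<equiv> restrict_scalars (snd S) (ring_as_module (fst S))"
abbreviation "Q \<equiv> quasi_coherent R C"
abbreviation "pt S \<equiv> pure_tensor R C (alg_mod S)"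

lemma module_alg_mod: "S \<in> Calg R \<Longrightarrow> module R (alg_mod S)"
  by (rule module_restrict_scalars[OF R module_ring CalgD(2)]) (rule CalgD(1))

lemma module_Q_R: "S \<in> Calg R \<Longrightarrow> module R (tensor R C (alg_mod S))"
  by (rule module_tensor[OF C module_alg_mod])

lemma mult_lin:
  assumes "S \<in> Calg R" "s \<in> carrier (fst S)"
  shows "(\<lambda>t. s \<otimes>\<^bsub>fst S\<^esub> t) \<in> lin_hom R (alg_mod S) (alg_mod S)"
proof -
  interpret S: cring "fst S" using CalgD(1)[OF assms(1)] .
  show ?thesis
    using assms(2) CalgD(4)[OF assms(1)] by (intro lin_homI) (simp_all add: S.r_distr S.m_lcomm)
qed

lemma alg_hom_lin:
  assumes "S \<in> Calg R" "f \<in> alg_hom R S T"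
  shows "f \<in> lin_hom R (alg_mod S) (alg_mod T)"
proof (rule lin_homI)
  note f = alg_homD(1)[OF assms(2)]
  show "f (r \<odot>\<^bsub>alg_mod S\<^esub> s) = r \<odot>\<^bsub>alg_mod T\<^esub> f s"
    if r: "r \<in> carrier R" and s: "s \<in> carrier (alg_mod S)" for r s
  proof -
    have "f (snd S r) = snd T r" using alg_homD(3)[OF assms(2)] r by (metis compose_eq)
    then show ?thesis using ring_hom_mult[OF f CalgD(4)[OF assms(1) r]] s by simp
  qed
qed (simp_all add: ring_hom_closed[OF alg_homD(1)[OF assms(2)]] ring_hom_add[OF alg_homD(1)[OF assms(2)]])

lemma Q_simps [simp]:
  "carrier (Ob Q S) = carrier (tensor R C (alg_mod S))"
  "add (Ob Q S) = add (tensor R C (alg_mod S))"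
  "\<zero>\<^bsub>Ob Q S\<^esub> = \<zero>\<^bsub>tensor R C (alg_mod S)\<^esub>"
  by (simp_all add: quasi_coherent_def Let_def)

lemma Q_smult: "s \<odot>\<^bsub>Ob Q S\<^esub> x = tensor_hom R C (alg_mod S) (\<lambda>c. c) (\<lambda>t. s \<otimes>\<^bsub>fst S\<^esub> t) x"
  and Q_Ar: "Ar Q S T f = tensor_hom R C (alg_mod T) (\<lambda>c. c) f"
  by (simp_all add: quasi_coherent_def Let_def)

lemma pt_closed:
  "\<lbrakk>S \<in> Calg R; c \<in> carrier C; s \<in> carrier (fst S)\<rbrakk> \<Longrightarrow> pt S c s \<in> carrier (tensor R C (alg_mod S))"
  by (rule pure_tensor_closed[OF C module_alg_mod]) simp_all

lemma pt_lin:
  assumes "S \<in> Calg R"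
  shows "s \<in> carrier (fst S) \<Longrightarrow> (\<lambda>c. pt S c s) \<in> lin_hom R C (tensor R C (alg_mod S))"
    and "c \<in> carrier C \<Longrightarrow> (\<lambda>s. pt S c s) \<in> lin_hom R (alg_mod S) (tensor R C (alg_mod S))"
  using bilinD(1,2)[OF pure_tensor_bilin[OF C module_alg_mod[OF assms]]] by simp_all

lemma Q_induct [consumes 2, case_names pt add]:
  assumes "S \<in> Calg R" "x \<in> carrier (tensor R C (alg_mod S))"
    and "\<And>c s. \<lbrakk>c \<in> carrier C; s \<in> carrier (fst S)\<rbrakk> \<Longrightarrow> P (pt S c s)"
    and "\<And>x y. \<lbrakk>x \<in> carrier (tensor R C (alg_mod S)); y \<in> carrier (tensor R C (alg_mod S)); P x; P y\<rbrakk> \<Longrightarrow>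
      P (x \<oplus>\<^bsub>tensor R C (alg_mod S)\<^esub> y)"
  shows "P x"
  using module_pair.tensor_induct[OF module_pairI[OF C module_alg_mod[OF assms(1)]] assms(2), of P] assms(3,4)
  by simp

lemma Q_smult_lin:
  "\<lbrakk>S \<in> Calg R; s \<in> carrier (fst S)\<rbrakk> \<Longrightarrow>
    (\<lambda>x. s \<odot>\<^bsub>Ob Q S\<^esub> x) \<in> lin_hom R (tensor R C (alg_mod S)) (tensor R C (alg_mod S))"
  unfolding Q_smult by (rule tensor_hom_lin[OF C module_alg_mod C module_alg_mod lin_hom_id mult_lin])

lemma Q_smult_pt:
  "\<lbrakk>S \<in> Calg R; s \<in> carrier (fst S); c \<in> carrier C; t \<in> carrier (fst S)\<rbrakk> \<Longrightarrow>
    s \<odot>\<^bsub>Ob Q S\<^esub> pt S c t = pt S c (s \<otimes>\<^bsub>fst S\<^esub> t)"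
  unfolding Q_smult by (rule tensor_hom_pure[OF C module_alg_mod C module_alg_mod lin_hom_id mult_lin]) simp_all

lemma Q_Ar_lin_R:
  "\<lbrakk>S \<in> Calg R; T \<in> Calg R; f \<in> alg_hom R S T\<rbrakk> \<Longrightarrow>
    Ar Q S T f \<in> lin_hom R (tensor R C (alg_mod S)) (tensor R C (alg_mod T))"
  unfolding Q_Ar by (rule tensor_hom_lin[OF C module_alg_mod C module_alg_mod lin_hom_id alg_hom_lin])

lemma Q_Ar_pt:
  "\<lbrakk>S \<in> Calg R; T \<in> Calg R; f \<in> alg_hom R S T; c \<in> carrier C; s \<in> carrier (fst S)\<rbrakk> \<Longrightarrow>
    Ar Q S T f (pt S c s) = pt T c (f s)"
  unfolding Q_Ar by (rule tensor_hom_pure[OF C module_alg_mod C module_alg_mod lin_hom_id alg_hom_lin]) simp_all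

lemma Q_module:
  assumes S: "S \<in> Calg R"
  shows "module (fst S) (Ob Q S)"
proof -
  let ?T = "tensor R C (alg_mod S)"
  interpret S: cring "fst S" using CalgD(1)[OF S] .
  interpret T: module R ?T by (rule module_Q_R[OF S])
  note sl = Q_smult_lin[OF S] and spt = Q_smult_pt[OF S]
  note closed = lin_hom_closed[OF sl]
  show ?thesis
  proof (rule moduleI[OF S.is_cring])
    show "abelian_group (Ob Q S)"
      by (rule abelian_groupI) (simp_all add: T.M.a_ac T.M.add.l_inv_ex[simplified])
    show "a \<odot>\<^bsub>Ob Q S\<^esub> x \<in> carrier (Ob Q S)" if "a \<in> carrier (fst S)" "x \<in> carrier (Ob Q S)" for a x
      using closed that by simp
    show "a \<odot>\<^bsub>Ob Q S\<^esub> (x \<oplus>\<^bsub>Ob Q S\<^esub> y) = a \<odot>\<^bsub>Ob Q S\<^esub> x \<oplus>\<^bsub>Ob Q S\<^esub> a \<odot>\<^bsub>Ob Q S\<^esub> y"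
      if "a \<in> carrier (fst S)" "x \<in> carrier (Ob Q S)" "y \<in> carrier (Ob Q S)" for a x y
      using lin_hom_add[OF sl] that by simp
    fix x assume "x \<in> carrier (Ob Q S)"
    then have x: "x \<in> carrier ?T" by simp
    show "\<one>\<^bsub>fst S\<^esub> \<odot>\<^bsub>Ob Q S\<^esub> x = x"
      using S x by (induction rule: Q_induct) (simp_all add: spt lin_hom_add[OF sl])
    fix a b assume a: "a \<in> carrier (fst S)" and b: "b \<in> carrier (fst S)"
    show "(a \<otimes>\<^bsub>fst S\<^esub> b) \<odot>\<^bsub>Ob Q S\<^esub> x = a \<odot>\<^bsub>Ob Q S\<^esub> (b \<odot>\<^bsub>Ob Q S\<^esub> x)"
      using S x by (induction rule: Q_induct)
        (simp_all add: a b spt closed lin_hom_add[OF sl] S.m_assoc)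
    have "(a \<oplus>\<^bsub>fst S\<^esub> b) \<odot>\<^bsub>Ob Q S\<^esub> x = a \<odot>\<^bsub>Ob Q S\<^esub> x \<oplus>\<^bsub>?T\<^esub> b \<odot>\<^bsub>Ob Q S\<^esub> x"
      using S x
    proof (induction rule: Q_induct)
      case (pt c s)
      then show ?case
        using lin_hom_add[OF pt_lin(2)[OF S pt(1)], of "a \<otimes>\<^bsub>fst S\<^esub> s" "b \<otimes>\<^bsub>fst S\<^esub> s"] a b
        by (simp add: spt S.l_distr)
    next
      case (add x y)
      then show ?case
        using a b closed by (simp add: lin_hom_add[OF sl] T.M.a_ac)
    qed
    then show "(a \<oplus>\<^bsub>fst S\<^esub> b) \<odot>\<^bsub>Ob Q S\<^esub> x = a \<odot>\<^bsub>Ob Q S\<^esub> x \<oplus>\<^bsub>Ob Q S\<^esub> b \<odot>\<^bsub>Ob Q S\<^esub> x" by simp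
  qed
qed

text \<open>The ring S acts on the second factor, while the tensor product over R carries its own
  R-action. They agree on C \<otimes> S because R acts on the second factor through the structure
  map.\<close>

lemma Q_smult_scalar:
  assumes S: "S \<in> Calg R" and r: "r \<in> carrier R" and x: "x \<in> carrier (tensor R C (alg_mod S))"
  shows "snd S r \<odot>\<^bsub>Ob Q S\<^esub> x = r \<odot>\<^bsub>tensor R C (alg_mod S)\<^esub> x"
proof -
  interpret T: module R "tensor R C (alg_mod S)" by (rule module_Q_R[OF S])
  note rS = CalgD(4)[OF S r]
  show ?thesis
    using S x
  proof (induction rule: Q_induct)
    case (pt c s)
    then show ?case
      using lin_hom_smult[OF pt_lin(2)[OF S pt(1)] r, of s] by (simp add: Q_smult_pt[OF S rS])
  next
    case (add x y)
    then show ?case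
      by (simp add: lin_hom_add[OF Q_smult_lin[OF S rS]] T.smult_r_distr r)
  qed
qed

lemma Q_functor: "module_functor R Q"
proof (rule module_functorI)
  fix S assume S: "S \<in> Calg R"
  show "module (fst S) (Ob Q S)" by (rule Q_module[OF S])
  fix x assume "x \<in> carrier (Ob Q S)"
  then have x: "x \<in> carrier (tensor R C (alg_mod S))" by simp
  note id = alg_hom_id[OF S]
  show "Ar Q S S (\<lambda>s\<in>carrier (fst S). s) x = x"
    using S x by (induction rule: Q_induct)
      (simp_all add: Q_Ar_pt[OF S S id] lin_hom_add[OF Q_Ar_lin_R[OF S S id]] del: restrict_apply,
       simp_all)
  fix T U f g assume T: "T \<in> Calg R" and U: "U \<in> Calg R"
    and f: "f \<in> alg_hom R S T" and g: "g \<in> alg_hom R T U"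
  note gf = alg_hom_compose[OF S f g]
  show "Ar Q S U (compose (carrier (fst S)) g f) x = Ar Q T U g (Ar Q S T f x)"
    using S x
  proof (induction rule: Q_induct)
    case (pt c s)
    then show ?case
      using alg_homD(4)[OF f] by (simp add: Q_Ar_pt[OF S T f] Q_Ar_pt[OF T U g] Q_Ar_pt[OF S U gf] compose_eq)
  next
    case (add x y)
    then show ?case
      by (simp add: lin_hom_add[OF Q_Ar_lin_R[OF S T f]] lin_hom_add[OF Q_Ar_lin_R[OF T U g]]
          lin_hom_add[OF Q_Ar_lin_R[OF S U gf]] lin_hom_closed[OF Q_Ar_lin_R[OF S T f]])
  qed
next
  fix S T f assume S: "S \<in> Calg R" and T: "T \<in> Calg R" and f: "f \<in> alg_hom R S T"
  note lin = Q_Ar_lin_R[OF S T f]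
  show "Ar Q S T f \<in> lin_hom (fst S) (Ob Q S) (restrict_scalars f (Ob Q T))"
  proof (rule lin_homI)
    fix a x assume a: "a \<in> carrier (fst S)" and "x \<in> carrier (Ob Q S)"
    then have x: "x \<in> carrier (tensor R C (alg_mod S))" by simp
    note fa = alg_homD(4)[OF f a]
    have "Ar Q S T f (a \<odot>\<^bsub>Ob Q S\<^esub> x) = f a \<odot>\<^bsub>Ob Q T\<^esub> Ar Q S T f x"
      using S x
    proof (induction rule: Q_induct)
      case (pt c s)
      interpret S: cring "fst S" using CalgD(1)[OF S] .
      show ?case
        using pt alg_homD(4)[OF f] a
        by (simp add: Q_smult_pt[OF S] Q_smult_pt[OF T] Q_Ar_pt[OF S T f] ring_hom_mult[OF alg_homD(1)[OF f]])
    next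
      case (add x y)
      then show ?case
        by (simp add: lin_hom_add[OF lin] lin_hom_add[OF Q_smult_lin[OF S a]]
            lin_hom_add[OF Q_smult_lin[OF T fa]] lin_hom_closed[OF lin] lin_hom_closed[OF Q_smult_lin[OF S a]])
    qed
    then show "Ar Q S T f (a \<odot>\<^bsub>Ob Q S\<^esub> x) = a \<odot>\<^bsub>restrict_scalars f (Ob Q T)\<^esub> Ar Q S T f x" by simp
  qed (simp_all add: lin_hom_closed[OF lin] lin_hom_add[OF lin])
qed

section \<open>The functor of linear maps out of C as a model of the dual\<close>

definition H :: "('u, 'c \<Rightarrow> 'u) mfun" where
  "H = \<lparr>Ob = (\<lambda>S. \<lparr>carrier = lin_hom R C (alg_mod S) \<inter> extensional (carrier C),
       mult = undefined, one = undefined, ring.zero = (\<lambda>c\<in>carrier C. \<zero>\<^bsub>fst S\<^esub>),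
       add = (\<lambda>g h. \<lambda>c\<in>carrier C. g c \<oplus>\<^bsub>fst S\<^esub> h c),
       smult = (\<lambda>s g. \<lambda>c\<in>carrier C. s \<otimes>\<^bsub>fst S\<^esub> g c)\<rparr>),
     Ar = (\<lambda>S T f g. compose (carrier C) f g)\<rparr>"

lemma H_simps:
  "carrier (Ob H S) = lin_hom R C (alg_mod S) \<inter> extensional (carrier C)"
  "\<zero>\<^bsub>Ob H S\<^esub> = (\<lambda>c\<in>carrier C. \<zero>\<^bsub>fst S\<^esub>)"
  "g \<oplus>\<^bsub>Ob H S\<^esub> h = (\<lambda>c\<in>carrier C. g c \<oplus>\<^bsub>fst S\<^esub> h c)"
  "s \<odot>\<^bsub>Ob H S\<^esub> g = (\<lambda>c\<in>carrier C. s \<otimes>\<^bsub>fst S\<^esub> g c)"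
  "Ar H S T f g = compose (carrier C) f g"
  by (simp_all add: H_def)

lemma H_D:
  assumes "h \<in> carrier (Ob H S)"
  shows "h \<in> lin_hom R C (alg_mod S)" "h \<in> extensional (carrier C)"
    and "c \<in> carrier C \<Longrightarrow> h c \<in> carrier (fst S)"
    and "\<lbrakk>c \<in> carrier C; d \<in> carrier C\<rbrakk> \<Longrightarrow> h (c \<oplus>\<^bsub>C\<^esub> d) = h c \<oplus>\<^bsub>fst S\<^esub> h d"
    and "\<lbrakk>r \<in> carrier R; c \<in> carrier C\<rbrakk> \<Longrightarrow> h (r \<odot>\<^bsub>C\<^esub> c) = snd S r \<otimes>\<^bsub>fst S\<^esub> h c"
  using assms by (auto simp: H_simps lin_hom_def)

lemma H_restrictI: "h \<in> lin_hom R C (alg_mod S) \<Longrightarrow> (\<lambda>c\<in>carrier C. h c) \<in> carrier (Ob H S)"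
  using lin_hom_cong[OF C, of h "alg_mod S" "\<lambda>c\<in>carrier C. h c"] by (simp add: H_simps)

lemma H_eqI:
  assumes "g \<in> carrier (Ob H S)" "h \<in> carrier (Ob H S)" "\<And>c. c \<in> carrier C \<Longrightarrow> g c = h c"
  shows "g = h"
  using H_D(2)[OF assms(1)] H_D(2)[OF assms(2)] assms(3) by (rule extensionalityI)

text \<open>One half of the adjunction between linear maps C \<rightarrow> S over R and linear maps
  C \<otimes> S \<rightarrow> S over S; \<open>dual_to_hom\<close> is the other. It replaces
  families indexed by algebras by single functions on C.\<close>

definition hom_to_dual :: "'u alg \<Rightarrow> ('c \<Rightarrow> 'u) \<Rightarrow> ('u alg \<Rightarrow> ('c \<times> 'u \<Rightarrow> 'u) set \<Rightarrow> 'u)" where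
  "hom_to_dual S h = (\<lambda>T\<in>Calg (fst S). \<lambda>x\<in>carrier (Ob Q (base_alg R S T)).
     tensor_lift R (alg_mod (base_alg R S T)) (\<lambda>c t. t \<otimes>\<^bsub>fst T\<^esub> snd T (h c)) x)"

definition dual_to_hom :: "'u alg \<Rightarrow> ('u alg \<Rightarrow> ('c \<times> 'u \<Rightarrow> 'u) set \<Rightarrow> 'u) \<Rightarrow> 'c \<Rightarrow> 'u" where
  "dual_to_hom S w = (\<lambda>c\<in>carrier C. w (self_alg (fst S)) (pt S c \<one>\<^bsub>fst S\<^esub>))"

lemma alg_bilin:
  assumes S: "S \<in> Calg R" and h: "h \<in> lin_hom R M (alg_mod S)" and g: "g \<in> lin_hom R N (alg_mod S)"
  shows "(\<lambda>x y. h x \<otimes>\<^bsub>fst S\<^esub> g y) \<in> bilin R M N (alg_mod S)"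
proof -
  interpret S: cring "fst S" using CalgD(1)[OF S] .
  note hc = lin_hom_closed[OF h, simplified] and gc = lin_hom_closed[OF g, simplified]
  show ?thesis
    using CalgD(4)[OF S]
    by (intro bilinI lin_homI) (simp_all add: hc gc lin_hom_add[OF h] lin_hom_add[OF g]
        lin_hom_smult[OF h] lin_hom_smult[OF g] S.l_distr S.r_distr S.m_ac)
qed

lemma hom_to_dual:
  assumes S: "S \<in> Calg R" and h: "h \<in> carrier (Ob H S)"
  shows hom_to_dual_closed: "hom_to_dual S h \<in> dual_carrier R Q S"
    and hom_to_dual_pt: "\<lbrakk>T \<in> Calg (fst S); c \<in> carrier C; t \<in> carrier (fst T)\<rbrakk> \<Longrightarrow>
      hom_to_dual S h T (pt (base_alg R S T) c t) = t \<otimes>\<^bsub>fst T\<^esub> snd T (h c)"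
proof -
  let ?L = "\<lambda>T. tensor_lift R (alg_mod (base_alg R S T)) (\<lambda>c t. t \<otimes>\<^bsub>fst T\<^esub> snd T (h c))"
  have lift: "?L T \<in> lin_hom R (tensor R C (alg_mod (base_alg R S T))) (alg_mod (base_alg R S T)) \<and>
      (\<forall>c\<in>carrier C. \<forall>t\<in>carrier (fst T). ?L T (pt (base_alg R S T) c t) = t \<otimes>\<^bsub>fst T\<^esub> snd T (h c))"
    if T: "T \<in> Calg (fst S)" for T
  proof -
    let ?B = "base_alg R S T"
    interpret T: cring "fst T" using CalgD(1)[OF T] .
    note B = base_alg_Calg[OF R S T]
    have "(\<lambda>c. snd T (h c)) \<in> lin_hom R C (alg_mod ?B)"
      using lin_hom_comp[OF alg_hom_lin[OF S snd_alg_hom[OF T]] H_D(1)[OF h]] .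
    from alg_bilin[OF B this lin_hom_id]
    have *: "(\<lambda>c t. snd T (h c) \<otimes>\<^bsub>fst T\<^esub> t) \<in> bilin R C (alg_mod ?B) (alg_mod ?B)" by simp
    have "snd T (h c) \<in> carrier (fst T)" if "c \<in> carrier C" for c
      using CalgD(4)[OF T H_D(3)[OF h that]] .
    then have b: "(\<lambda>c t. t \<otimes>\<^bsub>fst T\<^esub> snd T (h c)) \<in> bilin R C (alg_mod ?B) (alg_mod ?B)"
      by (intro bilin_cong[OF C module_alg_mod[OF B] _ *]) (simp add: T.m_comm)
    show ?thesis
      using tensor_lift_lin[OF C module_alg_mod[OF B] module_alg_mod[OF B] b]
        tensor_lift_pure[OF C module_alg_mod[OF B] module_alg_mod[OF B] b] by simp
  qed
  show "hom_to_dual S h \<in> dual_carrier R Q S"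
    unfolding hom_to_dual_def
  proof (rule dual_carrierI[OF R Q_functor S])
    fix T assume T: "T \<in> Calg (fst S)"
    let ?B = "base_alg R S T"
    interpret T: cring "fst T" using CalgD(1)[OF T] .
    note B = base_alg_Calg[OF R S T]
    note L = conjunct1[OF lift[OF T]]
    note Lpt = bspec[OF bspec[OF conjunct2[OF lift[OF T]]], simplified]
    have hT: "snd T (h c) \<in> carrier (fst T)" if "c \<in> carrier C" for c
      using CalgD(4)[OF T H_D(3)[OF h that]] .
    show "?L T \<in> lin_hom (fst T) (Ob Q ?B) (ring_as_module (fst T))"
    proof (rule lin_homI)
      fix a x assume a: "a \<in> carrier (fst T)" and "x \<in> carrier (Ob Q ?B)"
      then have x: "x \<in> carrier (tensor R C (alg_mod ?B))" by simp
      have aB: "a \<in> carrier (fst ?B)" using a by simp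
      have "?L T (a \<odot>\<^bsub>Ob Q ?B\<^esub> x) = a \<otimes>\<^bsub>fst T\<^esub> ?L T x"
        using B x
      proof (induction rule: Q_induct)
        case (pt c s)
        then show ?case
          using a hT by (simp add: Q_smult_pt[OF B aB, simplified] Lpt T.m_assoc)
      next
        case (add x y)
        then show ?case
          using a lin_hom_closed[OF L, simplified]
          by (simp add: lin_hom_add[OF L, simplified] lin_hom_add[OF Q_smult_lin[OF B aB], simplified]
              lin_hom_closed[OF Q_smult_lin[OF B aB], simplified] T.r_distr)
      qed
      then show "?L T (a \<odot>\<^bsub>Ob Q ?B\<^esub> x) = a \<odot>\<^bsub>ring_as_module (fst T)\<^esub> ?L T x" by simp
    qed (use lin_hom_closed[OF L] lin_hom_add[OF L] in simp_all)
    fix U f x assume U: "U \<in> Calg (fst S)" and f: "f \<in> alg_hom (fst S) T U" and "x \<in> carrier (Ob Q ?B)"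
    then have x: "x \<in> carrier (tensor R C (alg_mod ?B))" by simp
    let ?U = "base_alg R S U"
    note C' = base_alg_Calg[OF R S U] and fR = alg_hom_base_alg[OF S f]
    note LU = conjunct1[OF lift[OF U]]
    note LUpt = bspec[OF bspec[OF conjunct2[OF lift[OF U]]], simplified]
    note Ar_lin = Q_Ar_lin_R[OF B C' fR]
    show "?L U (Ar Q ?B ?U f x) = f (?L T x)"
      using B x
    proof (induction rule: Q_induct)
      case (pt c s)
      have "f (snd T (h c)) = snd U (h c)"
        using alg_homD(3)[OF f] H_D(3)[OF h pt(1)] by (metis compose_eq)
      then show ?case
        using pt alg_homD(4)[OF f] hT[OF pt(1)]
        by (simp add: Q_Ar_pt[OF B C' fR, simplified] Lpt LUpt ring_hom_mult[OF alg_homD(1)[OF f]])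
    next
      case (add x y)
      then show ?case
        using lin_hom_closed[OF L, simplified]
        by (simp add: lin_hom_add[OF Ar_lin, simplified] lin_hom_add[OF L, simplified]
            lin_hom_add[OF LU, simplified] lin_hom_closed[OF Ar_lin, simplified]
            ring_hom_add[OF alg_homD(1)[OF f]])
    qed
  qed
  show "\<lbrakk>T \<in> Calg (fst S); c \<in> carrier C; t \<in> carrier (fst T)\<rbrakk> \<Longrightarrow>
      hom_to_dual S h T (pt (base_alg R S T) c t) = t \<otimes>\<^bsub>fst T\<^esub> snd T (h c)"
    using lift[of T] pt_closed[OF base_alg_Calg[OF R S], of T] by (simp add: hom_to_dual_def)
qed

text \<open>Since c \<otimes> t is t times c \<otimes> 1, linearity over T reduces everything to the
  elements c \<otimes> 1, and over T these are the images of the same elements over S, so naturality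
  reduces to S itself.\<close>

lemma dual_Q_eqI:
  assumes S: "S \<in> Calg R" and v: "v \<in> dual_carrier R Q S" and w: "w \<in> dual_carrier R Q S"
    and eq: "\<And>c. c \<in> carrier C \<Longrightarrow> v (self_alg (fst S)) (pt S c \<one>\<^bsub>fst S\<^esub>) = w (self_alg (fst S)) (pt S c \<one>\<^bsub>fst S\<^esub>)"
  shows "v = w"
proof (rule dual_eqI[OF v w])
  interpret S: cring "fst S" using CalgD(1)[OF S] .
  note self = self_alg_Calg[OF CalgD(1)[OF S]]
  fix T x assume T: "T \<in> Calg (fst S)" and "x \<in> carrier (Ob Q (base_alg R S T))"
  let ?B = "base_alg R S T"
  have x: "x \<in> carrier (tensor R C (alg_mod ?B))" using \<open>x \<in> _\<close> by simp
  interpret T: cring "fst T" using CalgD(1)[OF T] .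
  note B = base_alg_Calg[OF R S T] and sT = snd_alg_hom[OF T]
  have val: "u T (pt ?B c t) = t \<otimes>\<^bsub>fst T\<^esub> snd T (u (self_alg (fst S)) (pt S c \<one>\<^bsub>fst S\<^esub>))"
    if u: "u \<in> dual_carrier R Q S" and c: "c \<in> carrier C" and t: "t \<in> carrier (fst T)" for u c t
  proof -
    have one: "pt ?B c \<one>\<^bsub>fst T\<^esub> \<in> carrier (Ob Q ?B)"
      using pt_closed[OF B c] by simp
    have "u T (pt ?B c t) = u T (t \<odot>\<^bsub>Ob Q ?B\<^esub> pt ?B c \<one>\<^bsub>fst T\<^esub>)"
      using t c by (simp add: Q_smult_pt[OF B, simplified])
    also have "\<dots> = t \<otimes>\<^bsub>fst T\<^esub> u T (pt ?B c \<one>\<^bsub>fst T\<^esub>)"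
      using lin_hom_smult[OF dual_carrierD(1)[OF u T] t one] by simp
    also have "pt ?B c \<one>\<^bsub>fst T\<^esub> = Ar Q S ?B (snd T) (pt S c \<one>\<^bsub>fst S\<^esub>)"
      using c by (simp add: Q_Ar_pt[OF S B sT] ring_hom_one[OF CalgD(2)[OF T]])
    also have "u T \<dots> = snd T (u (self_alg (fst S)) (pt S c \<one>\<^bsub>fst S\<^esub>))"
      using dual_carrierD(2)[OF u self T snd_alg_hom_self[OF S.is_cring T]] base_alg_self[OF S]
        pt_closed[OF S c] by simp
    finally show ?thesis .
  qed
  show "v T x = w T x"
    using B x
  proof (induction rule: Q_induct)
    case (pt c s)
    then show ?case by (simp add: val[OF v, simplified] val[OF w, simplified] eq)
  next
    case (add x y)
    then show ?case
      using lin_hom_add[OF dual_carrierD(1)[OF v T]] lin_hom_add[OF dual_carrierD(1)[OF w T]] by simp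
  qed
qed

lemma dual_to_hom_closed:
  assumes S: "S \<in> Calg R" and w: "w \<in> dual_carrier R Q S"
  shows "dual_to_hom S w \<in> carrier (Ob H S)"
  unfolding dual_to_hom_def
proof (rule H_restrictI, rule lin_homI)
  interpret S: cring "fst S" using CalgD(1)[OF S] .
  note self = self_alg_Calg[OF CalgD(1)[OF S]]
  note lin = dual_carrierD(1)[OF w self, unfolded base_alg_self[OF S]]
  note ptl = pt_lin(1)[OF S S.one_closed]
  fix c assume c: "c \<in> carrier C"
  show "w (self_alg (fst S)) (pt S c \<one>\<^bsub>fst S\<^esub>) \<in> carrier (alg_mod S)"
    using lin_hom_closed[OF lin] pt_closed[OF S c] by simp
  show "w (self_alg (fst S)) (pt S (c \<oplus>\<^bsub>C\<^esub> d) \<one>\<^bsub>fst S\<^esub>) =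
      w (self_alg (fst S)) (pt S c \<one>\<^bsub>fst S\<^esub>) \<oplus>\<^bsub>alg_mod S\<^esub> w (self_alg (fst S)) (pt S d \<one>\<^bsub>fst S\<^esub>)"
    if "d \<in> carrier C" for d
    using that c lin_hom_add[OF lin] pt_closed[OF S] by (simp add: lin_hom_add[OF ptl])
  show "w (self_alg (fst S)) (pt S (r \<odot>\<^bsub>C\<^esub> c) \<one>\<^bsub>fst S\<^esub>) =
      r \<odot>\<^bsub>alg_mod S\<^esub> w (self_alg (fst S)) (pt S c \<one>\<^bsub>fst S\<^esub>)" if r: "r \<in> carrier R" for r
  proof -
    have "pt S (r \<odot>\<^bsub>C\<^esub> c) \<one>\<^bsub>fst S\<^esub> = snd S r \<odot>\<^bsub>Ob Q S\<^esub> pt S c \<one>\<^bsub>fst S\<^esub>"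
      using c r pt_closed[OF S c] by (simp add: lin_hom_smult[OF ptl] Q_smult_scalar[OF S r])
    then show ?thesis
      using lin_hom_smult[OF lin, of "snd S r"] CalgD(4)[OF S r] pt_closed[OF S c] by simp
  qed
qed

lemma dual_to_hom_to_dual:
  assumes S: "S \<in> Calg R" and h: "h \<in> carrier (Ob H S)"
  shows "dual_to_hom S (hom_to_dual S h) = h"
proof (rule H_eqI[OF dual_to_hom_closed[OF S hom_to_dual_closed[OF S h]] h])
  interpret S: cring "fst S" using CalgD(1)[OF S] .
  fix c assume c: "c \<in> carrier C"
  show "dual_to_hom S (hom_to_dual S h) c = h c"
    using c hom_to_dual_pt[OF S h self_alg_Calg[OF CalgD(1)[OF S]] c, of "\<one>\<^bsub>fst S\<^esub>"] base_alg_self[OF S]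
      H_D(3)[OF h c] by (simp add: dual_to_hom_def)
qed

lemma hom_to_dual_to_hom:
  assumes S: "S \<in> Calg R" and w: "w \<in> dual_carrier R Q S"
  shows "hom_to_dual S (dual_to_hom S w) = w"
proof (rule dual_Q_eqI[OF S hom_to_dual_closed[OF S dual_to_hom_closed[OF S w]] w])
  fix c assume c: "c \<in> carrier C"
  show "hom_to_dual S (dual_to_hom S w) (self_alg (fst S)) (pt S c \<one>\<^bsub>fst S\<^esub>) =
      w (self_alg (fst S)) (pt S c \<one>\<^bsub>fst S\<^esub>)"
    using fun_cong[OF dual_to_hom_to_dual[OF S dual_to_hom_closed[OF S w]], of c] c
    by (simp add: dual_to_hom_def)
qed

lemma dual_to_hom_morphism: "module_morphism R (dual R Q) H dual_to_hom"
proof (rule module_morphismI)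
  fix S assume S: "S \<in> Calg R"
  interpret S: cring "fst S" using CalgD(1)[OF S] .
  note self = self_alg_Calg[OF CalgD(1)[OF S]] and pt1 = pt_closed[OF S _ S.one_closed]
  show "dual_to_hom S \<in> lin_hom (fst S) (Ob (dual R Q) S) (Ob H S)"
    using dual_to_hom_closed[OF S] pt1 self base_alg_self[OF S]
    by (intro lin_homI) (auto simp: dual_to_hom_def H_simps intro!: restrict_ext)
  fix T f w assume T: "T \<in> Calg R" and f: "f \<in> alg_hom R S T" and "w \<in> carrier (Ob (dual R Q) S)"
  then have w: "w \<in> dual_carrier R Q S" by simp
  note B = alg_hom_base[OF S f T]
  have "compose (carrier (fst S)) (\<lambda>s\<in>carrier (fst T). s) f = f"
    using alg_homD(2,4)[OF f] by (auto simp: compose_def extensional_def fun_eq_iff)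
  moreover have "w (fst T, f) (pt T c \<one>\<^bsub>fst T\<^esub>) = f (w (self_alg (fst S)) (pt S c \<one>\<^bsub>fst S\<^esub>))"
    if c: "c \<in> carrier C" for c
  proof -
    have "f \<in> alg_hom (fst S) (self_alg (fst S)) (fst T, f)"
      using snd_alg_hom_self[OF S.is_cring B(1)] by simp
    then show ?thesis
      using dual_carrierD(2)[OF w self B(1), of f "pt S c \<one>\<^bsub>fst S\<^esub>"] base_alg_self[OF S] B(2) pt1[OF c]
        Q_Ar_pt[OF S T f c S.one_closed] ring_hom_one[OF alg_homD(1)[OF f]] by simp
  qed
  ultimately show "dual_to_hom T (Ar (dual R Q) S T f w) = Ar H S T f (dual_to_hom S w)"
    using self_alg_Calg[OF CalgD(1)[OF T]]
    by (auto simp: dual_to_hom_def H_simps dual_Ar compose_def intro!: restrict_ext)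
qed

text \<open>Linearity and naturality are inherited from the two-sided inverse
  \<open>dual_to_hom\<close>, where they are immediate; \<open>inv\<close> recognises the image
  under \<open>hom_to_dual\<close> by its preimage.\<close>

lemma hom_to_dual_morphism: "module_morphism R H (dual R Q) hom_to_dual"
proof (rule module_morphismI)
  note D = dual_functor[OF R Q_functor]
  interpret D: module_functor R "dual R Q" by (rule D)
  note a = module_morphismD[OF dual_to_hom_morphism]
  have inv: "hom_to_dual S h = w" if "S \<in> Calg R" "w \<in> dual_carrier R Q S" "dual_to_hom S w = h" for S w h
    using hom_to_dual_to_hom[OF that(1,2)] that(3) by simp
  fix S assume S: "S \<in> Calg R"
  interpret DS: module "fst S" "Ob (dual R Q) S" using S by (rule D.module)
  note cl = hom_to_dual_closed[OF S] and rt = dual_to_hom_to_dual[OF S]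
  note lin = a(1)[OF S]
  show "hom_to_dual S \<in> lin_hom (fst S) (Ob H S) (Ob (dual R Q) S)"
  proof (rule lin_homI)
    fix g assume g: "g \<in> carrier (Ob H S)"
    have g': "hom_to_dual S g \<in> carrier (Ob (dual R Q) S)" using cl[OF g] by simp
    then show "hom_to_dual S g \<in> carrier (Ob (dual R Q) S)" .
    show "hom_to_dual S (g \<oplus>\<^bsub>Ob H S\<^esub> h) = hom_to_dual S g \<oplus>\<^bsub>Ob (dual R Q) S\<^esub> hom_to_dual S h"
      if h: "h \<in> carrier (Ob H S)" for h
    proof (rule inv[OF S])
      have h': "hom_to_dual S h \<in> carrier (Ob (dual R Q) S)" using cl[OF h] by simp
      show "hom_to_dual S g \<oplus>\<^bsub>Ob (dual R Q) S\<^esub> hom_to_dual S h \<in> dual_carrier R Q S"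
        using DS.M.a_closed[OF g' h'] by (simp only: dual_Ob_simps(1))
      show "dual_to_hom S (hom_to_dual S g \<oplus>\<^bsub>Ob (dual R Q) S\<^esub> hom_to_dual S h) = g \<oplus>\<^bsub>Ob H S\<^esub> h"
        by (simp only: lin_hom_add[OF lin g' h'] rt[OF g] rt[OF h])
    qed
    show "hom_to_dual S (s \<odot>\<^bsub>Ob H S\<^esub> g) = s \<odot>\<^bsub>Ob (dual R Q) S\<^esub> hom_to_dual S g"
      if s: "s \<in> carrier (fst S)" for s
    proof (rule inv[OF S])
      show "s \<odot>\<^bsub>Ob (dual R Q) S\<^esub> hom_to_dual S g \<in> dual_carrier R Q S"
        using DS.smult_closed[OF s g'] by (simp only: dual_Ob_simps(1))
      show "dual_to_hom S (s \<odot>\<^bsub>Ob (dual R Q) S\<^esub> hom_to_dual S g) = s \<odot>\<^bsub>Ob H S\<^esub> g"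
        by (simp only: lin_hom_smult[OF lin s g'] rt[OF g])
    qed
  qed
  fix T f h assume T: "T \<in> Calg R" and f: "f \<in> alg_hom R S T" and h: "h \<in> carrier (Ob H S)"
  have h': "hom_to_dual S h \<in> carrier (Ob (dual R Q) S)" using cl[OF h] by simp
  show "hom_to_dual T (Ar H S T f h) = Ar (dual R Q) S T f (hom_to_dual S h)"
  proof (rule inv[OF T])
    show "Ar (dual R Q) S T f (hom_to_dual S h) \<in> dual_carrier R Q T"
      using D.map_closed[OF S T f h'] by simp
    show "dual_to_hom T (Ar (dual R Q) S T f (hom_to_dual S h)) = Ar H S T f h"
      by (simp only: a(2)[OF S T f h'] rt[OF h])
  qed
qed

lemma dual_Q_algebra_iff: "is_algebra_functor R (dual R Q) \<longleftrightarrow> (\<exists>\<mu> e. alg_structure R H \<mu> e)"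
  unfolding is_algebra_functor_iff[OF dual_functor[OF R Q_functor]]
proof
  assume "\<exists>\<mu> e. alg_structure R (dual R Q) \<mu> e"
  then obtain \<mu> e where "alg_structure R (dual R Q) \<mu> e" by blast
  from alg_structure_transfer[OF dual_to_hom_morphism hom_to_dual_morphism _ _ this]
  show "\<exists>\<mu> e. alg_structure R H \<mu> e"
    using hom_to_dual_to_hom dual_to_hom_to_dual by auto
next
  assume "\<exists>\<mu> e. alg_structure R H \<mu> e"
  then obtain \<mu> e where "alg_structure R H \<mu> e" by blast
  from alg_structure_transfer[OF hom_to_dual_morphism dual_to_hom_morphism _ _ this]
  show "\<exists>\<mu> e. alg_structure R (dual R Q) \<mu> e"
    using hom_to_dual_to_hom dual_to_hom_to_dual by auto
qed

end

section \<open>The convolution algebra of a coalgebra\<close>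

text \<open>The multiplication of S after f \<otimes> g. The domains are arbitrary modules so that
  the construction can be iterated on triple tensor products.\<close>

definition tensor_mult ::
    "'u ring \<Rightarrow> 'u alg \<Rightarrow> ('m \<Rightarrow> 'u) \<Rightarrow> ('n \<Rightarrow> 'u) \<Rightarrow> ('m \<times> 'n \<Rightarrow> 'u) set \<Rightarrow> 'u" where
  "tensor_mult R S f g =
     tensor_lift R (restrict_scalars (snd S) (ring_as_module (fst S))) (\<lambda>x y. f x \<otimes>\<^bsub>fst S\<^esub> g y)"

context quasi_coherent_setup
begin

lemma
  assumes "S \<in> Calg R" "module R M" "module R N"
    and "f \<in> lin_hom R M (alg_mod S)" "g \<in> lin_hom R N (alg_mod S)"
  shows tensor_mult_lin: "tensor_mult R S f g \<in> lin_hom R (tensor R M N) (alg_mod S)"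
    and tensor_mult_pure: "\<lbrakk>x \<in> carrier M; y \<in> carrier N\<rbrakk> \<Longrightarrow>
      tensor_mult R S f g (pure_tensor R M N x y) = f x \<otimes>\<^bsub>fst S\<^esub> g y"
  unfolding tensor_mult_def using alg_bilin[OF assms(1,4,5)]
  by (auto intro: tensor_lift_lin[OF assms(2,3) module_alg_mod[OF assms(1)]]
      tensor_lift_pure[OF assms(2,3) module_alg_mod[OF assms(1)]])

text \<open>Mediates between a linear map and its extensional restriction, since convolution
  products and elements of \<open>H\<close> are cut down to the carrier of C.\<close>

lemma tensor_mult_cong:
  assumes S: "S \<in> Calg R" and M: "module R M" and N: "module R N"
    and f: "f \<in> lin_hom R M (alg_mod S)" and g: "g \<in> lin_hom R N (alg_mod S)"
    and f': "\<And>x. x \<in> carrier M \<Longrightarrow> f' x = f x" and g': "\<And>y. y \<in> carrier N \<Longrightarrow> g' y = g y"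
    and t: "t \<in> carrier (tensor R M N)"
  shows "tensor_mult R S f' g' t = tensor_mult R S f g t"
proof -
  have f'l: "f' \<in> lin_hom R M (alg_mod S)" by (rule lin_hom_cong[OF M f]) (simp add: f')
  have g'l: "g' \<in> lin_hom R N (alg_mod S)" by (rule lin_hom_cong[OF N g]) (simp add: g')
  show ?thesis
    by (rule tensor_hom_ext[OF M N tensor_mult_lin[OF S M N f'l g'l] tensor_mult_lin[OF S M N f g] _ t])
       (simp add: tensor_mult_pure[OF S M N] f g f'l g'l f' g')
qed

lemma tensor_mult_alg_hom:
  assumes S: "S \<in> Calg R" and T: "T \<in> Calg R" and \<phi>: "\<phi> \<in> alg_hom R S T"
    and M: "module R M" and N: "module R N"
    and f: "f \<in> lin_hom R M (alg_mod S)" and g: "g \<in> lin_hom R N (alg_mod S)"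
    and t: "t \<in> carrier (tensor R M N)"
  shows "\<phi> (tensor_mult R S f g t) = tensor_mult R T (\<lambda>x. \<phi> (f x)) (\<lambda>y. \<phi> (g y)) t"
proof -
  note \<phi>l = alg_hom_lin[OF S \<phi>]
  note f' = lin_hom_comp[OF \<phi>l f] and g' = lin_hom_comp[OF \<phi>l g]
  show ?thesis
  proof (rule tensor_hom_ext[OF M N lin_hom_comp[OF \<phi>l tensor_mult_lin[OF S M N f g]]
        tensor_mult_lin[OF T M N f' g'] _ t])
    fix x y assume xy: "x \<in> carrier M" "y \<in> carrier N"
    then show "\<phi> (tensor_mult R S f g (pure_tensor R M N x y)) =
        tensor_mult R T (\<lambda>x. \<phi> (f x)) (\<lambda>y. \<phi> (g y)) (pure_tensor R M N x y)"
      using lin_hom_closed[OF f xy(1)] lin_hom_closed[OF g xy(2)]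
      by (simp add: tensor_mult_pure[OF S M N f g] tensor_mult_pure[OF T M N f' g']
          ring_hom_mult[OF alg_homD(1)[OF \<phi>]])
  qed
qed

lemma tensor_mult_tensor_hom:
  assumes S: "S \<in> Calg R" and mods: "module R M" "module R N" "module R M'" "module R N'"
    and f: "f \<in> lin_hom R M' (alg_mod S)" and g: "g \<in> lin_hom R N' (alg_mod S)"
    and h: "h \<in> lin_hom R M M'" and k: "k \<in> lin_hom R N N'"
    and t: "t \<in> carrier (tensor R M N)"
  shows "tensor_mult R S f g (tensor_hom R M' N' h k t) = tensor_mult R S (\<lambda>x. f (h x)) (\<lambda>y. g (k y)) t"
proof -
  note fh = lin_hom_comp[OF f h] and gk = lin_hom_comp[OF g k]
  show ?thesis
    by (rule tensor_hom_ext[OF mods(1,2) lin_hom_comp[OF tensor_mult_lin[OF S mods(3,4) f g]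
          tensor_hom_lin[OF mods h k]] tensor_mult_lin[OF S mods(1,2) fh gk] _ t])
       (simp add: tensor_hom_pure[OF mods h k] tensor_mult_pure[OF S mods(3,4) f g]
          tensor_mult_pure[OF S mods(1,2) fh gk] lin_hom_closed[OF h] lin_hom_closed[OF k])
qed

lemma tensor_mult_assoc:
  assumes S: "S \<in> Calg R" and mods: "module R M" "module R N" "module R P"
    and f: "f \<in> lin_hom R M (alg_mod S)" and g: "g \<in> lin_hom R N (alg_mod S)"
    and h: "h \<in> lin_hom R P (alg_mod S)"
    and t: "t \<in> carrier (tensor R (tensor R M N) P)"
  shows "tensor_mult R S (tensor_mult R S f g) h t =
    tensor_mult R S f (tensor_mult R S g h) (tensor_assoc R M N P t)"
proof -
  interpret S: cring "fst S" using CalgD(1)[OF S] .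
  note MN = module_tensor[OF mods(1,2)] and NP = module_tensor[OF mods(2,3)]
  note fg = tensor_mult_lin[OF S mods(1,2) f g] and gh = tensor_mult_lin[OF S mods(2,3) g h]
  show ?thesis
  proof (rule tensor_hom_ext3[OF mods tensor_mult_lin[OF S MN mods(3) fg h]
        lin_hom_comp[OF tensor_mult_lin[OF S mods(1) NP f gh] tensor_assoc_lin[OF mods]] _ t])
    fix x y z assume xyz: "x \<in> carrier M" "y \<in> carrier N" "z \<in> carrier P"
    show "tensor_mult R S (tensor_mult R S f g) h
          (pure_tensor R (tensor R M N) P (pure_tensor R M N x y) z) =
        tensor_mult R S f (tensor_mult R S g h)
          (tensor_assoc R M N P (pure_tensor R (tensor R M N) P (pure_tensor R M N x y) z))"
      using xyz lin_hom_closed[OF f xyz(1)] lin_hom_closed[OF g xyz(2)] lin_hom_closed[OF h xyz(3)]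
        pure_tensor_closed[OF mods(1,2)] pure_tensor_closed[OF mods(2,3)]
      by (simp add: tensor_assoc_pure[OF mods] tensor_mult_pure[OF S MN mods(3) fg h]
          tensor_mult_pure[OF S mods(1) NP f gh] tensor_mult_pure[OF S mods(1,2) f g]
          tensor_mult_pure[OF S mods(2,3) g h] S.m_assoc)
  qed
qed

lemma snd_lin: "S \<in> Calg R \<Longrightarrow> snd S \<in> lin_hom R (ring_as_module R) (alg_mod S)"
  using CalgD(2,4)[of S R] by (intro lin_homI) (simp_all add: ring_hom_add ring_hom_mult)

section \<open>Convolution products\<close>

definition conv :: "('c \<Rightarrow> ('c \<times> 'c \<Rightarrow> 'u) set) \<Rightarrow> 'u alg \<Rightarrow> ('c \<Rightarrow> 'u) \<Rightarrow> ('c \<Rightarrow> 'u) \<Rightarrow> 'c \<Rightarrow> 'u" where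
  "conv \<Delta> S f g = (\<lambda>c\<in>carrier C. tensor_mult R S f g (\<Delta> c))"

context
  fixes \<Delta>
  assumes \<Delta>: "\<Delta> \<in> lin_hom R C (tensor R C C)"
begin

lemma conv_closed:
  assumes "S \<in> Calg R" "f \<in> carrier (Ob H S)" "g \<in> carrier (Ob H S)"
  shows "conv \<Delta> S f g \<in> carrier (Ob H S)"
  unfolding conv_def
  by (rule H_restrictI[OF lin_hom_comp[OF tensor_mult_lin[OF assms(1) C C H_D(1)[OF assms(2)] H_D(1)[OF assms(3)]] \<Delta>]])

text \<open>Together with \<open>conv_right\<close> this expresses the two bracketings of a
  threefold convolution by one and the same map, f times (g times h) on C \<otimes> (C \<otimes> C),
  applied to the two sides of coassociativity.\<close>

lemma conv_left:
  assumes S: "S \<in> Calg R" and f: "f \<in> carrier (Ob H S)" and g: "g \<in> carrier (Ob H S)"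
    and h: "h \<in> carrier (Ob H S)" and t: "t \<in> carrier (tensor R C C)"
  shows "tensor_mult R S (conv \<Delta> S f g) h t =
    tensor_mult R S f (tensor_mult R S g h)
      (tensor_assoc R C C C (tensor_hom R (tensor R C C) C \<Delta> (\<lambda>x. x) t))"
proof -
  note T = module_tensor[OF C C]
  note fl = H_D(1)[OF f] and gl = H_D(1)[OF g] and hl = H_D(1)[OF h]
  note fg = tensor_mult_lin[OF S C C fl gl]
  have "tensor_mult R S (conv \<Delta> S f g) h t = tensor_mult R S (\<lambda>x. tensor_mult R S f g (\<Delta> x)) h t"
    by (rule tensor_mult_cong[OF S C C lin_hom_comp[OF fg \<Delta>] hl _ _ t]) (simp_all add: conv_def)
  also have "\<dots> = tensor_mult R S (tensor_mult R S f g) h (tensor_hom R (tensor R C C) C \<Delta> (\<lambda>x. x) t)"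
    by (rule tensor_mult_tensor_hom[OF S C C T C fg hl \<Delta> lin_hom_id t, symmetric])
  also have "\<dots> = tensor_mult R S f (tensor_mult R S g h)
      (tensor_assoc R C C C (tensor_hom R (tensor R C C) C \<Delta> (\<lambda>x. x) t))"
    by (rule tensor_mult_assoc[OF S C C C fl gl hl lin_hom_closed[OF tensor_hom_lin[OF C C T C \<Delta> lin_hom_id] t]])
  finally show ?thesis .
qed

lemma conv_right:
  assumes S: "S \<in> Calg R" and f: "f \<in> carrier (Ob H S)" and g: "g \<in> carrier (Ob H S)"
    and h: "h \<in> carrier (Ob H S)" and t: "t \<in> carrier (tensor R C C)"
  shows "tensor_mult R S f (conv \<Delta> S g h) t =
    tensor_mult R S f (tensor_mult R S g h) (tensor_hom R C (tensor R C C) (\<lambda>x. x) \<Delta> t)"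
proof -
  note T = module_tensor[OF C C]
  note fl = H_D(1)[OF f] and gl = H_D(1)[OF g] and hl = H_D(1)[OF h]
  note gh = tensor_mult_lin[OF S C C gl hl]
  have "tensor_mult R S f (conv \<Delta> S g h) t = tensor_mult R S f (\<lambda>x. tensor_mult R S g h (\<Delta> x)) t"
    by (rule tensor_mult_cong[OF S C C fl lin_hom_comp[OF gh \<Delta>] _ _ t]) (simp_all add: conv_def)
  also have "\<dots> = tensor_mult R S f (tensor_mult R S g h) (tensor_hom R C (tensor R C C) (\<lambda>x. x) \<Delta> t)"
    by (rule tensor_mult_tensor_hom[OF S C C C T fl gh lin_hom_id \<Delta> t, symmetric])
  finally show ?thesis .
qed

text \<open>The laws are proved for \<open>tensor_mult\<close> at an arbitrary tensor, where pure
  tensors suffice, and only then specialised to \<Delta>(c).\<close>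

lemma conv_bilin:
  assumes S: "S \<in> Calg R"
  shows "conv \<Delta> S \<in> bilin (fst S) (Ob H S) (Ob H S) (Ob H S)"
proof -
  interpret S: cring "fst S" using CalgD(1)[OF S] .
  let ?T = "tensor R C C"
  note lin = tensor_mult_lin[OF S C C] and pure = tensor_mult_pure[OF S C C]
  have tc: "tensor_mult R S f g t \<in> carrier (fst S)"
    if "f \<in> lin_hom R C (alg_mod S)" "g \<in> lin_hom R C (alg_mod S)" "t \<in> carrier ?T" for f g t
    using lin_hom_closed[OF lin[OF that(1,2)] that(3)] by simp
  have addc: "f \<oplus>\<^bsub>Ob H S\<^esub> g \<in> carrier (Ob H S)"
    if f: "f \<in> carrier (Ob H S)" and g: "g \<in> carrier (Ob H S)" for f g
    using H_restrictI[OF lin_hom_sum[OF module_alg_mod[OF S] H_D(1)[OF f] H_D(1)[OF g]]]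
    by (simp add: H_simps)
  have smultc: "s \<odot>\<^bsub>Ob H S\<^esub> f \<in> carrier (Ob H S)"
    if s: "s \<in> carrier (fst S)" and f: "f \<in> carrier (Ob H S)" for s f
    using H_restrictI[OF lin_hom_comp[OF mult_lin[OF S s] H_D(1)[OF f]]] by (simp add: H_simps)
  have val3: "(f \<oplus>\<^bsub>Ob H S\<^esub> g) c = f c \<oplus>\<^bsub>fst S\<^esub> g c" and val4: "(s \<odot>\<^bsub>Ob H S\<^esub> f) c = s \<otimes>\<^bsub>fst S\<^esub> f c"
    if "c \<in> carrier C" for f g s c
    using that by (simp_all add: H_simps)
  have \<Delta>c: "\<Delta> c \<in> carrier ?T" if "c \<in> carrier C" for c using lin_hom_closed[OF \<Delta> that] .
  show ?thesis
  proof (intro bilinI lin_homI conv_closed[OF S])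
    fix f g h assume f: "f \<in> carrier (Ob H S)" and g: "g \<in> carrier (Ob H S)" and h: "h \<in> carrier (Ob H S)"
    note fl = H_D(1)[OF f] and gl = H_D(1)[OF g] and hl = H_D(1)[OF h]
    have "tensor_mult R S f (g \<oplus>\<^bsub>Ob H S\<^esub> h) t = tensor_mult R S f g t \<oplus>\<^bsub>fst S\<^esub> tensor_mult R S f h t \<and>
        tensor_mult R S (g \<oplus>\<^bsub>Ob H S\<^esub> h) f t = tensor_mult R S g f t \<oplus>\<^bsub>fst S\<^esub> tensor_mult R S h f t"
      if t: "t \<in> carrier ?T" for t
    proof (intro conjI)
      note ghl = H_D(1)[OF addc[OF g h]]
      note s1 = lin_hom_sum[OF module_alg_mod[OF S] lin[OF fl gl] lin[OF fl hl]]
        and s2 = lin_hom_sum[OF module_alg_mod[OF S] lin[OF gl fl] lin[OF hl fl]]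
      show "tensor_mult R S f (g \<oplus>\<^bsub>Ob H S\<^esub> h) t = tensor_mult R S f g t \<oplus>\<^bsub>fst S\<^esub> tensor_mult R S f h t"
        by (rule tensor_hom_ext[OF C C lin[OF fl ghl] s1[simplified] _ t])
           (simp add: pure fl gl hl ghl val3 H_D(3)[OF f] H_D(3)[OF g] H_D(3)[OF h] S.r_distr
             del: restrict_scalars_simps)
      show "tensor_mult R S (g \<oplus>\<^bsub>Ob H S\<^esub> h) f t = tensor_mult R S g f t \<oplus>\<^bsub>fst S\<^esub> tensor_mult R S h f t"
        by (rule tensor_hom_ext[OF C C lin[OF ghl fl] s2[simplified] _ t])
           (simp add: pure fl gl hl ghl val3 H_D(3)[OF f] H_D(3)[OF g] H_D(3)[OF h] S.l_distr
             del: restrict_scalars_simps)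
    qed
    then show "conv \<Delta> S f (g \<oplus>\<^bsub>Ob H S\<^esub> h) = conv \<Delta> S f g \<oplus>\<^bsub>Ob H S\<^esub> conv \<Delta> S f h"
      "conv \<Delta> S (g \<oplus>\<^bsub>Ob H S\<^esub> h) f = conv \<Delta> S g f \<oplus>\<^bsub>Ob H S\<^esub> conv \<Delta> S h f"
      using \<Delta>c by (auto simp: conv_def H_simps(3)[where g = "restrict _ _"] intro!: restrict_ext)
  next
    fix s f g assume s: "s \<in> carrier (fst S)" and f: "f \<in> carrier (Ob H S)" and g: "g \<in> carrier (Ob H S)"
    note fl = H_D(1)[OF f] and gl = H_D(1)[OF g]
    have "tensor_mult R S f (s \<odot>\<^bsub>Ob H S\<^esub> g) t = s \<otimes>\<^bsub>fst S\<^esub> tensor_mult R S f g t \<and>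
        tensor_mult R S (s \<odot>\<^bsub>Ob H S\<^esub> g) f t = s \<otimes>\<^bsub>fst S\<^esub> tensor_mult R S g f t"
      if t: "t \<in> carrier ?T" for t
    proof (intro conjI)
      note sgl = H_D(1)[OF smultc[OF s g]]
      note s1 = lin_hom_comp[OF mult_lin[OF S s] lin[OF fl gl]]
        and s2 = lin_hom_comp[OF mult_lin[OF S s] lin[OF gl fl]]
      show "tensor_mult R S f (s \<odot>\<^bsub>Ob H S\<^esub> g) t = s \<otimes>\<^bsub>fst S\<^esub> tensor_mult R S f g t"
        by (rule tensor_hom_ext[OF C C lin[OF fl sgl] s1 _ t])
           (simp add: pure fl gl sgl val4 H_D(3)[OF f] H_D(3)[OF g] s S.m_lcomm
             del: restrict_scalars_simps)
      show "tensor_mult R S (s \<odot>\<^bsub>Ob H S\<^esub> g) f t = s \<otimes>\<^bsub>fst S\<^esub> tensor_mult R S g f t"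
        by (rule tensor_hom_ext[OF C C lin[OF sgl fl] s2 _ t])
           (simp add: pure fl gl sgl val4 H_D(3)[OF f] H_D(3)[OF g] s S.m_assoc
             del: restrict_scalars_simps)
    qed
    then show "conv \<Delta> S f (s \<odot>\<^bsub>Ob H S\<^esub> g) = s \<odot>\<^bsub>Ob H S\<^esub> conv \<Delta> S f g"
      "conv \<Delta> S (s \<odot>\<^bsub>Ob H S\<^esub> g) f = s \<odot>\<^bsub>Ob H S\<^esub> conv \<Delta> S g f"
      using \<Delta>c by (auto simp: conv_def H_simps(4)[where g = "restrict _ _"] intro!: restrict_ext)
  qed
qed

lemma conv_natural:
  assumes "S \<in> Calg R" "T \<in> Calg R" "\<phi> \<in> alg_hom R S T" "f \<in> carrier (Ob H S)" "g \<in> carrier (Ob H S)"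
  shows "Ar H S T \<phi> (conv \<Delta> S f g) = conv \<Delta> T (Ar H S T \<phi> f) (Ar H S T \<phi> g)"
  unfolding H_simps conv_def compose_def
proof (rule restrict_ext)
  fix c assume c: "c \<in> carrier C"
  note fl = H_D(1)[OF assms(4)] and gl = H_D(1)[OF assms(5)]
  note \<Delta>c = lin_hom_closed[OF \<Delta> c] and \<phi>l = alg_hom_lin[OF assms(1,3)]
  have "tensor_mult R T (\<lambda>x\<in>carrier C. \<phi> (f x)) (\<lambda>x\<in>carrier C. \<phi> (g x)) (\<Delta> c) =
      tensor_mult R T (\<lambda>x. \<phi> (f x)) (\<lambda>x. \<phi> (g x)) (\<Delta> c)"
    by (rule tensor_mult_cong[OF assms(2) C C lin_hom_comp[OF \<phi>l fl] lin_hom_comp[OF \<phi>l gl] _ _ \<Delta>c]) simp_all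
  then show "\<phi> ((\<lambda>c\<in>carrier C. tensor_mult R S f g (\<Delta> c)) c) =
      tensor_mult R T (\<lambda>x\<in>carrier C. \<phi> (f x)) (\<lambda>x\<in>carrier C. \<phi> (g x)) (\<Delta> c)"
    using tensor_mult_alg_hom[OF assms(1-3) C C fl gl \<Delta>c] c by simp
qed

end

lemma coalgebra_imp_H_algebra:
  assumes "is_coalgebra R C"
  shows "\<exists>\<mu> e. alg_structure R H \<mu> e"
proof -
  from assms obtain \<Delta> \<epsilon> where \<Delta>: "\<Delta> \<in> lin_hom R C (tensor R C C)"
    and \<epsilon>: "\<epsilon> \<in> lin_hom R C (ring_as_module R)"
    and coassoc: "\<And>c. c \<in> carrier C \<Longrightarrow>
      tensor_assoc R C C C (tensor_hom R (tensor R C C) C \<Delta> (\<lambda>x. x) (\<Delta> c)) =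
      tensor_hom R C (tensor R C C) (\<lambda>x. x) \<Delta> (\<Delta> c)"
    and counit_l: "\<And>c. c \<in> carrier C \<Longrightarrow> tensor_hom R (ring_as_module R) C \<epsilon> (\<lambda>x. x) (\<Delta> c) =
      pure_tensor R (ring_as_module R) C \<one>\<^bsub>R\<^esub> c"
    and counit_r: "\<And>c. c \<in> carrier C \<Longrightarrow> tensor_hom R C (ring_as_module R) (\<lambda>x. x) \<epsilon> (\<Delta> c) =
      pure_tensor R C (ring_as_module R) c \<one>\<^bsub>R\<^esub>"
    unfolding is_coalgebra_def by blast
  define e where "e S = (\<lambda>c\<in>carrier C. snd S (\<epsilon> c))" for S :: "'u alg"
  note modR = module_ring[OF R]
  have "alg_structure R H (conv \<Delta>) e"
    unfolding alg_structure_def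
  proof (intro conjI ballI)
    fix S assume S: "S \<in> Calg R"
    interpret S: cring "fst S" using CalgD(1)[OF S] .
    show "conv \<Delta> S \<in> bilin (fst S) (Ob H S) (Ob H S) (Ob H S)" by (rule conv_bilin[OF \<Delta> S])
    note \<epsilon>l = lin_hom_comp[OF snd_lin[OF S] \<epsilon>]
    show "e S \<in> carrier (Ob H S)" unfolding e_def by (rule H_restrictI[OF \<epsilon>l])
    fix f assume f: "f \<in> carrier (Ob H S)"
    note fl = H_D(1)[OF f]
    have unit: "conv \<Delta> S (e S) f c = f c" "conv \<Delta> S f (e S) c = f c" if c: "c \<in> carrier C" for c
    proof -
      note \<Delta>c = lin_hom_closed[OF \<Delta> c]
      have "tensor_mult R S (e S) f (\<Delta> c) = tensor_mult R S (\<lambda>c. snd S (\<epsilon> c)) f (\<Delta> c)"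
        by (rule tensor_mult_cong[OF S C C \<epsilon>l fl _ _ \<Delta>c]) (simp_all add: e_def)
      \<comment> \<open>The counit law replaces (\<epsilon> \<otimes> id)(\<Delta>(c)) by 1
        \<otimes> c, on which the product of \<open>snd S\<close> and f has the value f(c).\<close>
      also have "\<dots> = f c"
        using tensor_mult_tensor_hom[OF S C C modR C snd_lin[OF S] fl \<epsilon> lin_hom_id \<Delta>c, symmetric]
          tensor_mult_pure[OF S modR C snd_lin[OF S] fl _ c, of "\<one>\<^bsub>R\<^esub>"] counit_l[OF c] H_D(3)[OF f c]
        by (simp add: ring_hom_one[OF CalgD(2)[OF S]])
      finally show "conv \<Delta> S (e S) f c = f c" using c by (simp add: conv_def)
      have "tensor_mult R S f (e S) (\<Delta> c) = tensor_mult R S f (\<lambda>c. snd S (\<epsilon> c)) (\<Delta> c)"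
        by (rule tensor_mult_cong[OF S C C fl \<epsilon>l _ _ \<Delta>c]) (simp_all add: e_def)
      also have "\<dots> = f c"
        using tensor_mult_tensor_hom[OF S C C C modR fl snd_lin[OF S] lin_hom_id \<epsilon> \<Delta>c, symmetric]
          tensor_mult_pure[OF S C modR fl snd_lin[OF S] c, of "\<one>\<^bsub>R\<^esub>"] counit_r[OF c] H_D(3)[OF f c]
        by (simp add: ring_hom_one[OF CalgD(2)[OF S]])
      finally show "conv \<Delta> S f (e S) c = f c" using c by (simp add: conv_def)
    qed
    note eS = \<open>e S \<in> carrier (Ob H S)\<close>
    show "conv \<Delta> S (e S) f = f" by (rule H_eqI[OF conv_closed[OF \<Delta> S eS f] f unit(1)])
    show "conv \<Delta> S f (e S) = f" by (rule H_eqI[OF conv_closed[OF \<Delta> S f eS] f unit(2)])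
    fix g h assume g: "g \<in> carrier (Ob H S)" and h: "h \<in> carrier (Ob H S)"
    show "conv \<Delta> S (conv \<Delta> S f g) h = conv \<Delta> S f (conv \<Delta> S g h)"
    proof (rule H_eqI[OF conv_closed[OF \<Delta> S conv_closed[OF \<Delta> S f g] h]
          conv_closed[OF \<Delta> S f conv_closed[OF \<Delta> S g h]]])
      fix c assume c: "c \<in> carrier C"
      note \<Delta>c = lin_hom_closed[OF \<Delta> c]
      show "conv \<Delta> S (conv \<Delta> S f g) h c = conv \<Delta> S f (conv \<Delta> S g h) c"
        using conv_left[OF \<Delta> S f g h \<Delta>c] conv_right[OF \<Delta> S f g h \<Delta>c] coassoc[OF c] c
        by (simp add: conv_def[of \<Delta> S "conv \<Delta> S f g" h] conv_def[of \<Delta> S f "conv \<Delta> S g h"])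
    qed
  next
    fix S T \<phi> assume S: "S \<in> Calg R" and T: "T \<in> Calg R" and \<phi>: "\<phi> \<in> alg_hom R S T"
    have "\<phi> (snd S (\<epsilon> c)) = snd T (\<epsilon> c)" if c: "c \<in> carrier C" for c
      using alg_homD(3)[OF \<phi>] lin_hom_closed[OF \<epsilon> c, simplified] by (metis compose_eq)
    then show "Ar H S T \<phi> (e S) = e T"
      by (auto simp: e_def H_simps compose_def intro!: restrict_ext)
    show "Ar H S T \<phi> (conv \<Delta> S f g) = conv \<Delta> T (Ar H S T \<phi> f) (Ar H S T \<phi> g)"
      if "f \<in> carrier (Ob H S)" "g \<in> carrier (Ob H S)" for f g
      by (rule conv_natural[OF \<Delta> S T \<phi> that])
  qed
  then show ?thesis by blast
qed

end

section \<open>Trivial square-zero extensions\<close>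

text \<open>The algebra S + N with N N = 0, described by coordinates: \<open>t s n\<close> codes the
  element s + n. It is axiomatised rather than fixed as a set of pairs because its elements must
  belong to the universe \<open>'u\<close>.\<close>

locale trivial_extension =
  fixes R :: "'u ring" and S :: "'u alg" and N :: "('u, 'n) module" and E :: "'u alg"
    and t :: "'u \<Rightarrow> 'n \<Rightarrow> 'u"
  assumes S_Calg: "S \<in> Calg R" and N_module: "module (fst S) N" and E_Calg: "E \<in> Calg R"
    and inj: "inj_on (case_prod t) (carrier (fst S) \<times> carrier N)"
    and carrier: "carrier (fst E) = case_prod t ` (carrier (fst S) \<times> carrier N)"
    and add: "\<lbrakk>s \<in> carrier (fst S); n \<in> carrier N; s' \<in> carrier (fst S); n' \<in> carrier N\<rbrakk> \<Longrightarrow>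
      t s n \<oplus>\<^bsub>fst E\<^esub> t s' n' = t (s \<oplus>\<^bsub>fst S\<^esub> s') (n \<oplus>\<^bsub>N\<^esub> n')"
    and mult: "\<lbrakk>s \<in> carrier (fst S); n \<in> carrier N; s' \<in> carrier (fst S); n' \<in> carrier N\<rbrakk> \<Longrightarrow>
      t s n \<otimes>\<^bsub>fst E\<^esub> t s' n' = t (s \<otimes>\<^bsub>fst S\<^esub> s') (s \<odot>\<^bsub>N\<^esub> n' \<oplus>\<^bsub>N\<^esub> s' \<odot>\<^bsub>N\<^esub> n)"
    and one: "\<one>\<^bsub>fst E\<^esub> = t \<one>\<^bsub>fst S\<^esub> \<zero>\<^bsub>N\<^esub>"
    and zero: "\<zero>\<^bsub>fst E\<^esub> = t \<zero>\<^bsub>fst S\<^esub> \<zero>\<^bsub>N\<^esub>"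
    and scalar: "r \<in> carrier R \<Longrightarrow> snd E r = t (snd S r) \<zero>\<^bsub>N\<^esub>"
begin

sublocale S: cring "fst S" using CalgD(1)[OF S_Calg] .
sublocale N: module "fst S" N by (rule N_module)
sublocale E: cring "fst E" using CalgD(1)[OF E_Calg] .

definition proj_base :: "'u \<Rightarrow> 'u" where
  "proj_base x = fst (inv_into (carrier (fst S) \<times> carrier N) (case_prod t) x)"

definition proj_module :: "'u \<Rightarrow> 'n" where
  "proj_module x = snd (inv_into (carrier (fst S) \<times> carrier N) (case_prod t) x)"

lemma proj_simps [simp]:
  assumes "s \<in> carrier (fst S)" "n \<in> carrier N"
  shows "proj_base (t s n) = s" "proj_module (t s n) = n"
  using inv_into_f_f[OF inj, of "(s, n)"] assms by (simp_all add: proj_base_def proj_module_def)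

lemma t_closed [simp]: "\<lbrakk>s \<in> carrier (fst S); n \<in> carrier N\<rbrakk> \<Longrightarrow> t s n \<in> carrier (fst E)"
  by (auto simp: carrier)

lemma t_cases:
  assumes "x \<in> carrier (fst E)"
  obtains s n where "s \<in> carrier (fst S)" "n \<in> carrier N" "x = t s n"
  using assms by (auto simp: carrier)

lemma proj_closed [simp]:
  assumes "x \<in> carrier (fst E)"
  shows "proj_base x \<in> carrier (fst S)" "proj_module x \<in> carrier N" "t (proj_base x) (proj_module x) = x"
  using assms by (auto elim: t_cases)

definition incl :: "'u \<Rightarrow> 'u" where "incl = (\<lambda>s\<in>carrier (fst S). t s \<zero>\<^bsub>N\<^esub>)"

lemma incl_alg_hom: "incl \<in> alg_hom R S E"
proof -
  have "(\<lambda>s. t s \<zero>\<^bsub>N\<^esub>) \<in> ring_hom (fst S) (fst E)"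
    by (rule ring_hom_memI) (simp_all add: add mult one)
  then have "incl \<in> ring_hom (fst S) (fst E)"
    unfolding incl_def by (rule ring_hom_cong[OF S.ring_axioms]) simp
  moreover have "compose (carrier R) incl (snd S) = snd E"
    using CalgD(4)[OF S_Calg] CalgD(3)[OF E_Calg]
    by (auto simp: compose_def fun_eq_iff incl_def scalar extensional_def)
  ultimately show ?thesis
    by (simp add: alg_hom_def incl_def)
qed

lemma proj_base_alg_hom: "(\<lambda>x\<in>carrier (fst E). proj_base x) \<in> alg_hom R E S"
proof -
  have "proj_base \<in> ring_hom (fst E) (fst S)"
    by (rule ring_hom_memI) (auto elim!: t_cases simp: add mult one)
  then have "(\<lambda>x\<in>carrier (fst E). proj_base x) \<in> ring_hom (fst E) (fst S)"
    by (rule ring_hom_cong[OF E.ring_axioms]) simp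
  moreover have "compose (carrier R) (\<lambda>x\<in>carrier (fst E). proj_base x) (snd E) = snd S"
    using CalgD(3,4)[OF S_Calg]
    by (auto simp: compose_def fun_eq_iff scalar extensional_def)
  ultimately show ?thesis
    by (simp add: alg_hom_def)
qed

definition lift :: "'u alg \<Rightarrow> ('u \<Rightarrow> 'u) \<Rightarrow> ('n \<Rightarrow> 'u) \<Rightarrow> 'u \<Rightarrow> 'u" where
  "lift U \<phi> \<psi> = (\<lambda>x\<in>carrier (fst E). \<phi> (proj_base x) \<oplus>\<^bsub>fst U\<^esub> \<psi> (proj_module x))"

lemma lift_t: "\<lbrakk>s \<in> carrier (fst S); n \<in> carrier N\<rbrakk> \<Longrightarrow> lift U \<phi> \<psi> (t s n) = \<phi> s \<oplus>\<^bsub>fst U\<^esub> \<psi> n"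
  by (simp add: lift_def)

text \<open>The universal property of the extension. In the product of \<phi>(s) + \<psi>(n) and
  \<phi>(s') + \<psi>(n') the cross terms match the module part of the product in E by semilinearity
  of \<psi>, and the term \<psi>(n) \<psi>(n') vanishes.\<close>

lemma lift_alg_hom:
  assumes U: "U \<in> Calg R" and \<phi>: "\<phi> \<in> alg_hom R S U"
    and closed: "\<And>n. n \<in> carrier N \<Longrightarrow> \<psi> n \<in> carrier (fst U)"
    and \<psi>_add: "\<And>n n'. \<lbrakk>n \<in> carrier N; n' \<in> carrier N\<rbrakk> \<Longrightarrow> \<psi> (n \<oplus>\<^bsub>N\<^esub> n') = \<psi> n \<oplus>\<^bsub>fst U\<^esub> \<psi> n'"
    and smult: "\<And>s n. \<lbrakk>s \<in> carrier (fst S); n \<in> carrier N\<rbrakk> \<Longrightarrow> \<psi> (s \<odot>\<^bsub>N\<^esub> n) = \<phi> s \<otimes>\<^bsub>fst U\<^esub> \<psi> n"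
    and square: "\<And>n n'. \<lbrakk>n \<in> carrier N; n' \<in> carrier N\<rbrakk> \<Longrightarrow> \<psi> n \<otimes>\<^bsub>fst U\<^esub> \<psi> n' = \<zero>\<^bsub>fst U\<^esub>"
  shows "lift U \<phi> \<psi> \<in> alg_hom R E U"
proof -
  interpret U: cring "fst U" using CalgD(1)[OF U] .
  note \<phi>h = alg_homD(1)[OF \<phi>]
  note [simp] = alg_homD(4)[OF \<phi>] ring_hom_add[OF \<phi>h] ring_hom_mult[OF \<phi>h] ring_hom_one[OF \<phi>h] closed
  have \<psi>0: "\<psi> \<zero>\<^bsub>N\<^esub> = \<zero>\<^bsub>fst U\<^esub>"
  proof -
    have "\<psi> (\<zero>\<^bsub>fst S\<^esub> \<odot>\<^bsub>N\<^esub> \<zero>\<^bsub>N\<^esub>) = \<zero>\<^bsub>fst U\<^esub>"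
      using ring_hom_zero[OF \<phi>h S.ring_axioms U.ring_axioms] by (subst smult) simp_all
    then show ?thesis by simp
  qed
  have "lift U \<phi> \<psi> \<in> ring_hom (fst E) (fst U)"
  proof (rule ring_hom_memI)
    fix x assume x: "x \<in> carrier (fst E)"
    then obtain s n where sn: "s \<in> carrier (fst S)" "n \<in> carrier N" "x = t s n" by (rule t_cases)
    then show "lift U \<phi> \<psi> x \<in> carrier (fst U)" by (simp add: lift_t)
    fix y assume "y \<in> carrier (fst E)"
    then obtain s' n' where sn': "s' \<in> carrier (fst S)" "n' \<in> carrier N" "y = t s' n'" by (rule t_cases)
    show "lift U \<phi> \<psi> (x \<oplus>\<^bsub>fst E\<^esub> y) = lift U \<phi> \<psi> x \<oplus>\<^bsub>fst U\<^esub> lift U \<phi> \<psi> y"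
      using sn sn' by (simp add: add lift_t \<psi>_add U.a_ac)
    show "lift U \<phi> \<psi> (x \<otimes>\<^bsub>fst E\<^esub> y) = lift U \<phi> \<psi> x \<otimes>\<^bsub>fst U\<^esub> lift U \<phi> \<psi> y"
      using sn sn' by (simp add: mult lift_t \<psi>_add smult square U.l_distr U.r_distr U.m_ac U.a_ac)
  qed (simp add: one lift_t \<psi>0)
  moreover have "compose (carrier R) (lift U \<phi> \<psi>) (snd E) = snd U"
  proof (rule extensionalityI)
    fix r assume r: "r \<in> carrier R"
    have "\<phi> (snd S r) = snd U r" using alg_homD(3)[OF \<phi>] r by (metis compose_eq)
    then show "compose (carrier R) (lift U \<phi> \<psi>) (snd E) r = snd U r"
      using r CalgD(4)[OF S_Calg] CalgD(4)[OF U] by (simp add: compose_eq scalar lift_t \<psi>0)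
  qed (use CalgD(3)[OF U] in simp_all)
  ultimately show ?thesis
    by (simp add: alg_hom_def lift_def)
qed

lemma proj_module_add:
  "\<lbrakk>x \<in> carrier (fst E); y \<in> carrier (fst E)\<rbrakk> \<Longrightarrow>
    proj_module (x \<oplus>\<^bsub>fst E\<^esub> y) = proj_module x \<oplus>\<^bsub>N\<^esub> proj_module y"
  by (auto elim!: t_cases simp: add)

lemma proj_module_scalar:
  "\<lbrakk>r \<in> carrier R; x \<in> carrier (fst E)\<rbrakk> \<Longrightarrow>
    proj_module (snd E r \<otimes>\<^bsub>fst E\<^esub> x) = snd S r \<odot>\<^bsub>N\<^esub> proj_module x"
  using CalgD(4)[OF S_Calg] by (auto elim!: t_cases simp: scalar mult)

end

section \<open>Coding the extensions in the universe\<close>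

lemma infinite_times_lepoll:
  assumes "infinite (UNIV :: 'u set)" "A \<lesssim> (UNIV :: 'u set)" "B \<lesssim> (UNIV :: 'u set)"
  shows "A \<times> B \<lesssim> (UNIV :: 'u set)"
proof -
  have "(UNIV :: 'u set) \<times> (UNIV :: 'u set) \<approx> (UNIV :: 'u set)"
    using card_of_Times_same_infinite[OF assms(1)] by (simp add: eqpoll_iff_card_of_ordIso)
  then show ?thesis
    using times_lepoll_mono[OF assms(2,3)] lepoll_trans2 by blast
qed

text \<open>An infinite type is equipotent with its square, so the pairs in S \<times> N inject into
  \<open>'u\<close>; the ring structure is transported along such an injection.\<close>

lemma trivial_extension_exists:
  fixes R :: "'u ring" and N :: "('u, 'n) module"
  assumes "infinite (UNIV :: 'u set)" "carrier N \<lesssim> (UNIV :: 'u set)"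
    and R: "ring R" and S: "S \<in> Calg R" and N: "module (fst S) N"
  obtains E t where "trivial_extension R S N E t"
proof -
  interpret S: cring "fst S" using CalgD(1)[OF S] .
  interpret N: module "fst S" N by (rule N)
  let ?P = "carrier (fst S) \<times> carrier N"
  have "carrier (fst S) \<lesssim> (UNIV :: 'u set)" by (rule subset_imp_lepoll) simp
  from infinite_times_lepoll[OF assms(1) this assms(2)]
  obtain j :: "'u \<times> 'n \<Rightarrow> 'u" where j: "inj_on j ?P" by (auto simp: lepoll_def)
  \<comment> \<open>Decodes an element of \<open>'u\<close> into its pair of coordinates.\<close>
  define i where "i = inv_into ?P j"
  have i [simp]: "i (j (s, n)) = (s, n)" if "s \<in> carrier (fst S)" "n \<in> carrier N" for s n
    using inv_into_f_f[OF j, of "(s, n)"] that by (simp add: i_def)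
  define E :: "'u ring" where "E = \<lparr>carrier = j ` ?P,
    mult = (\<lambda>x y. j (fst (i x) \<otimes>\<^bsub>fst S\<^esub> fst (i y), fst (i x) \<odot>\<^bsub>N\<^esub> snd (i y) \<oplus>\<^bsub>N\<^esub> fst (i y) \<odot>\<^bsub>N\<^esub> snd (i x))),
    one = j (\<one>\<^bsub>fst S\<^esub>, \<zero>\<^bsub>N\<^esub>), ring.zero = j (\<zero>\<^bsub>fst S\<^esub>, \<zero>\<^bsub>N\<^esub>),
    add = (\<lambda>x y. j (fst (i x) \<oplus>\<^bsub>fst S\<^esub> fst (i y), snd (i x) \<oplus>\<^bsub>N\<^esub> snd (i y)))\<rparr>"
  have car: "carrier E = j ` ?P" by (simp add: E_def)
  have jc: "j (s, n) \<in> carrier E" if "s \<in> carrier (fst S)" "n \<in> carrier N" for s n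
    using that by (simp add: E_def)
  have ops: "j (s, n) \<otimes>\<^bsub>E\<^esub> j (s', n') = j (s \<otimes>\<^bsub>fst S\<^esub> s', s \<odot>\<^bsub>N\<^esub> n' \<oplus>\<^bsub>N\<^esub> s' \<odot>\<^bsub>N\<^esub> n)"
    "j (s, n) \<oplus>\<^bsub>E\<^esub> j (s', n') = j (s \<oplus>\<^bsub>fst S\<^esub> s', n \<oplus>\<^bsub>N\<^esub> n')"
    if "s \<in> carrier (fst S)" "n \<in> carrier N" "s' \<in> carrier (fst S)" "n' \<in> carrier N" for s n s' n'
    using that by (simp_all add: E_def)
  have neutral: "\<one>\<^bsub>E\<^esub> = j (\<one>\<^bsub>fst S\<^esub>, \<zero>\<^bsub>N\<^esub>)" "\<zero>\<^bsub>E\<^esub> = j (\<zero>\<^bsub>fst S\<^esub>, \<zero>\<^bsub>N\<^esub>)"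
    by (simp_all add: E_def)
  have E_cases: thesis if "x \<in> carrier E" "\<And>s n. \<lbrakk>s \<in> carrier (fst S); n \<in> carrier N; x = j (s, n)\<rbrakk> \<Longrightarrow> thesis"
    for x thesis
    using that by (auto simp: car)
  have "cring E"
  proof (rule cringI)
    show "abelian_group E"
    proof (rule abelian_groupI)
      fix x assume "x \<in> carrier E"
      then obtain s n where x: "s \<in> carrier (fst S)" "n \<in> carrier N" "x = j (s, n)" by (rule E_cases)
      show "\<exists>y\<in>carrier E. y \<oplus>\<^bsub>E\<^esub> x = \<zero>\<^bsub>E\<^esub>"
        using x by (intro bexI[of _ "j (\<ominus>\<^bsub>fst S\<^esub> s, \<ominus>\<^bsub>N\<^esub> n)"])
          (simp_all add: jc ops neutral S.l_neg N.M.l_neg)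
    qed (auto elim!: E_cases simp: jc ops neutral S.a_ac N.M.a_ac)
    show "comm_monoid E"
      by (rule comm_monoidI)
         (auto elim!: E_cases simp: jc ops neutral S.m_ac N.M.a_ac N.smult_r_distr
           N.smult_assoc1[symmetric])
    show "(x \<oplus>\<^bsub>E\<^esub> y) \<otimes>\<^bsub>E\<^esub> z = x \<otimes>\<^bsub>E\<^esub> z \<oplus>\<^bsub>E\<^esub> y \<otimes>\<^bsub>E\<^esub> z"
      if "x \<in> carrier E" "y \<in> carrier E" "z \<in> carrier E" for x y z
      using that by (auto elim!: E_cases simp: jc ops S.l_distr N.smult_l_distr N.smult_r_distr N.M.a_ac)
  qed
  moreover have "(\<lambda>r. j (snd S r, \<zero>\<^bsub>N\<^esub>)) \<in> ring_hom R E"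
    using CalgD(4)[OF S]
    by (intro ring_hom_memI) (simp_all add: jc ops neutral ring_hom_add[OF CalgD(2)[OF S]]
      ring_hom_mult[OF CalgD(2)[OF S]] ring_hom_one[OF CalgD(2)[OF S]])
  then have "(\<lambda>r\<in>carrier R. j (snd S r, \<zero>\<^bsub>N\<^esub>)) \<in> ring_hom R E"
    by (rule ring_hom_cong[OF R]) simp
  ultimately have "trivial_extension R S N (E, \<lambda>r\<in>carrier R. j (snd S r, \<zero>\<^bsub>N\<^esub>)) (\<lambda>s n. j (s, n))"
    using S N j by unfold_locales (auto simp: Calg_def ops neutral car inj_on_def)
  then show thesis by (rule that)
qed

context quasi_coherent_setup
begin

text \<open>Each element of C \<otimes> S is a finite sum of pure tensors, so the lists over C
  \<times> S map onto it, and an infinite type has only as many finite lists as elements.\<close>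

lemma Q_carrier_lepoll:
  assumes inf: "infinite (UNIV :: 'u set)" and "carrier C \<lesssim> (UNIV :: 'u set)" and S: "S \<in> Calg R"
  shows "carrier (Ob Q S) \<lesssim> (UNIV :: 'u set)"
proof -
  let ?T = "tensor R C (alg_mod S)" and ?A = "carrier C \<times> carrier (fst S)"
  interpret T: module R ?T by (rule module_Q_R[OF S])
  \<comment> \<open>The free start value of the fold makes concatenation of lists correspond to
    addition.\<close>
  define sum where "sum = foldr (\<lambda>(c, s) x. pt S c s \<oplus>\<^bsub>?T\<^esub> x)"
  have sum_closed: "sum l x \<in> carrier ?T" if "l \<in> lists ?A" "x \<in> carrier ?T" for l x
    using that by (induction l) (auto simp: sum_def pt_closed[OF S])
  have sum_add: "sum l (x \<oplus>\<^bsub>?T\<^esub> y) = sum l x \<oplus>\<^bsub>?T\<^esub> y"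
    if "l \<in> lists ?A" "x \<in> carrier ?T" "y \<in> carrier ?T" for l x y
    using that(1)
  proof (induction l)
    case (Cons a l)
    then show ?case
      using sum_closed[of l x] that(2,3) by (cases a) (simp add: sum_def pt_closed[OF S] T.M.a_assoc)
  qed (simp add: sum_def)
  have "x \<in> (\<lambda>l. sum l \<zero>\<^bsub>?T\<^esub>) ` lists ?A" if "x \<in> carrier ?T" for x
    using S that
  proof (induction rule: Q_induct)
    case (pt c s)
    then have "pt S c s = sum [(c, s)] \<zero>\<^bsub>?T\<^esub>" by (simp add: sum_def pt_closed[OF S])
    then show ?case using pt by (intro image_eqI[of _ _ "[(c, s)]"]) auto
  next
    case (add x y)
    then obtain k l where kl: "k \<in> lists ?A" "x = sum k \<zero>\<^bsub>?T\<^esub>" "l \<in> lists ?A" "y = sum l \<zero>\<^bsub>?T\<^esub>"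
      by blast
    then have "x \<oplus>\<^bsub>?T\<^esub> y = sum (k @ l) \<zero>\<^bsub>?T\<^esub>"
      using sum_add[OF kl(1), of "\<zero>\<^bsub>?T\<^esub>" "sum l \<zero>\<^bsub>?T\<^esub>"] sum_closed[OF kl(3)] by (simp add: sum_def)
    then show ?case using kl by (intro image_eqI[of _ _ "k @ l"]) auto
  qed
  then have "carrier ?T \<lesssim> lists ?A"
    by (intro subset_image_lepoll[of _ "\<lambda>l. sum l \<zero>\<^bsub>?T\<^esub>"]) blast
  also have "lists ?A \<lesssim> lists (UNIV :: 'u set)"
    by (intro lists_lepoll_mono infinite_times_lepoll assms subset_imp_lepoll) simp
  also have "lists (UNIV :: 'u set) \<approx> (UNIV :: 'u set)"
    using card_of_lists_infinite[OF inf] by (simp add: eqpoll_iff_card_of_ordIso)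
  finally show ?thesis by simp
qed

end

section \<open>The coalgebra of a functor of convolution algebras\<close>

lemma (in quasi_coherent_setup) H_smult_closed:
  assumes "S \<in> Calg R" "s \<in> carrier (fst S)" "f \<in> carrier (Ob H S)"
  shows "s \<odot>\<^bsub>Ob H S\<^esub> f \<in> carrier (Ob H S)"
  using H_restrictI[OF lin_hom_comp[OF mult_lin[OF assms(1,2)] H_D(1)[OF assms(3)]]]
  by (simp add: H_simps)

lemma (in quasi_coherent_setup) H_Ar_closed:
  assumes "S \<in> Calg R" "\<phi> \<in> alg_hom R S T" "f \<in> carrier (Ob H S)"
  shows "Ar H S T \<phi> f \<in> carrier (Ob H T)"
  using H_restrictI[OF lin_hom_comp[OF alg_hom_lin[OF assms(1,2)] H_D(1)[OF assms(3)]]]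
  by (simp add: H_simps compose_def)

text \<open>The maps \<open>left, right: C \<rightarrow> S2\<close> play the role of a universal pair of linear maps into an algebra
  whose images have square zero; their product in the given algebra structure determines the
  comultiplication.\<close>

locale universal_pair = quasi_coherent_setup R C
  for R :: "'u ring" and C :: "('u, 'c) module" +
  fixes \<mu> e S1 t1 S2 t2
  assumes inf: "infinite (UNIV :: 'u set)"
    and A: "alg_structure R H \<mu> e"
    and T1: "trivial_extension R (self_alg R) C S1 t1"
    and T2: "trivial_extension R S1 (Ob Q S1) S2 t2"
begin

sublocale X1: trivial_extension R "self_alg R" C S1 t1 by (rule T1)
sublocale X2: trivial_extension R S1 "Ob Q S1" S2 t2 by (rule T2)

lemmas S1 = X1.E_Calg
lemmas S2 = X2.E_Calg

abbreviation "T1C \<equiv> tensor R C (alg_mod S1)"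

lemma t1_lin: "(\<lambda>c. t1 \<zero>\<^bsub>R\<^esub> c) \<in> lin_hom R C (alg_mod S1)"
  using CalgD(4)[OF X1.S_Calg]
  by (intro lin_homI) (simp_all add: X1.add[simplified] X1.scalar X1.mult[simplified])

lemma pt1_closed: "c \<in> carrier C \<Longrightarrow> pt S1 c \<one>\<^bsub>fst S1\<^esub> \<in> carrier T1C"
  by (rule pt_closed[OF S1]) simp_all

section \<open>The comultiplication read off from a universal product\<close>

definition base :: "'c \<Rightarrow> 'u" where "base = (\<lambda>c\<in>carrier C. t1 \<zero>\<^bsub>R\<^esub> c)"
text \<open>In S2 = R + C + C + C \<otimes> C the copy of C used by \<open>left\<close> is C
  \<otimes> 1 in the new summand, and the one used by \<open>right\<close> lies in S1. The ring
  product of left(c) and right(d) is therefore c \<otimes> d, placed in C \<otimes> S1.\<close>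

definition left :: "'c \<Rightarrow> 'u" where "left = (\<lambda>c\<in>carrier C. t2 \<zero>\<^bsub>fst S1\<^esub> (pt S1 c \<one>\<^bsub>fst S1\<^esub>))"
definition right :: "'c \<Rightarrow> 'u" where "right = Ar H S1 S2 X2.incl base"

lemma base_closed: "base \<in> carrier (Ob H S1)"
  unfolding base_def by (rule H_restrictI[OF t1_lin])

lemma base_apply: "c \<in> carrier C \<Longrightarrow> base c = t1 \<zero>\<^bsub>R\<^esub> c"
  by (simp add: base_def)

lemma left_closed: "left \<in> carrier (Ob H S2)"
  unfolding left_def
proof (rule H_restrictI, rule lin_homI)
  note l = pt_lin(1)[OF S1 X1.E.one_closed]
  note T = module_Q_R[OF S1]
  interpret T: module R T1C by (rule T)
  fix c assume c: "c \<in> carrier C"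
  show "t2 \<zero>\<^bsub>fst S1\<^esub> (pt S1 c \<one>\<^bsub>fst S1\<^esub>) \<in> carrier (alg_mod S2)"
    using pt1_closed[OF c] by simp
  show "t2 \<zero>\<^bsub>fst S1\<^esub> (pt S1 (c \<oplus>\<^bsub>C\<^esub> d) \<one>\<^bsub>fst S1\<^esub>) =
      t2 \<zero>\<^bsub>fst S1\<^esub> (pt S1 c \<one>\<^bsub>fst S1\<^esub>) \<oplus>\<^bsub>alg_mod S2\<^esub> t2 \<zero>\<^bsub>fst S1\<^esub> (pt S1 d \<one>\<^bsub>fst S1\<^esub>)"
    if d: "d \<in> carrier C" for d
    using pt1_closed[OF c] pt1_closed[OF d] lin_hom_add[OF l c d] by (simp add: X2.add)
  show "t2 \<zero>\<^bsub>fst S1\<^esub> (pt S1 (r \<odot>\<^bsub>C\<^esub> c) \<one>\<^bsub>fst S1\<^esub>) =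
      r \<odot>\<^bsub>alg_mod S2\<^esub> t2 \<zero>\<^bsub>fst S1\<^esub> (pt S1 c \<one>\<^bsub>fst S1\<^esub>)" if r: "r \<in> carrier R" for r
    using pt1_closed[OF c] lin_hom_smult[OF l r c] r CalgD(4)[OF S1 r]
      X2.mult[of "snd S1 r" "\<zero>\<^bsub>T1C\<^esub>" "\<zero>\<^bsub>fst S1\<^esub>" "pt S1 c \<one>\<^bsub>fst S1\<^esub>"]
      X2.N.smult_l_null[of "\<zero>\<^bsub>T1C\<^esub>"] Q_smult_scalar[OF S1 r pt1_closed[OF c]]
    by (simp add: X2.scalar)
qed

lemma right_closed: "right \<in> carrier (Ob H S2)"
  unfolding right_def by (rule H_Ar_closed[OF S1 X2.incl_alg_hom base_closed])

lemma right_apply: "c \<in> carrier C \<Longrightarrow> right c = t2 (t1 \<zero>\<^bsub>R\<^esub> c) \<zero>\<^bsub>T1C\<^esub>"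
  by (simp add: right_def H_simps base_def compose_eq X2.incl_def)

lemma left_apply: "c \<in> carrier C \<Longrightarrow> left c = t2 \<zero>\<^bsub>fst S1\<^esub> (pt S1 c \<one>\<^bsub>fst S1\<^esub>)"
  by (simp add: left_def)

abbreviation "lr_prod \<equiv> \<mu> S2 left right"

lemma prod_closed: "lr_prod \<in> carrier (Ob H S2)"
  by (rule bilinD(3)[OF alg_structureD(1)[OF A S2] left_closed right_closed])

lemma proj1_lin: "X1.proj_module \<in> lin_hom R (alg_mod S1) C"
  by (rule lin_homI) (simp_all add: X1.proj_module_add X1.proj_module_scalar)

lemma proj2_lin: "X2.proj_module \<in> lin_hom R (alg_mod S2) T1C"
  using X2.proj_closed(2) X2.proj_module_add Q_smult_scalar[OF S1]
  by (intro lin_homI) (simp_all add: X2.proj_module_scalar)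

text \<open>The C \<otimes> C component of the product of the two universal maps. That the other
  components vanish, so that nothing is lost by projecting, is \<open>prod_proj_base\<close> and
  \<open>prod_proj_module\<close>.\<close>

definition comult :: "'c \<Rightarrow> ('c \<times> 'c \<Rightarrow> 'u) set" where
  "comult c = tensor_hom R C C (\<lambda>c. c) X1.proj_module (X2.proj_module (lr_prod c))"

lemma tensor_proj1_lin: "tensor_hom R C C (\<lambda>c. c) X1.proj_module \<in> lin_hom R T1C (tensor R C C)"
  by (rule tensor_hom_lin[OF C module_alg_mod[OF S1] C C lin_hom_id proj1_lin])

lemma comult_lin: "comult \<in> lin_hom R C (tensor R C C)"
  unfolding comult_def[abs_def]
  by (rule lin_hom_comp[OF tensor_proj1_lin lin_hom_comp[OF proj2_lin H_D(1)[OF prod_closed]]])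

text \<open>A map that vanishes on C equals 0 times itself, so homogeneity of \<mu> in either
  argument forces the product to vanish.\<close>

lemma mult_zero:
  assumes S: "S \<in> Calg R" and z: "z \<in> carrier (Ob H S)" and z0: "\<And>c. c \<in> carrier C \<Longrightarrow> z c = \<zero>\<^bsub>fst S\<^esub>"
    and f: "f \<in> carrier (Ob H S)" and c: "c \<in> carrier C"
  shows "\<mu> S z f c = \<zero>\<^bsub>fst S\<^esub>" "\<mu> S f z c = \<zero>\<^bsub>fst S\<^esub>"
proof -
  interpret S: cring "fst S" using CalgD(1)[OF S] .
  note b = alg_structureD(1)[OF A S]
  have z': "\<zero>\<^bsub>fst S\<^esub> \<odot>\<^bsub>Ob H S\<^esub> z = z"
    by (rule H_eqI[OF H_smult_closed[OF S S.zero_closed z] z]) (simp add: H_simps z0)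
  have 1: "\<mu> S z f = \<zero>\<^bsub>fst S\<^esub> \<odot>\<^bsub>Ob H S\<^esub> \<mu> S z f" and 2: "\<mu> S f z = \<zero>\<^bsub>fst S\<^esub> \<odot>\<^bsub>Ob H S\<^esub> \<mu> S f z"
    using lin_hom_smult[OF bilinD(2)[OF b f] S.zero_closed z]
      lin_hom_smult[OF bilinD(1)[OF b f] S.zero_closed z] unfolding z' by simp_all
  have smult0: "(\<zero>\<^bsub>fst S\<^esub> \<odot>\<^bsub>Ob H S\<^esub> h) c = \<zero>\<^bsub>fst S\<^esub>" if "h \<in> carrier (Ob H S)" for h
    using c H_D(3)[OF that c] by (simp add: H_simps)
  show "\<mu> S z f c = \<zero>\<^bsub>fst S\<^esub>"
    using smult0[OF bilinD(3)[OF b z f]] unfolding 1[symmetric] .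
  show "\<mu> S f z c = \<zero>\<^bsub>fst S\<^esub>"
    using smult0[OF bilinD(3)[OF b f z]] unfolding 2[symmetric] .
qed

lemma mult_natural:
  assumes "S \<in> Calg R" "T \<in> Calg R" "\<phi> \<in> alg_hom R S T" "f \<in> carrier (Ob H S)" "g \<in> carrier (Ob H S)"
    and "c \<in> carrier C"
  shows "\<phi> (\<mu> S f g c) = \<mu> T (Ar H S T \<phi> f) (Ar H S T \<phi> g) c"
  using fun_cong[OF alg_structureD(7)[OF A assms(1-5)], of c] assms(6) by (simp add: H_simps compose_eq)

text \<open>Both coordinate projections kill the product of \<open>left\<close> and \<open>right\<close>, because each of them kills one
  of the factors.\<close>

lemma prod_proj_base:
  assumes c: "c \<in> carrier C"
  shows "X2.proj_base (lr_prod c) = \<zero>\<^bsub>fst S1\<^esub>"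
proof -
  let ?p = "\<lambda>x\<in>carrier (fst S2). X2.proj_base x"
  note p = X2.proj_base_alg_hom
  have "Ar H S2 S1 ?p left d = \<zero>\<^bsub>fst S1\<^esub>" if d: "d \<in> carrier C" for d
    using d pt1_closed[OF d] by (simp add: H_simps compose_eq left_apply)
  then have "?p (lr_prod c) = \<zero>\<^bsub>fst S1\<^esub>"
    unfolding mult_natural[OF S2 S1 p left_closed right_closed c]
    by (intro mult_zero(1)[OF S1 H_Ar_closed[OF S2 p left_closed] _ H_Ar_closed[OF S2 p right_closed] c])
  then show ?thesis
    using H_D(3)[OF prod_closed c] by simp
qed

text \<open>After \<open>prod_proj_base\<close> the product lies in C \<otimes> S1 = C \<otimes> R +
  C \<otimes> C. Killing the summand C of S1 induces an endomorphism of S2 that annihilates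
  \<open>right\<close>, hence the product, while it retains the C \<otimes> R component; so that
  component is zero.\<close>

lemma prod_proj_module:
  assumes c: "c \<in> carrier C"
  shows "X2.proj_module (lr_prod c) = tensor_hom R C (alg_mod S1) (\<lambda>c. c) (\<lambda>c. t1 \<zero>\<^bsub>R\<^esub> c) (comult c)"
proof -
  \<comment> \<open>The projection of S1 onto its summand R, as an endomorphism of S1.\<close>
  define \<rho> where "\<rho> = compose (carrier (fst S1)) X1.incl (\<lambda>x\<in>carrier (fst S1). X1.proj_base x)"
  have \<rho>: "\<rho> \<in> alg_hom R S1 S1"
    unfolding \<rho>_def by (rule alg_hom_compose[OF S1 X1.proj_base_alg_hom X1.incl_alg_hom])
  have \<rho>t: "\<rho> (t1 r d) = t1 r \<zero>\<^bsub>C\<^esub>" if "r \<in> carrier R" "d \<in> carrier C" for r d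
    using that by (simp add: \<rho>_def compose_eq X1.incl_def)
  have \<rho>0: "\<rho> \<zero>\<^bsub>fst S1\<^esub> = \<zero>\<^bsub>fst S1\<^esub>"
    using \<rho>t[of "\<zero>\<^bsub>R\<^esub>" "\<zero>\<^bsub>C\<^esub>"] by (simp add: X1.zero)
  note Q\<rho> = Q_Ar_lin_R[OF S1 S1 \<rho>]
  interpret T: module R T1C by (rule module_Q_R[OF S1])
  have Q\<rho>c: "Ar Q S1 S1 \<rho> n \<in> carrier T1C" if "n \<in> carrier T1C" for n
    using lin_hom_closed[OF Q\<rho> that] .
  have Q\<rho>0: "Ar Q S1 S1 \<rho> \<zero>\<^bsub>T1C\<^esub> = \<zero>\<^bsub>T1C\<^esub>"
    by (rule lin_hom_zero[OF module_Q_R[OF S1] module_Q_R[OF S1] Q\<rho>])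
  \<comment> \<open>The endomorphism of S2 induced by \<rho> on both summands S1 and C \<otimes>
    S1.\<close>
  define \<chi> where "\<chi> = X2.lift S2 (compose (carrier (fst S1)) X2.incl \<rho>) (\<lambda>n. t2 \<zero>\<^bsub>fst S1\<^esub> (Ar Q S1 S1 \<rho> n))"
  have i\<rho>: "compose (carrier (fst S1)) X2.incl \<rho> \<in> alg_hom R S1 S2"
    by (rule alg_hom_compose[OF S1 \<rho> X2.incl_alg_hom])
  have i\<rho>_apply: "compose (carrier (fst S1)) X2.incl \<rho> s = t2 (\<rho> s) \<zero>\<^bsub>T1C\<^esub>" if "s \<in> carrier (fst S1)" for s
    using that alg_homD(4)[OF \<rho>] by (simp add: compose_eq X2.incl_def)
  have smult: "Ar Q S1 S1 \<rho> (s \<odot>\<^bsub>Ob Q S1\<^esub> n) = \<rho> s \<odot>\<^bsub>Ob Q S1\<^esub> Ar Q S1 S1 \<rho> n"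
    if "s \<in> carrier (fst S1)" "n \<in> carrier T1C" for s n
    using module_functor.map_smult[OF Q_functor S1 S1 \<rho> that(1)] that(2) by simp
  have smult_closed: "s \<odot>\<^bsub>Ob Q S1\<^esub> n \<in> carrier T1C" if "s \<in> carrier (fst S1)" "n \<in> carrier T1C" for s n
    using X2.N.smult_closed[of s n] that by simp
  have null: "\<zero>\<^bsub>fst S1\<^esub> \<odot>\<^bsub>Ob Q S1\<^esub> n = \<zero>\<^bsub>T1C\<^esub>" "s \<odot>\<^bsub>Ob Q S1\<^esub> \<zero>\<^bsub>T1C\<^esub> = \<zero>\<^bsub>T1C\<^esub>"
    if "n \<in> carrier T1C" "s \<in> carrier (fst S1)" for n s
    using X2.N.smult_l_null[of n] X2.N.smult_r_null[of s] that by simp_all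
  have \<chi>: "\<chi> \<in> alg_hom R S2 S2"
    unfolding \<chi>_def
  proof (rule X2.lift_alg_hom[OF S2 i\<rho>])
    show "t2 \<zero>\<^bsub>fst S1\<^esub> (Ar Q S1 S1 \<rho> n) \<in> carrier (fst S2)" if "n \<in> carrier (Ob Q S1)" for n
      using that Q\<rho>c by simp
    show "t2 \<zero>\<^bsub>fst S1\<^esub> (Ar Q S1 S1 \<rho> (n \<oplus>\<^bsub>Ob Q S1\<^esub> n')) =
        t2 \<zero>\<^bsub>fst S1\<^esub> (Ar Q S1 S1 \<rho> n) \<oplus>\<^bsub>fst S2\<^esub> t2 \<zero>\<^bsub>fst S1\<^esub> (Ar Q S1 S1 \<rho> n')"
      if "n \<in> carrier (Ob Q S1)" "n' \<in> carrier (Ob Q S1)" for n n'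
      using that Q\<rho>c by (simp add: X2.add lin_hom_add[OF Q\<rho>])
    show "t2 \<zero>\<^bsub>fst S1\<^esub> (Ar Q S1 S1 \<rho> (s \<odot>\<^bsub>Ob Q S1\<^esub> n)) =
        compose (carrier (fst S1)) X2.incl \<rho> s \<otimes>\<^bsub>fst S2\<^esub> t2 \<zero>\<^bsub>fst S1\<^esub> (Ar Q S1 S1 \<rho> n)"
      if "s \<in> carrier (fst S1)" "n \<in> carrier (Ob Q S1)" for s n
      using that Q\<rho>c alg_homD(4)[OF \<rho>] smult_closed by (simp add: i\<rho>_apply X2.mult smult null)
    show "t2 \<zero>\<^bsub>fst S1\<^esub> (Ar Q S1 S1 \<rho> n) \<otimes>\<^bsub>fst S2\<^esub> t2 \<zero>\<^bsub>fst S1\<^esub> (Ar Q S1 S1 \<rho> n') = \<zero>\<^bsub>fst S2\<^esub>"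
      if "n \<in> carrier (Ob Q S1)" "n' \<in> carrier (Ob Q S1)" for n n'
      using that Q\<rho>c by (simp add: X2.mult null X2.zero)
  qed
  have \<chi>t: "\<chi> (t2 s n) = t2 (\<rho> s) (Ar Q S1 S1 \<rho> n)" if "s \<in> carrier (fst S1)" "n \<in> carrier T1C" for s n
    using that Q\<rho>c alg_homD(4)[OF \<rho>] by (simp add: \<chi>_def X2.lift_t i\<rho>_apply X2.add)
  define n where "n = X2.proj_module (lr_prod c)"
  have n: "n \<in> carrier T1C" and lr_prod: "lr_prod c = t2 \<zero>\<^bsub>fst S1\<^esub> n"
    using H_D(3)[OF prod_closed c] X2.proj_closed(2,3)[of "lr_prod c"] prod_proj_base[OF c] by (simp_all add: n_def)
  have "Ar H S2 S2 \<chi> right d = \<zero>\<^bsub>fst S2\<^esub>" if d: "d \<in> carrier C" for d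
    using d by (simp add: H_simps compose_eq right_apply \<chi>t \<rho>t Q\<rho>0 X2.zero X1.zero)
  then have "\<chi> (lr_prod c) = \<zero>\<^bsub>fst S2\<^esub>"
    unfolding mult_natural[OF S2 S2 \<chi> left_closed right_closed c]
    by (intro mult_zero(2)[OF S2 H_Ar_closed[OF S2 \<chi> right_closed] _ H_Ar_closed[OF S2 \<chi> left_closed] c])
  then have "t2 \<zero>\<^bsub>fst S1\<^esub> (Ar Q S1 S1 \<rho> n) = t2 \<zero>\<^bsub>fst S1\<^esub> \<zero>\<^bsub>T1C\<^esub>"
    using n by (simp add: lr_prod \<chi>t \<rho>0 X2.zero)
  then have "X2.proj_module (t2 \<zero>\<^bsub>fst S1\<^esub> (Ar Q S1 S1 \<rho> n)) = X2.proj_module (t2 \<zero>\<^bsub>fst S1\<^esub> \<zero>\<^bsub>T1C\<^esub>)"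
    by (rule arg_cong)
  then have \<rho>n: "Ar Q S1 S1 \<rho> n = \<zero>\<^bsub>T1C\<^esub>"
    using Q\<rho>c[OF n] by simp
  let ?\<iota> = "tensor_hom R C (alg_mod S1) (\<lambda>c. c) (\<lambda>c. t1 \<zero>\<^bsub>R\<^esub> c)"
  let ?\<pi> = "tensor_hom R C C (\<lambda>c. c) X1.proj_module"
  note \<iota> = tensor_hom_lin[OF C C C module_alg_mod[OF S1] lin_hom_id t1_lin]
    and \<iota>_pure = tensor_hom_pure[OF C C C module_alg_mod[OF S1] lin_hom_id t1_lin]
  note \<pi>_pure = tensor_hom_pure[OF C module_alg_mod[OF S1] C C lin_hom_id proj1_lin]
  note \<iota>\<pi> = lin_hom_comp[OF \<iota> tensor_proj1_lin]
  \<comment> \<open>The identity of C \<otimes> S1 is the sum of the projections to C \<otimes> R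
    and to C \<otimes> C. For the product the first term is zero, which leaves the image of the
    comultiplication.\<close>
  have "Ar Q S1 S1 \<rho> x \<oplus>\<^bsub>T1C\<^esub> ?\<iota> (?\<pi> x) = x" if "x \<in> carrier T1C" for x
  proof (rule tensor_hom_ext[OF C module_alg_mod[OF S1]
        lin_hom_sum[OF module_Q_R[OF S1] Q\<rho> \<iota>\<pi>] lin_hom_id _ that])
    fix d s assume d: "d \<in> carrier C" and "s \<in> carrier (alg_mod S1)"
    then have s: "s \<in> carrier (fst S1)" by simp
    obtain r d' where rd: "r \<in> carrier R" "d' \<in> carrier C" "s = t1 r d'"
      using X1.t_cases[OF s] by auto
    have "pt S1 d (t1 r \<zero>\<^bsub>C\<^esub> \<oplus>\<^bsub>fst S1\<^esub> t1 \<zero>\<^bsub>R\<^esub> d') = pt S1 d (t1 r \<zero>\<^bsub>C\<^esub>) \<oplus>\<^bsub>T1C\<^esub> pt S1 d (t1 \<zero>\<^bsub>R\<^esub> d')"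
      using lin_hom_add[OF pt_lin(2)[OF S1 d], of "t1 r \<zero>\<^bsub>C\<^esub>" "t1 \<zero>\<^bsub>R\<^esub> d'"] rd by simp
    then have "pt S1 d s = pt S1 d (t1 r \<zero>\<^bsub>C\<^esub>) \<oplus>\<^bsub>T1C\<^esub> pt S1 d (t1 \<zero>\<^bsub>R\<^esub> d')"
      using rd X1.add[of r "\<zero>\<^bsub>C\<^esub>" "\<zero>\<^bsub>R\<^esub>" d'] by simp
    moreover have "Ar Q S1 S1 \<rho> (pt S1 d s) = pt S1 d (t1 r \<zero>\<^bsub>C\<^esub>)"
      using d s rd by (simp only: Q_Ar_pt[OF S1 S1 \<rho>] \<rho>t)
    moreover have "?\<iota> (?\<pi> (pt S1 d s)) = pt S1 d (t1 \<zero>\<^bsub>R\<^esub> d')"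
      using d s rd by (simp add: \<pi>_pure \<iota>_pure)
    ultimately show "Ar Q S1 S1 \<rho> (pt S1 d s) \<oplus>\<^bsub>T1C\<^esub> ?\<iota> (?\<pi> (pt S1 d s)) = pt S1 d s"
      by simp
  qed
  from this[OF n] have "\<zero>\<^bsub>T1C\<^esub> \<oplus>\<^bsub>T1C\<^esub> ?\<iota> (?\<pi> n) = n"
    by (simp add: \<rho>n)
  then show ?thesis
    using lin_hom_closed[OF \<iota>\<pi> n] by (simp add: comult_def n_def)
qed

section \<open>The given product is the convolution product\<close>

abbreviation "square_zero U f \<equiv>
  (\<forall>c\<in>carrier C. \<forall>d\<in>carrier C. f c \<otimes>\<^bsub>fst U\<^esub> f d = \<zero>\<^bsub>fst U\<^esub>)"

text \<open>By the universal properties of S1 and S2 one algebra map from S2 to U sends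
  \<open>left\<close> to f and \<open>right\<close> to g. Naturality along it computes the product
  of f and g from the universal product, which is known to come from the comultiplication.\<close>

lemma mult_eq_conv_square_zero:
  assumes U: "U \<in> Calg R" and f: "f \<in> carrier (Ob H U)" and g: "g \<in> carrier (Ob H U)"
    and f0: "square_zero U f" and g0: "square_zero U g"
  shows "\<mu> U f g = conv comult U f g"
proof (rule H_eqI[OF bilinD(3)[OF alg_structureD(1)[OF A U] f g] conv_closed[OF comult_lin U f g]])
  interpret U: cring "fst U" using CalgD(1)[OF U] .
  fix c assume c: "c \<in> carrier C"
  \<comment> \<open>The extension of g to S1, available because g has square-zero image.\<close>
  define \<phi>1 where "\<phi>1 = X1.lift U (snd U) g"
  have \<phi>1: "\<phi>1 \<in> alg_hom R S1 U"
    unfolding \<phi>1_def using snd_alg_hom_self[OF R U] H_D(3-5)[OF g] g0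
    by (intro X1.lift_alg_hom[OF U]) simp_all
  have snd0: "snd U \<zero>\<^bsub>R\<^esub> = \<zero>\<^bsub>fst U\<^esub>"
    using ring_hom_zero[OF CalgD(2)[OF U] R.ring_axioms U.ring_axioms] .
  have \<phi>1t: "\<phi>1 (t1 \<zero>\<^bsub>R\<^esub> d) = g d" if "d \<in> carrier C" for d
    using that H_D(3)[OF g that] by (simp add: \<phi>1_def X1.lift_t snd0)
  have \<phi>1_zero: "\<phi>1 \<zero>\<^bsub>fst S1\<^esub> = \<zero>\<^bsub>fst U\<^esub>"
    by (rule ring_hom_zero[OF alg_homD(1)[OF \<phi>1] X1.E.ring_axioms U.ring_axioms])
  \<comment> \<open>The module part of the map out of S2: c \<otimes> s goes to f(c) times
    \<phi>1(s), as it must once \<open>left\<close> goes to f.\<close>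
  define \<psi> where "\<psi> = tensor_mult R U f \<phi>1"
  note \<phi>1l = alg_hom_lin[OF S1 \<phi>1]
  note fl = H_D(1)[OF f]
  have \<psi>: "\<psi> \<in> lin_hom R T1C (alg_mod U)"
    unfolding \<psi>_def by (rule tensor_mult_lin[OF U C module_alg_mod[OF S1] fl \<phi>1l])
  have \<psi>_pt: "\<psi> (pt S1 d s) = f d \<otimes>\<^bsub>fst U\<^esub> \<phi>1 s" if "d \<in> carrier C" "s \<in> carrier (fst S1)" for d s
    unfolding \<psi>_def using that by (simp add: tensor_mult_pure[OF U C module_alg_mod[OF S1] fl \<phi>1l])
  have \<psi>c: "\<psi> n \<in> carrier (fst U)" if "n \<in> carrier T1C" for n
    using lin_hom_closed[OF \<psi> that] by simp
  note \<psi>_add = lin_hom_add[OF \<psi>, simplified]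
  have \<psi>_smult: "\<psi> (s \<odot>\<^bsub>Ob Q S1\<^esub> n) = \<phi>1 s \<otimes>\<^bsub>fst U\<^esub> \<psi> n" if s: "s \<in> carrier (fst S1)" and n: "n \<in> carrier T1C" for s n
    using S1 n
  proof (induction rule: Q_induct)
    case (pt d s')
    then show ?case
      using s alg_homD(4)[OF \<phi>1] H_D(3)[OF f pt(1)]
      by (simp add: Q_smult_pt[OF S1 s] \<psi>_pt ring_hom_mult[OF alg_homD(1)[OF \<phi>1]] U.m_lcomm)
  next
    case (add x y)
    then show ?case
      using s alg_homD(4)[OF \<phi>1] \<psi>c
      by (simp add: lin_hom_add[OF Q_smult_lin[OF S1 s]] \<psi>_add lin_hom_closed[OF Q_smult_lin[OF S1 s]] U.r_distr)
  qed
  \<comment> \<open>Commutativity of U collects the two values of f into one product, which vanishes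
    by assumption; sums are handled by induction in each factor.\<close>
  have \<psi>_square: "\<psi> n \<otimes>\<^bsub>fst U\<^esub> \<psi> n' = \<zero>\<^bsub>fst U\<^esub>" if n: "n \<in> carrier T1C" and n': "n' \<in> carrier T1C" for n n'
    using S1 n
  proof (induction rule: Q_induct)
    case (pt d s)
    note ds = pt
    show ?case
      using S1 n'
    proof (induction rule: Q_induct)
      case (pt d' s')
      have cl: "f d \<in> carrier (fst U)" "f d' \<in> carrier (fst U)" "\<phi>1 s \<in> carrier (fst U)" "\<phi>1 s' \<in> carrier (fst U)"
        using H_D(3)[OF f] alg_homD(4)[OF \<phi>1] ds pt by simp_all
      have "(f d \<otimes>\<^bsub>fst U\<^esub> \<phi>1 s) \<otimes>\<^bsub>fst U\<^esub> (f d' \<otimes>\<^bsub>fst U\<^esub> \<phi>1 s') =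
          (f d \<otimes>\<^bsub>fst U\<^esub> f d') \<otimes>\<^bsub>fst U\<^esub> (\<phi>1 s \<otimes>\<^bsub>fst U\<^esub> \<phi>1 s')"
        using cl by (simp add: U.m_ac)
      then show ?case
        using ds pt f0 cl by (simp add: \<psi>_pt)
    next
      case (add x y)
      then show ?case
        using ds \<psi>c pt_closed[OF S1] by (simp add: \<psi>_add U.r_distr)
    qed
  next
    case (add x y)
    then show ?case
      using n' \<psi>c by (simp add: \<psi>_add U.l_distr)
  qed
  define \<phi> where "\<phi> = X2.lift U \<phi>1 \<psi>"
  have \<phi>: "\<phi> \<in> alg_hom R S2 U"
    unfolding \<phi>_def using \<psi>c \<psi>_add \<psi>_smult \<psi>_square by (intro X2.lift_alg_hom[OF U \<phi>1]) simp_all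
  have \<psi>0: "\<psi> \<zero>\<^bsub>T1C\<^esub> = \<zero>\<^bsub>fst U\<^esub>"
    using lin_hom_zero[OF module_Q_R[OF S1] module_alg_mod[OF U] \<psi>] by simp
  have left: "Ar H S2 U \<phi> left = f"
  proof (rule H_eqI[OF H_Ar_closed[OF S2 \<phi> left_closed] f])
    fix d assume d: "d \<in> carrier C"
    show "Ar H S2 U \<phi> left d = f d"
      using d pt1_closed[OF d] H_D(3)[OF f d]
      by (simp add: H_simps compose_eq left_apply \<phi>_def X2.lift_t \<phi>1_zero \<psi>_pt
          ring_hom_one[OF alg_homD(1)[OF \<phi>1]])
  qed
  have right: "Ar H S2 U \<phi> right = g"
  proof (rule H_eqI[OF H_Ar_closed[OF S2 \<phi> right_closed] g])
    fix d assume d: "d \<in> carrier C"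
    have "\<zero>\<^bsub>T1C\<^esub> \<in> carrier T1C" using X2.N.M.zero_closed by simp
    then show "Ar H S2 U \<phi> right d = g d"
      using d H_D(3)[OF g d] by (simp add: H_simps compose_eq right_apply \<phi>_def X2.lift_t \<phi>1t \<psi>0)
  qed
  have n: "X2.proj_module (lr_prod c) \<in> carrier T1C"
    using X2.proj_closed(2)[of "lr_prod c"] H_D(3)[OF prod_closed c] by simp
  note \<Delta>c = lin_hom_closed[OF comult_lin c]
  have "\<mu> U f g c = \<phi> (lr_prod c)"
    using mult_natural[OF S2 U \<phi> left_closed right_closed c] by (simp add: left right)
  also have "\<dots> = \<psi> (X2.proj_module (lr_prod c))"
    using H_D(3)[OF prod_closed c] \<psi>c[OF n] by (simp add: \<phi>_def X2.lift_def prod_proj_base[OF c] \<phi>1_zero)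
  also have "\<dots> = tensor_mult R U f (\<lambda>d. \<phi>1 (t1 \<zero>\<^bsub>R\<^esub> d)) (comult c)"
    unfolding prod_proj_module[OF c] \<psi>_def
    by (rule tensor_mult_tensor_hom[OF U C C C module_alg_mod[OF S1] fl \<phi>1l lin_hom_id t1_lin \<Delta>c])
  also have "\<dots> = tensor_mult R U f g (comult c)"
    by (rule tensor_mult_cong[OF U C C fl H_D(1)[OF g] _ _ \<Delta>c]) (simp_all add: \<phi>1t)
  finally show "\<mu> U f g c = conv comult U f g c"
    using c by (simp add: conv_def)
qed

text \<open>The restriction to square-zero maps is removed by multiplying with the nilpotent element of the
  dual numbers \<open>E\<close> over \<open>U\<close>.\<close>

lemma mult_eq_conv_scale:
  assumes U: "U \<in> Calg R" and E: "trivial_extension R U (ring_as_module (fst U)) E t"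
    and z: "z \<in> carrier (fst E)" and w: "w \<in> carrier (fst E)"
    and zw: "\<And>s. s \<in> carrier (fst U) \<Longrightarrow> z \<otimes>\<^bsub>fst E\<^esub> (w \<otimes>\<^bsub>fst E\<^esub> t s \<zero>\<^bsub>fst U\<^esub>) = t \<zero>\<^bsub>fst U\<^esub> s"
    and f: "f \<in> carrier (Ob H U)" and g: "g \<in> carrier (Ob H U)"
    and eq: "\<mu> E (z \<odot>\<^bsub>Ob H E\<^esub> Ar H U E (trivial_extension.incl U (ring_as_module (fst U)) t) f)
        (w \<odot>\<^bsub>Ob H E\<^esub> Ar H U E (trivial_extension.incl U (ring_as_module (fst U)) t) g) =
      conv comult E (z \<odot>\<^bsub>Ob H E\<^esub> Ar H U E (trivial_extension.incl U (ring_as_module (fst U)) t) f)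
        (w \<odot>\<^bsub>Ob H E\<^esub> Ar H U E (trivial_extension.incl U (ring_as_module (fst U)) t) g)"
  shows "\<mu> U f g = conv comult U f g"
proof -
  interpret E: trivial_extension R U "ring_as_module (fst U)" E t by (rule E)
  note EC = E.E_Calg and i = E.incl_alg_hom
  let ?i = "Ar H U E E.incl"
  note fi = H_Ar_closed[OF U i f] and gi = H_Ar_closed[OF U i g]
  \<comment> \<open>Stated for a general product \<nu> in order to serve \<mu> and the convolution
    alike: bilinearity pulls out z and w, which together shift the value into the nilpotent summand
    of E, from where \<open>proj_module\<close> recovers it.\<close>
  have scale: "\<nu> E (z \<odot>\<^bsub>Ob H E\<^esub> ?i f) (w \<odot>\<^bsub>Ob H E\<^esub> ?i g) c = t \<zero>\<^bsub>fst U\<^esub> (\<nu> U f g c)"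
    if \<nu>: "\<nu> E \<in> bilin (fst E) (Ob H E) (Ob H E) (Ob H E)" "\<nu> U f g \<in> carrier (Ob H U)"
      and nat: "?i (\<nu> U f g) = \<nu> E (?i f) (?i g)" and c: "c \<in> carrier C" for \<nu> c
  proof -
    have "\<nu> E (z \<odot>\<^bsub>Ob H E\<^esub> ?i f) (w \<odot>\<^bsub>Ob H E\<^esub> ?i g) = z \<odot>\<^bsub>Ob H E\<^esub> (w \<odot>\<^bsub>Ob H E\<^esub> ?i (\<nu> U f g))"
      using lin_hom_smult[OF bilinD(2)[OF \<nu>(1) H_smult_closed[OF EC w gi]] z fi]
        lin_hom_smult[OF bilinD(1)[OF \<nu>(1) fi] w gi] nat by simp
    then show ?thesis
      using c zw[OF H_D(3)[OF \<nu>(2) c]] H_D(3)[OF \<nu>(2) c] by (simp add: H_simps compose_eq E.incl_def)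
  qed
  note 1 = bilinD(3)[OF alg_structureD(1)[OF A U] f g] and 2 = conv_closed[OF comult_lin U f g]
  show ?thesis
  proof (rule H_eqI[OF 1 2])
    fix c assume c: "c \<in> carrier C"
    have "t \<zero>\<^bsub>fst U\<^esub> (\<mu> U f g c) = t \<zero>\<^bsub>fst U\<^esub> (conv comult U f g c)"
      using scale[of \<mu>, OF alg_structureD(1)[OF A EC] 1 alg_structureD(7)[OF A U EC i f g] c]
        scale[of "conv comult", OF conv_bilin[OF comult_lin EC] 2 conv_natural[OF comult_lin U EC i f g] c] eq
      by simp
    then have "E.proj_module (t \<zero>\<^bsub>fst U\<^esub> (\<mu> U f g c)) = E.proj_module (t \<zero>\<^bsub>fst U\<^esub> (conv comult U f g c))"
      by (rule arg_cong)
    then show "\<mu> U f g c = conv comult U f g c"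
      using H_D(3)[OF 1 c] H_D(3)[OF 2 c] by simp
  qed
qed

text \<open>Scaling by the nilpotent \<epsilon> makes any map square-zero. Both factors cannot be
  scaled by the same \<epsilon>, since \<epsilon> \<epsilon> = 0 would erase the product, so the two
  restrictions are removed one after the other.\<close>

lemma mult_eq_conv:
  assumes U: "U \<in> Calg R" and f: "f \<in> carrier (Ob H U)" and g: "g \<in> carrier (Ob H U)"
  shows "\<mu> U f g = conv comult U f g"
proof -
  have step: "\<exists>E t. trivial_extension R U (ring_as_module (fst U)) E t" if U: "U \<in> Calg R" for U
  proof -
    have "carrier (ring_as_module (fst U)) \<lesssim> (UNIV :: 'u set)" by (rule subset_imp_lepoll) simp
    from trivial_extension_exists[OF inf this R.ring_axioms U module_ring[OF CalgD(1)[OF U]]]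
    show ?thesis by blast
  qed
  \<comment> \<open>f keeps its square-zero image in the dual numbers, so only g is scaled by
    \<epsilon>.\<close>
  have half: "\<mu> U f g = conv comult U f g"
    if U: "U \<in> Calg R" and f: "f \<in> carrier (Ob H U)" and g: "g \<in> carrier (Ob H U)" and f0: "square_zero U f"
    for U f g
  proof -
    obtain E t where ET: "trivial_extension R U (ring_as_module (fst U)) E t" using step[OF U] by blast
    interpret E: trivial_extension R U "ring_as_module (fst U)" E t by (rule ET)
    let ?i = "Ar H U E E.incl" and ?\<epsilon> = "t \<zero>\<^bsub>fst U\<^esub> \<one>\<^bsub>fst U\<^esub>"
    have \<epsilon>: "?\<epsilon> \<in> carrier (fst E)" by simp
    have i_apply: "?i h c = t (h c) \<zero>\<^bsub>fst U\<^esub>" if "h \<in> carrier (Ob H U)" "c \<in> carrier C" for h c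
      using that H_D(3)[OF that] by (simp add: H_simps compose_eq E.incl_def)
    show ?thesis
    proof (rule mult_eq_conv_scale[OF U ET E.E.one_closed \<epsilon> _ f g])
      show "\<one>\<^bsub>fst E\<^esub> \<otimes>\<^bsub>fst E\<^esub> (?\<epsilon> \<otimes>\<^bsub>fst E\<^esub> t s \<zero>\<^bsub>fst U\<^esub>) = t \<zero>\<^bsub>fst U\<^esub> s" if "s \<in> carrier (fst U)" for s
        using that by (simp add: E.mult)
      note fi = H_Ar_closed[OF U E.incl_alg_hom f] and gi = H_Ar_closed[OF U E.incl_alg_hom g]
      show "\<mu> E (\<one>\<^bsub>fst E\<^esub> \<odot>\<^bsub>Ob H E\<^esub> ?i f) (?\<epsilon> \<odot>\<^bsub>Ob H E\<^esub> ?i g) =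
          conv comult E (\<one>\<^bsub>fst E\<^esub> \<odot>\<^bsub>Ob H E\<^esub> ?i f) (?\<epsilon> \<odot>\<^bsub>Ob H E\<^esub> ?i g)"
      proof (rule mult_eq_conv_square_zero[OF E.E_Calg H_smult_closed[OF E.E_Calg E.E.one_closed fi]
            H_smult_closed[OF E.E_Calg \<epsilon> gi]]; intro ballI)
        fix c d assume cd: "c \<in> carrier C" "d \<in> carrier C"
        show "(\<one>\<^bsub>fst E\<^esub> \<odot>\<^bsub>Ob H E\<^esub> ?i f) c \<otimes>\<^bsub>fst E\<^esub> (\<one>\<^bsub>fst E\<^esub> \<odot>\<^bsub>Ob H E\<^esub> ?i f) d = \<zero>\<^bsub>fst E\<^esub>"
          using cd f0 H_D(3)[OF f] by (simp add: H_simps(4) i_apply f E.mult E.zero)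
        show "(?\<epsilon> \<odot>\<^bsub>Ob H E\<^esub> ?i g) c \<otimes>\<^bsub>fst E\<^esub> (?\<epsilon> \<odot>\<^bsub>Ob H E\<^esub> ?i g) d = \<zero>\<^bsub>fst E\<^esub>"
          using cd H_D(3)[OF g] by (simp add: H_simps(4) i_apply g E.mult E.zero)
      qed
    qed
  qed
  obtain E t where ET: "trivial_extension R U (ring_as_module (fst U)) E t" using step[OF U] by blast
  interpret E: trivial_extension R U "ring_as_module (fst U)" E t by (rule ET)
  let ?i = "Ar H U E E.incl" and ?\<epsilon> = "t \<zero>\<^bsub>fst U\<^esub> \<one>\<^bsub>fst U\<^esub>"
  have \<epsilon>: "?\<epsilon> \<in> carrier (fst E)" by simp
  have i_apply: "?i h c = t (h c) \<zero>\<^bsub>fst U\<^esub>" if "h \<in> carrier (Ob H U)" "c \<in> carrier C" for h c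
    using that H_D(3)[OF that] by (simp add: H_simps compose_eq E.incl_def)
  show ?thesis
  \<comment> \<open>Now f is scaled and g is left arbitrary, which is the situation of
    \<open>half\<close> over the dual numbers.\<close>
  proof (rule mult_eq_conv_scale[OF U ET \<epsilon> E.E.one_closed _ f g])
    show "?\<epsilon> \<otimes>\<^bsub>fst E\<^esub> (\<one>\<^bsub>fst E\<^esub> \<otimes>\<^bsub>fst E\<^esub> t s \<zero>\<^bsub>fst U\<^esub>) = t \<zero>\<^bsub>fst U\<^esub> s" if "s \<in> carrier (fst U)" for s
      using that by (simp add: E.mult)
    note fi = H_Ar_closed[OF U E.incl_alg_hom f] and gi = H_Ar_closed[OF U E.incl_alg_hom g]
    show "\<mu> E (?\<epsilon> \<odot>\<^bsub>Ob H E\<^esub> ?i f) (\<one>\<^bsub>fst E\<^esub> \<odot>\<^bsub>Ob H E\<^esub> ?i g) =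
        conv comult E (?\<epsilon> \<odot>\<^bsub>Ob H E\<^esub> ?i f) (\<one>\<^bsub>fst E\<^esub> \<odot>\<^bsub>Ob H E\<^esub> ?i g)"
    proof (rule half[OF E.E_Calg H_smult_closed[OF E.E_Calg \<epsilon> fi]
          H_smult_closed[OF E.E_Calg E.E.one_closed gi]]; intro ballI)
      fix c d assume cd: "c \<in> carrier C" "d \<in> carrier C"
      show "(?\<epsilon> \<odot>\<^bsub>Ob H E\<^esub> ?i f) c \<otimes>\<^bsub>fst E\<^esub> (?\<epsilon> \<odot>\<^bsub>Ob H E\<^esub> ?i f) d = \<zero>\<^bsub>fst E\<^esub>"
        using cd H_D(3)[OF f] by (simp add: H_simps(4) i_apply f E.mult E.zero)
    qed
  qed
qed

text \<open>The unit law for \<open>base\<close> over S1 says that the map r \<otimes> d \<mapsto> r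
  d into the summand C of S1 sends (\<epsilon> \<otimes> id)(\<Delta>(c)) to c. This map identifies
  R \<otimes> C with C, so the counit law follows; the other side is symmetric.\<close>

lemma counit:
  defines "\<epsilon> \<equiv> \<lambda>c\<in>carrier C. e (self_alg R) c"
  shows "\<epsilon> \<in> lin_hom R C (ring_as_module R)"
    and "c \<in> carrier C \<Longrightarrow> tensor_hom R (ring_as_module R) C \<epsilon> (\<lambda>x. x) (comult c) =
      pure_tensor R (ring_as_module R) C \<one>\<^bsub>R\<^esub> c"
    and "c \<in> carrier C \<Longrightarrow> tensor_hom R C (ring_as_module R) (\<lambda>x. x) \<epsilon> (comult c) =
      pure_tensor R C (ring_as_module R) c \<one>\<^bsub>R\<^esub>"
proof -
  note self = self_alg_Calg[OF R]
  note modR = module_ring[OF R]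
  have e: "e (self_alg R) \<in> carrier (Ob H (self_alg R))" by (rule alg_structureD(2)[OF A self])
  have eR: "e (self_alg R) c \<in> carrier R" if "c \<in> carrier C" for c
    using H_D(3)[OF e that] by simp
  show \<epsilon>: "\<epsilon> \<in> lin_hom R C (ring_as_module R)"
    using eR H_D(4,5)[OF e] by (intro lin_homI) (simp_all add: \<epsilon>_def)
  \<comment> \<open>The unit over S1 is the image of the unit over R under the structure
    map.\<close>
  have e1: "e S1 d = snd S1 (\<epsilon> d)" if "d \<in> carrier C" for d
    using fun_cong[OF alg_structureD(6)[OF A self S1 snd_alg_hom_self[OF R S1]], of d] that
    by (simp add: H_simps compose_eq \<epsilon>_def)
  have e1c: "e S1 \<in> carrier (Ob H S1)" by (rule alg_structureD(2)[OF A S1])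
  note sl = snd_lin[OF S1]
  note snd_\<epsilon> = lin_hom_comp[OF sl \<epsilon>]
  fix c assume c: "c \<in> carrier C"
  note \<Delta>c = lin_hom_closed[OF comult_lin c]
  note bl = H_D(1)[OF base_closed]
  let ?L = "tensor_mult R S1 (snd S1) base" and ?y = "tensor_hom R (ring_as_module R) C \<epsilon> (\<lambda>x. x) (comult c)"
  note L = tensor_mult_lin[OF S1 modR C sl bl]
  have y: "?y \<in> carrier (tensor R (ring_as_module R) C)"
    by (rule lin_hom_closed[OF tensor_hom_lin[OF C C modR C \<epsilon> lin_hom_id] \<Delta>c])
  have "\<mu> S1 (e S1) base c = tensor_mult R S1 (e S1) base (comult c)"
    using c by (simp add: mult_eq_conv[OF S1 e1c base_closed] conv_def)
  also have "\<dots> = tensor_mult R S1 (\<lambda>d. snd S1 (\<epsilon> d)) base (comult c)"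
    by (rule tensor_mult_cong[OF S1 C C snd_\<epsilon> bl _ _ \<Delta>c]) (simp_all add: e1)
  also have "\<dots> = ?L ?y"
    by (rule tensor_mult_tensor_hom[OF S1 C C modR C sl bl \<epsilon> lin_hom_id \<Delta>c, symmetric])
  finally have Ly: "?L ?y = t1 \<zero>\<^bsub>R\<^esub> c"
    using alg_structureD(3)[OF A S1 base_closed] c by (simp add: base_def)
  \<comment> \<open>Projecting to C and tensoring with 1 inverts \<open>?L\<close>, because r
    \<otimes> d = 1 \<otimes> r d.\<close>
  have "(\<lambda>x. pure_tensor R (ring_as_module R) C \<one>\<^bsub>R\<^esub> (X1.proj_module (?L x))) \<in>
      lin_hom R (tensor R (ring_as_module R) C) (tensor R (ring_as_module R) C)"
    using lin_hom_comp[OF bilinD(1)[OF pure_tensor_bilin[OF modR C], of "\<one>\<^bsub>R\<^esub>"] lin_hom_comp[OF proj1_lin L]]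
    by simp
  from modR C this lin_hom_id
  have "pure_tensor R (ring_as_module R) C \<one>\<^bsub>R\<^esub> (X1.proj_module (?L ?y)) = ?y"
  proof (rule tensor_hom_ext[OF _ _ _ _ _ y])
    fix r d assume "r \<in> carrier (ring_as_module R)" and d: "d \<in> carrier C"
    then have r: "r \<in> carrier R" by simp
    have "pure_tensor R (ring_as_module R) C \<one>\<^bsub>R\<^esub> (r \<odot>\<^bsub>C\<^esub> d) = pure_tensor R (ring_as_module R) C r d"
      using lin_hom_smult[OF bilinD(1)[OF pure_tensor_bilin[OF modR C], of "\<one>\<^bsub>R\<^esub>"] r d]
        lin_hom_smult[OF bilinD(2)[OF pure_tensor_bilin[OF modR C] d] r, of "\<one>\<^bsub>R\<^esub>"] r by simp
    then show "pure_tensor R (ring_as_module R) C \<one>\<^bsub>R\<^esub>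
        (X1.proj_module (?L (pure_tensor R (ring_as_module R) C r d))) = pure_tensor R (ring_as_module R) C r d"
      using r d by (simp add: tensor_mult_pure[OF S1 modR C sl bl] base_apply X1.proj_module_scalar)
  qed
  then show "?y = pure_tensor R (ring_as_module R) C \<one>\<^bsub>R\<^esub> c"
    using c by (simp add: Ly)
  let ?L' = "tensor_mult R S1 base (snd S1)" and ?y' = "tensor_hom R C (ring_as_module R) (\<lambda>x. x) \<epsilon> (comult c)"
  note L' = tensor_mult_lin[OF S1 C modR bl sl]
  have y': "?y' \<in> carrier (tensor R C (ring_as_module R))"
    by (rule lin_hom_closed[OF tensor_hom_lin[OF C C C modR lin_hom_id \<epsilon>] \<Delta>c])
  have "\<mu> S1 base (e S1) c = tensor_mult R S1 base (e S1) (comult c)"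
    using c by (simp add: mult_eq_conv[OF S1 base_closed e1c] conv_def)
  also have "\<dots> = tensor_mult R S1 base (\<lambda>d. snd S1 (\<epsilon> d)) (comult c)"
    by (rule tensor_mult_cong[OF S1 C C bl snd_\<epsilon> _ _ \<Delta>c]) (simp_all add: e1)
  also have "\<dots> = ?L' ?y'"
    by (rule tensor_mult_tensor_hom[OF S1 C C C modR bl sl lin_hom_id \<epsilon> \<Delta>c, symmetric])
  finally have Ly': "?L' ?y' = t1 \<zero>\<^bsub>R\<^esub> c"
    using alg_structureD(4)[OF A S1 base_closed] c by (simp add: base_def)
  have "(\<lambda>x. pure_tensor R C (ring_as_module R) (X1.proj_module (?L' x)) \<one>\<^bsub>R\<^esub>) \<in>
      lin_hom R (tensor R C (ring_as_module R)) (tensor R C (ring_as_module R))"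
    using lin_hom_comp[OF bilinD(2)[OF pure_tensor_bilin[OF C modR], of "\<one>\<^bsub>R\<^esub>"] lin_hom_comp[OF proj1_lin L']]
    by simp
  from C modR this lin_hom_id
  have "pure_tensor R C (ring_as_module R) (X1.proj_module (?L' ?y')) \<one>\<^bsub>R\<^esub> = ?y'"
  proof (rule tensor_hom_ext[OF _ _ _ _ _ y'])
    fix d r assume "r \<in> carrier (ring_as_module R)" and d: "d \<in> carrier C"
    then have r: "r \<in> carrier R" by simp
    have "pure_tensor R C (ring_as_module R) (r \<odot>\<^bsub>C\<^esub> d) \<one>\<^bsub>R\<^esub> = pure_tensor R C (ring_as_module R) d r"
      using lin_hom_smult[OF bilinD(2)[OF pure_tensor_bilin[OF C modR], of "\<one>\<^bsub>R\<^esub>"] r d]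
        lin_hom_smult[OF bilinD(1)[OF pure_tensor_bilin[OF C modR] d] r, of "\<one>\<^bsub>R\<^esub>"] r by simp
    moreover have "t1 \<zero>\<^bsub>R\<^esub> d \<otimes>\<^bsub>fst S1\<^esub> snd S1 r = snd S1 r \<otimes>\<^bsub>fst S1\<^esub> t1 \<zero>\<^bsub>R\<^esub> d"
      using d CalgD(4)[OF S1 r] by (intro X1.E.m_comm) simp_all
    ultimately show "pure_tensor R C (ring_as_module R)
        (X1.proj_module (?L' (pure_tensor R C (ring_as_module R) d r))) \<one>\<^bsub>R\<^esub> = pure_tensor R C (ring_as_module R) d r"
      using r d by (simp add: tensor_mult_pure[OF S1 C modR bl sl] base_apply X1.proj_module_scalar)
  qed
  then show "?y' = pure_tensor R C (ring_as_module R) c \<one>\<^bsub>R\<^esub>"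
    using c by (simp add: Ly')
qed

text \<open>Over S3 there are three copies of C, whose product map \<open>L\<close> embeds C
  \<otimes> C \<otimes> C with left inverse \<open>K\<close>. Associativity of the convolution of
  the three inclusions says that \<open>L\<close> agrees on the two sides of
  coassociativity.\<close>

lemma comult_coassoc:
  assumes T3: "trivial_extension R S2 (Ob Q S2) S3 t3" and c: "c \<in> carrier C"
  shows "tensor_assoc R C C C (tensor_hom R (tensor R C C) C comult (\<lambda>x. x) (comult c)) =
    tensor_hom R C (tensor R C C) (\<lambda>x. x) comult (comult c)"
proof -
  interpret X3: trivial_extension R S2 "Ob Q S2" S3 t3 by (rule T3)
  note S3 = X3.E_Calg
  let ?T2 = "tensor R C (alg_mod S2)" and ?CC = "tensor R C C"
  note CC = module_tensor[OF C C]
  note l2 = pt_lin(1)[OF S2 X2.E.one_closed]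
  have pt2: "pt S2 c s \<in> carrier ?T2" if "c \<in> carrier C" "s \<in> carrier (fst S2)" for c s
    by (rule pt_closed[OF S2 that])
  have T0: "\<zero>\<^bsub>?T2\<^esub> \<in> carrier ?T2" using X3.N.M.zero_closed by simp
  have T10: "\<zero>\<^bsub>T1C\<^esub> \<in> carrier T1C" using X2.N.M.zero_closed by simp
  have null2: "\<zero>\<^bsub>fst S2\<^esub> \<odot>\<^bsub>Ob Q S2\<^esub> n = \<zero>\<^bsub>?T2\<^esub>" "s \<odot>\<^bsub>Ob Q S2\<^esub> \<zero>\<^bsub>?T2\<^esub> = \<zero>\<^bsub>?T2\<^esub>"
    if "n \<in> carrier ?T2" "s \<in> carrier (fst S2)" for n s
    using X3.N.smult_l_null[of n] X3.N.smult_r_null[of s] that by simp_all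
  have null1: "\<zero>\<^bsub>fst S1\<^esub> \<odot>\<^bsub>Ob Q S1\<^esub> n = \<zero>\<^bsub>T1C\<^esub>" if "n \<in> carrier T1C" for n
    using X2.N.smult_l_null[of n] that by simp
  \<comment> \<open>The copy C \<otimes> 1 of C in the summand C \<otimes> S2, analogous to
    \<open>left\<close> one level lower.\<close>
  define f3 where "f3 = (\<lambda>c\<in>carrier C. t3 \<zero>\<^bsub>fst S2\<^esub> (pt S2 c \<one>\<^bsub>fst S2\<^esub>))"
  have f3: "f3 \<in> carrier (Ob H S3)"
    unfolding f3_def
  proof (rule H_restrictI, rule lin_homI)
    fix c assume c: "c \<in> carrier C"
    show "t3 \<zero>\<^bsub>fst S2\<^esub> (pt S2 c \<one>\<^bsub>fst S2\<^esub>) \<in> carrier (alg_mod S3)"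
      using pt2[OF c] by simp
    show "t3 \<zero>\<^bsub>fst S2\<^esub> (pt S2 (c \<oplus>\<^bsub>C\<^esub> d) \<one>\<^bsub>fst S2\<^esub>) =
        t3 \<zero>\<^bsub>fst S2\<^esub> (pt S2 c \<one>\<^bsub>fst S2\<^esub>) \<oplus>\<^bsub>alg_mod S3\<^esub> t3 \<zero>\<^bsub>fst S2\<^esub> (pt S2 d \<one>\<^bsub>fst S2\<^esub>)"
      if d: "d \<in> carrier C" for d
      using pt2[OF c] pt2[OF d] lin_hom_add[OF l2 c d] by (simp add: X3.add)
    show "t3 \<zero>\<^bsub>fst S2\<^esub> (pt S2 (r \<odot>\<^bsub>C\<^esub> c) \<one>\<^bsub>fst S2\<^esub>) =
        r \<odot>\<^bsub>alg_mod S3\<^esub> t3 \<zero>\<^bsub>fst S2\<^esub> (pt S2 c \<one>\<^bsub>fst S2\<^esub>)" if r: "r \<in> carrier R" for r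
      using pt2[OF c] lin_hom_smult[OF l2 r c] r CalgD(4)[OF S2 r] T0
        X3.N.smult_closed[of "snd S2 r" "pt S2 c \<one>\<^bsub>fst S2\<^esub>"]
        Q_smult_scalar[OF S2 r pt2[OF c X2.E.one_closed]] X3.N.M.r_zero
      by (simp add: X3.scalar X3.mult null2)
  qed
  note i3 = X3.incl_alg_hom
  \<comment> \<open>The two copies already present in S2, included into S3.\<close>
  define f2 where "f2 = Ar H S2 S3 X3.incl left"
  define f1 where "f1 = Ar H S2 S3 X3.incl right"
  have f2: "f2 \<in> carrier (Ob H S3)" unfolding f2_def by (rule H_Ar_closed[OF S2 i3 left_closed])
  have f1: "f1 \<in> carrier (Ob H S3)" unfolding f1_def by (rule H_Ar_closed[OF S2 i3 right_closed])
  note fl3 = H_D(1)[OF f3] and fl2 = H_D(1)[OF f2] and fl1 = H_D(1)[OF f1]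
  have m: "\<mu> S3 f g \<in> carrier (Ob H S3)" if "f \<in> carrier (Ob H S3)" "g \<in> carrier (Ob H S3)" for f g
    using bilinD(3)[OF alg_structureD(1)[OF A S3] that] .
  \<comment> \<open>Associativity of the given product, rewritten by \<open>mult_eq_conv\<close>;
    this is the only associativity that enters.\<close>
  have "conv comult S3 (conv comult S3 f3 f2) f1 = conv comult S3 f3 (conv comult S3 f2 f1)"
    using alg_structureD(5)[OF A S3 f3 f2 f1] m[OF f3 f2] m[OF f2 f1]
    by (simp add: mult_eq_conv[OF S3] f1 f2 f3)
  from fun_cong[OF this, of c]
  have *: "tensor_mult R S3 (conv comult S3 f3 f2) f1 (comult c) =
      tensor_mult R S3 f3 (conv comult S3 f2 f1) (comult c)"
    using c by (simp add: conv_def[of comult S3 "conv comult S3 f3 f2"] conv_def[of comult S3 f3 "conv comult S3 f2 f1"])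
  note \<Delta>c = lin_hom_closed[OF comult_lin c]
  define L where "L = tensor_mult R S3 f3 (tensor_mult R S3 f2 f1)"
  note l21 = tensor_mult_lin[OF S3 C C fl2 fl1]
  have L: "L \<in> lin_hom R (tensor R C ?CC) (alg_mod S3)"
    unfolding L_def by (rule tensor_mult_lin[OF S3 C CC fl3 l21])
  define a where "a = tensor_assoc R C C C (tensor_hom R ?CC C comult (\<lambda>x. x) (comult c))"
  define b where "b = tensor_hom R C ?CC (\<lambda>x. x) comult (comult c)"
  have a: "a \<in> carrier (tensor R C ?CC)"
    unfolding a_def by (rule lin_hom_closed[OF tensor_assoc_lin[OF C C C]
      lin_hom_closed[OF tensor_hom_lin[OF C C CC C comult_lin lin_hom_id] \<Delta>c]])
  have b: "b \<in> carrier (tensor R C ?CC)"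
    unfolding b_def by (rule lin_hom_closed[OF tensor_hom_lin[OF C C C CC lin_hom_id comult_lin] \<Delta>c])
  have "L a = L b"
    using * conv_left[OF comult_lin S3 f3 f2 f1 \<Delta>c] conv_right[OF comult_lin S3 f3 f2 f1 \<Delta>c]
    by (simp add: L_def a_def b_def)
  moreover
  \<comment> \<open>Successive projections S3 to C \<otimes> S2, S2 to C \<otimes> S1 and S1 to C,
    each applied in the last tensor factor.\<close>
  define k where "k x = tensor_hom R C C (\<lambda>c. c) X1.proj_module (X2.proj_module x)" for x
  define K where "K x = tensor_hom R C ?CC (\<lambda>c. c) k (X3.proj_module x)" for x
  have k: "k \<in> lin_hom R (alg_mod S2) ?CC"
    unfolding k_def[abs_def] by (rule lin_hom_comp[OF tensor_proj1_lin proj2_lin])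
  have proj3: "X3.proj_module \<in> lin_hom R (alg_mod S3) ?T2"
    using X3.proj_closed(2) X3.proj_module_add Q_smult_scalar[OF S2]
    by (intro lin_homI) (simp_all add: X3.proj_module_scalar)
  note k_lin = tensor_hom_lin[OF C module_alg_mod[OF S2] C CC lin_hom_id k]
    and k_pure = tensor_hom_pure[OF C module_alg_mod[OF S2] C CC lin_hom_id k]
  note \<pi>_pure = tensor_hom_pure[OF C module_alg_mod[OF S1] C C lin_hom_id proj1_lin]
  have K: "K \<in> lin_hom R (alg_mod S3) (tensor R C ?CC)"
    unfolding K_def[abs_def] by (rule lin_hom_comp[OF k_lin proj3])
  have KL: "K (L x) = x" if "x \<in> carrier (tensor R C ?CC)" for x
  proof (rule tensor_hom_ext3'[OF C C C lin_hom_comp[OF K L] lin_hom_id _ that])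
    fix c1 c2 c3 assume cs: "c1 \<in> carrier C" "c2 \<in> carrier C" "c3 \<in> carrier C"
    have p: "pt S1 c2 (t1 \<zero>\<^bsub>R\<^esub> c3) \<in> carrier T1C"
      using cs by (intro pt_closed[OF S1]) simp_all
    \<comment> \<open>Products with the nilpotent summands accumulate in the last factor: right(c3)
      acts as a scalar on c2 \<otimes> 1. The same computation one level up yields c1 \<otimes> (c2
      \<otimes> c3).\<close>
    have y: "left c2 \<otimes>\<^bsub>fst S2\<^esub> right c3 = t2 \<zero>\<^bsub>fst S1\<^esub> (pt S1 c2 (t1 \<zero>\<^bsub>R\<^esub> c3))"
    proof -
      have "t2 \<zero>\<^bsub>fst S1\<^esub> (pt S1 c2 \<one>\<^bsub>fst S1\<^esub>) \<otimes>\<^bsub>fst S2\<^esub> t2 (t1 \<zero>\<^bsub>R\<^esub> c3) \<zero>\<^bsub>T1C\<^esub> =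
          t2 (\<zero>\<^bsub>fst S1\<^esub> \<otimes>\<^bsub>fst S1\<^esub> t1 \<zero>\<^bsub>R\<^esub> c3)
            (\<zero>\<^bsub>fst S1\<^esub> \<odot>\<^bsub>Ob Q S1\<^esub> \<zero>\<^bsub>T1C\<^esub> \<oplus>\<^bsub>Ob Q S1\<^esub> t1 \<zero>\<^bsub>R\<^esub> c3 \<odot>\<^bsub>Ob Q S1\<^esub> pt S1 c2 \<one>\<^bsub>fst S1\<^esub>)"
        using cs pt1_closed[OF cs(2)] T10 by (intro X2.mult) simp_all
      also have "\<dots> = t2 \<zero>\<^bsub>fst S1\<^esub> (pt S1 c2 (t1 \<zero>\<^bsub>R\<^esub> c3))"
        using cs p T10 X2.N.M.l_zero[of "pt S1 c2 (t1 \<zero>\<^bsub>R\<^esub> c3)"] by (simp add: null1 Q_smult_pt[OF S1])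
      finally show ?thesis using cs by (simp add: left_apply right_apply)
    qed
    have lr: "left c2 \<in> carrier (fst S2)" "right c3 \<in> carrier (fst S2)"
      using H_D(3)[OF left_closed cs(2)] H_D(3)[OF right_closed cs(3)] .
    have "f2 c2 \<otimes>\<^bsub>fst S3\<^esub> f1 c3 = X3.incl (left c2 \<otimes>\<^bsub>fst S2\<^esub> right c3)"
      using cs lr by (simp add: f2_def f1_def H_simps compose_eq ring_hom_mult[OF alg_homD(1)[OF i3]])
    also have "\<dots> = t3 (t2 \<zero>\<^bsub>fst S1\<^esub> (pt S1 c2 (t1 \<zero>\<^bsub>R\<^esub> c3))) \<zero>\<^bsub>?T2\<^esub>"
      using p by (simp add: y X3.incl_def)
    finally have 21: "f2 c2 \<otimes>\<^bsub>fst S3\<^esub> f1 c3 = t3 (t2 \<zero>\<^bsub>fst S1\<^esub> (pt S1 c2 (t1 \<zero>\<^bsub>R\<^esub> c3))) \<zero>\<^bsub>?T2\<^esub>" .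
    let ?w = "t2 \<zero>\<^bsub>fst S1\<^esub> (pt S1 c2 (t1 \<zero>\<^bsub>R\<^esub> c3))"
    have w: "?w \<in> carrier (fst S2)" using p by simp
    have "t3 \<zero>\<^bsub>fst S2\<^esub> (pt S2 c1 \<one>\<^bsub>fst S2\<^esub>) \<otimes>\<^bsub>fst S3\<^esub> t3 ?w \<zero>\<^bsub>?T2\<^esub> =
        t3 (\<zero>\<^bsub>fst S2\<^esub> \<otimes>\<^bsub>fst S2\<^esub> ?w)
          (\<zero>\<^bsub>fst S2\<^esub> \<odot>\<^bsub>Ob Q S2\<^esub> \<zero>\<^bsub>?T2\<^esub> \<oplus>\<^bsub>Ob Q S2\<^esub> ?w \<odot>\<^bsub>Ob Q S2\<^esub> pt S2 c1 \<one>\<^bsub>fst S2\<^esub>)"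
      using cs pt2[OF cs(1)] T0 w by (intro X3.mult) simp_all
    also have "\<dots> = t3 \<zero>\<^bsub>fst S2\<^esub> (pt S2 c1 ?w)"
      using cs w T0 pt2[OF cs(1) w] X3.N.M.l_zero[of "pt S2 c1 ?w"] by (simp add: null2 Q_smult_pt[OF S2])
    finally have 3: "f3 c1 \<otimes>\<^bsub>fst S3\<^esub> t3 ?w \<zero>\<^bsub>?T2\<^esub> = t3 \<zero>\<^bsub>fst S2\<^esub> (pt S2 c1 ?w)"
      using cs by (simp add: f3_def)
    have pc: "pure_tensor R C C c2 c3 \<in> carrier ?CC" by (rule pure_tensor_closed[OF C C cs(2,3)])
    have "L (pure_tensor R C ?CC c1 (pure_tensor R C C c2 c3)) = t3 \<zero>\<^bsub>fst S2\<^esub> (pt S2 c1 ?w)"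
      unfolding L_def tensor_mult_pure[OF S3 C CC fl3 l21 cs(1) pc] tensor_mult_pure[OF S3 C C fl2 fl1 cs(2,3)]
      by (simp only: 21 3)
    then show "K (L (pure_tensor R C ?CC c1 (pure_tensor R C C c2 c3))) =
        pure_tensor R C ?CC c1 (pure_tensor R C C c2 c3)"
      using cs w p pt2[OF cs(1) w] by (simp add: K_def k_pure k_def \<pi>_pure)
  qed
  ultimately have "a = b" using KL[OF a] KL[OF b] by metis
  then show ?thesis by (simp add: a_def b_def)
qed

end

context quasi_coherent_setup
begin

lemma H_algebra_imp_coalgebra:
  assumes inf: "infinite (UNIV :: 'u set)" and card: "carrier C \<lesssim> (UNIV :: 'u set)"
    and A: "alg_structure R H \<mu> e"
  shows "is_coalgebra R C"
proof -
  note self = self_alg_Calg[OF R]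
  have "module (fst (self_alg R)) C" using C by simp
  from trivial_extension_exists[OF inf card R.ring_axioms self this]
  obtain S1 t1 where T1: "trivial_extension R (self_alg R) C S1 t1" .
  note S1 = trivial_extension.E_Calg[OF T1]
  \<comment> \<open>The module adjoined next must again fit into \<open>'u\<close>, which the bound
    on C \<otimes> S guarantees at each stage.\<close>
  from trivial_extension_exists[OF inf Q_carrier_lepoll[OF inf card S1] R.ring_axioms S1 Q_module[OF S1]]
  obtain S2 t2 where T2: "trivial_extension R S1 (Ob Q S1) S2 t2" .
  note S2 = trivial_extension.E_Calg[OF T2]
  from trivial_extension_exists[OF inf Q_carrier_lepoll[OF inf card S2] R.ring_axioms S2 Q_module[OF S2]]
  obtain S3 t3 where T3: "trivial_extension R S2 (Ob Q S2) S3 t3" .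
  interpret universal_pair R C \<mu> e S1 t1 S2 t2
    by (intro universal_pair.intro universal_pair_axioms.intro quasi_coherent_setup_axioms inf A T1 T2)
  show ?thesis
    unfolding is_coalgebra_def
    using C comult_lin counit comult_coassoc[OF T3] by blast
qed

theorem coalgebra_iff:
  assumes "infinite (UNIV :: 'u set)" "carrier C \<lesssim> (UNIV :: 'u set)"
  shows "is_coalgebra R C \<longleftrightarrow> is_algebra_functor R (dual R Q)"
  unfolding dual_Q_algebra_iff
  using coalgebra_imp_H_algebra H_algebra_imp_coalgebra[OF assms] by blast

end

theorem proposition5p3:
  fixes R :: "'u ring" and M :: "('u, 'm) mfun" and C :: "('u, 'c) module"
  assumes "cring R"
  shows "(module_functor R M \<longrightarrow>
            (is_coalgebra_functor R M \<longleftrightarrow> is_algebra_functor R (dual R M))) \<and>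
         (infinite (UNIV :: 'u set) \<and> module R C \<and> carrier C \<lesssim> (UNIV :: 'u set) \<longrightarrow>
            (is_coalgebra R C \<longleftrightarrow> is_algebra_functor R (dual R (quasi_coherent R C))))"
proof (intro conjI impI)
  assume "module_functor R M"
  then interpret dual_setup R M
    using assms by (simp add: dual_setup_def)
  show "is_coalgebra_functor R M \<longleftrightarrow> is_algebra_functor R (dual R M)"
    by (rule coalgebra_functor_iff)
next
  assume *: "infinite (UNIV :: 'u set) \<and> module R C \<and> carrier C \<lesssim> (UNIV :: 'u set)"
  then interpret quasi_coherent_setup R C
    using assms by (simp add: quasi_coherent_setup_def)
  show "is_coalgebra R C \<longleftrightarrow> is_algebra_functor R (dual R (quasi_coherent R C))"
    using * by (intro coalgebra_iff) simp_all
qed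

end
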